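(* Let $d\ge 1$ be an integer, $\sigma\in(0,1)$, $\mathcal L=-\Delta+(-\Delta)^\sigma$ on $\mathbb R^d$, $\theta\in\mathbb R$ with $\theta\ne 0$, and $p>1$. Consider the problem $$u_t+\mathcal L u=e^{\theta t}u^p\ \text{ in }\mathbb R^d\times(0,\infty),\qquad u(\cdot,0)=u_0 .$$ The mild solution of this problem blows up in finite time for every positive initial datum $u_0\in C_0(\mathbb R^d)\cap L^1(\mathbb R^d)$ if and only if $\theta>0$.
   Context: $C_0(\mathbb R^d)$ is the space of continuous functions on $\mathbb R^d$ vanishing at infinity. For $\sigma\in(0,1)$, $(-\Delta)^\sigma v(x)=C_{d,\sigma}\,\mathrm{P.V.}\int_{\mathbb R^d}\frac{v(x)-v(y)}{|x-y|^{d+2\sigma}}\,dy$ with $C_{d,\sigma}=\frac{2^{2\sigma-1}\,2\sigma\,\Gamma(\frac{d+2\sigma}{2})}{\pi^{d/2}\Gamma(1-\sigma)}$ is the fractional Laplacian (Fourier multiplier $|\xi|^{2\sigma}$). The heat semigroup generated by $-\mathcal L$ is $e^{-t\mathcal L}\phi(x)=\int_{\mathbb R^d}p_t(x-y)\phi(y)\,dy$, where $p_t(x)=(4\pi t)^{-d/2}\int_{\mathbb R^d}e^{-|x-\xi|^2/(4t)}H^\sigma_t(\xi)\,d\xi$ for $t>0$, and $H_t^\sigma$ is the heat kernel of $(-\Delta)^\sigma$. Mild solution of $u_t+\mathcal L u=h(t)f(u)$, $u(\cdot,0)=u_0$ (here $h(t)=e^{\theta t}$, $f(u)=u^p$): for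 nonnegative nontrivial $u_0\in L^\infty(\mathbb R^d)$ there is a nonnegative local-in-time mild solution $u\in C([0,T_{\max});L^\infty(\mathbb R^d))$ with maximal existence time $T_{\max}\le\infty$, i.e. $u(x,t)=e^{-t\mathcal L}u_0(x)+\int_0^t e^{-(t-s)\mathcal L}h(s)f(u(x,s))\,ds$ for all $t\in[0,T_{\max})$. It is global if $T_{\max}=\infty$; it blows up in finite time if $T_{\max}<\infty$, in which case $\lim_{t\to T_{\max}}\|u(\cdot,t)\|_{L^\infty(\mathbb R^d)}=\infty$. *)

theory Defs
  imports "HOL-Probability.Essential_Supremum"
begin

text \<open>
  The heat kernel of the fractional Laplacian, whose Fourier multiplier is
  \<open>\<bar>\<xi>\<bar> powr (2 * \<sigma>)\<close>: the inverse Fourier transform of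
  \<open>exp (- t * \<bar>\<xi>\<bar> powr (2 * \<sigma>))\<close>. The integral is real by symmetry, so \<open>Re\<close> only
  changes the type.
\<close>
definition frac_heat_kernel :: "real \<Rightarrow> real \<Rightarrow> 'a::euclidean_space \<Rightarrow> real" where
  "frac_heat_kernel \<sigma> t x =
     (1 / (2 * pi) ^ DIM('a)) *
     Re (LINT \<xi>|lborel. exp (\<i> * complex_of_real (x \<bullet> \<xi>)) *
           complex_of_real (exp (- t * norm \<xi> powr (2 * \<sigma>))))"

text \<open>
  The heat kernel of \<open>-\<Delta> + (-\<Delta>)\<^sup>\<sigma>\<close>: the convolution of the Gaussian with
  the kernel above. Meaningful for \<open>t > 0\<close> only.
\<close>
definition mixed_heat_kernel :: "real \<Rightarrow> real \<Rightarrow> 'a::euclidean_space \<Rightarrow> real" where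
  "mixed_heat_kernel \<sigma> t x =
     (4 * pi * t) powr (- real DIM('a) / 2) *
     (LINT \<xi>|lborel. exp (- (norm (x - \<xi>))\<^sup>2 / (4 * t)) * frac_heat_kernel \<sigma> t \<xi>)"

definition mixed_semigroup ::
    "real \<Rightarrow> real \<Rightarrow> ('a::euclidean_space \<Rightarrow> real) \<Rightarrow> 'a \<Rightarrow> real" where
  "mixed_semigroup \<sigma> t \<phi> x =
     (if t = 0 then \<phi> x else (LINT y|lborel. mixed_heat_kernel \<sigma> t (x - y) * \<phi> y))"

text \<open>
  Elements of \<open>L\<^sup>\<infinity>\<close> are represented by Borel functions; hence equations and
  inequalities between them are required only almost everywhere.
\<close>
definition Linf_norm :: "('a::euclidean_space \<Rightarrow> real) \<Rightarrow> ereal" where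
  "Linf_norm v = esssup lborel (\<lambda>x. ereal \<bar>v x\<bar>)"

definition in_Linf :: "('a::euclidean_space \<Rightarrow> real) \<Rightarrow> bool" where
  "in_Linf v \<longleftrightarrow> v \<in> borel_measurable lborel \<and> Linf_norm v < \<infinity>"

definition in_C0 :: "('a::euclidean_space \<Rightarrow> real) \<Rightarrow> bool" where
  "in_C0 v \<longleftrightarrow> continuous_on UNIV v \<and> (v \<longlongrightarrow> 0) at_infinity"

text \<open>
  Nonnegative mild solutions, in \<open>C([0,T); L\<^sup>\<infinity>)\<close>, of the problem with right-hand side
  \<open>h(t) f(u)\<close> and initial datum \<open>u0\<close>; \<open>u t x\<close> stands for \<open>u(x,t)\<close>, and \<open>T = \<infinity>\<close> is
  allowed.
\<close>
definition mild_solution ::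
    "real \<Rightarrow> (real \<Rightarrow> real) \<Rightarrow> (real \<Rightarrow> real) \<Rightarrow> ('a::euclidean_space \<Rightarrow> real) \<Rightarrow>
     ereal \<Rightarrow> (real \<Rightarrow> 'a \<Rightarrow> real) \<Rightarrow> bool" where
  "mild_solution \<sigma> h f u0 T u \<longleftrightarrow>
     0 < T \<and>
     (\<forall>t. 0 \<le> t \<and> ereal t < T \<longrightarrow>
        in_Linf (u t) \<and>
        (AE x in lborel. 0 \<le> u t x) \<and>
        ((\<lambda>s. Linf_norm (\<lambda>x. u s x - u t x)) \<longlongrightarrow> 0)
          (at t within {s. 0 \<le> s \<and> ereal s < T}) \<and>
        (AE x in lborel.
           u t x = mixed_semigroup \<sigma> t u0 x +
             (LINT s:{0..t}|lborel. mixed_semigroup \<sigma> (t - s) (\<lambda>y. h s * f (u s y)) x)))"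

text \<open>\<open>T\<close> is the maximal existence time: no mild solution lives on a longer interval.\<close>
definition maximal_mild_solution ::
    "real \<Rightarrow> (real \<Rightarrow> real) \<Rightarrow> (real \<Rightarrow> real) \<Rightarrow> ('a::euclidean_space \<Rightarrow> real) \<Rightarrow>
     ereal \<Rightarrow> (real \<Rightarrow> 'a \<Rightarrow> real) \<Rightarrow> bool" where
  "maximal_mild_solution \<sigma> h f u0 T u \<longleftrightarrow>
     mild_solution \<sigma> h f u0 T u \<and>
     (\<forall>T' v. mild_solution \<sigma> h f u0 T' v \<longrightarrow> T' \<le> T)"

text \<open>
  The mild solution is unique up to null sets, so the existential quantifier speaks about
  ``the'' maximal mild solution.
\<close>
definition blows_up_in_finite_time ::
    "real \<Rightarrow> (real \<Rightarrow> real) \<Rightarrow> (real \<Rightarrow> real) \<Rightarrow> ('a::euclidean_space \<Rightarrow> real) \<Rightarrow> bool" where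
  "blows_up_in_finite_time \<sigma> h f u0 \<longleftrightarrow>
     (\<exists>T u. maximal_mild_solution \<sigma> h f u0 T u \<and> T < \<infinity> \<and>
        ((\<lambda>t. Linf_norm (u t)) \<longlongrightarrow> \<infinity>) (at_left (real_of_ereal T)))"

end

theory Submission
  imports Defs "HOL-Probability.Probability" "HOL-Real_Asymp.Real_Asymp"
begin

text \<open>
  The mixed kernel \<open>p\<^sub>t\<close> has Fourier transform \<open>exp (- t * (\<bar>\<xi>\<bar>\<^sup>2 + \<bar>\<xi>\<bar> powr (2 * \<sigma>)))\<close>. It is
  nonnegative because \<open>r powr \<sigma>\<close> is an average of the functions \<open>1 - exp (- \<lambda> * r)\<close>, which exhibits
  the kernel as a limit of mixtures of Gaussians.

  Picard iteration from zero, carried out with values in \<open>[0, \<infinity>]\<close>, converges monotonically to a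
  solution \<open>U\<close> below every mild solution and below every supersolution. Hence the maximal existence
  time is the supremum of the times up to which \<open>U\<close> is bounded, and \<open>U\<close> cannot stay bounded along
  times approaching it, since a supersolution that is constant in space extends it by a time that
  depends only on its current size.

  If \<open>\<theta> < 0\<close>, then \<open>exp (\<theta> * t)\<close> is integrable in time, and a constant is a supersolution for small
  data. If \<open>\<theta> > 0\<close>, then testing a global solution against the backward kernel and using Jensen's
  inequality yields \<open>(p - 1) * (\<integral>\<^sub>0\<^sup>b exp (\<theta> * s) ds) \<le> (p\<^sub>\<tau> * u\<^sub>0) powr (1 - p)\<close> for \<open>b < \<tau>\<close>. This is
  impossible for large \<open>\<tau>\<close>, because \<open>p\<^sub>\<tau>\<close> decays slower than every exponential.
\<close>

section \<open>The mixed heat kernel as a Fourier integral\<close>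

text \<open>The dichotomy has a spectral reason. The symbol vanishes at the origin, so the free flow
  of a positive datum decays slower than every exponential, whereas the primitive of
  \<open>exp (\<theta> * t)\<close> either grows exponentially or stays bounded. This is why no
  critical exponent \<open>p\<close> appears, and why a single small Gaussian datum refutes blow-up
  when \<theta> is negative.

  Two obstacles shape the proof. First, a mild solution is only a curve in L^infinity, given at each
  time up to a null set and not known to be jointly measurable, and a Bochner integral that does not
  exist equals 0. Comparison is therefore carried out with nonnegative integrals, whose monotonicity
  asks for neither measurability nor integrability, and the passage back to Bochner integrals is a
  separate step. Second, the symbol is not smooth at the origin, so integrability of the kernel
  cannot be read off from rapid decay. It is deduced from the sign of the kernel instead, which is
  why positivity is proved before mass one.\<close>

lemma
  fixes f :: "'a::euclidean_space \<Rightarrow> real \<Rightarrow> 'c::{real_normed_field,banach,second_countable_topology}"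
  assumes f: "\<And>b. b \<in> Basis \<Longrightarrow> integrable lborel (f b)"
  shows integrable_lborel_prod_Basis:
      "integrable lborel (\<lambda>x::'a. \<Prod>b\<in>Basis. f b (x \<bullet> b))" (is ?I)
    and integral_lborel_prod_Basis:
      "(LINT x|(lborel::'a measure). (\<Prod>b\<in>Basis. f b (x \<bullet> b))) = (\<Prod>b\<in>Basis. (LINT x|lborel. f b x))" (is ?E)
proof -
  interpret product_sigma_finite "\<lambda>_::'a. lborel :: real measure" ..
  let ?T = "\<lambda>g. \<Sum>b\<in>Basis. g b *\<^sub>R (b::'a)"
  have [measurable]: "b \<in> Basis \<Longrightarrow> f b \<in> borel_measurable borel" for b
    using borel_measurable_integrable[OF f] by simp
  have comp: "(\<Prod>b\<in>Basis. f b (?T g \<bullet> b)) = (\<Prod>b\<in>Basis. f b (g b))" for g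
    by (intro prod.cong refl) (simp add: inner_sum_left inner_Basis if_distrib cong: if_cong)
  show ?I
    by (subst lborel_eq, subst integrable_distr_eq) (simp_all add: comp product_integrable_prod f)
  show ?E
    by (subst lborel_eq, subst integral_distr) (simp_all add: comp product_integral_prod f)
qed

text \<open>Rescaling by \<open>sqrt (2 * a)\<close> turns the integrand into the one that defines
  the characteristic function of the standard normal distribution.\<close>

lemma integral_gaussian_iexp_real:
  fixes a t :: real
  assumes a: "0 < a"
  shows "integrable lborel (\<lambda>x. iexp (t * x) * of_real (exp (- a * x\<^sup>2)))"
    and "(LINT x|lborel. iexp (t * x) * of_real (exp (- a * x\<^sup>2)))
           = complex_of_real (sqrt (pi / a) * exp (- t\<^sup>2 / (4 * a)))"
proof -
  let ?c = "sqrt (2 * a)"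
  let ?f = "\<lambda>y::real. iexp (t / ?c * y) * of_real (std_normal_density y)"
  have c: "?c > 0" using a by simp
  have "char std_normal_distribution (t / ?c) = complex_of_real (exp (- ((t / ?c)\<^sup>2) / 2))"
    by (simp add: char_std_normal_distribution)
  moreover have "char std_normal_distribution (t / ?c) = (LINT y|lborel. ?f y)"
    unfolding char_def by (subst integral_density) (auto simp: scaleR_conv_of_real mult_ac)
  ultimately have 1: "(LINT y|lborel. ?f y) = complex_of_real (exp (- t\<^sup>2 / (4 * a)))"
    using a by (simp add: power_divide)
  have i: "integrable lborel ?f"
    using integrable_normal_density[of 1 0]
    by (rule Bochner_Integration.integrable_bound) (auto simp: norm_mult)
  have eq: "iexp (t * x) * of_real (exp (- a * x\<^sup>2)) = of_real (sqrt (2*pi)) * ?f (0 + ?c * x)" for x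
    using a by (simp add: std_normal_density_def power_mult_distrib)
  show "integrable lborel (\<lambda>x. iexp (t * x) * of_real (exp (- a * x\<^sup>2)))"
    unfolding eq using lborel_integrable_real_affine[OF i, of ?c 0] c by (intro integrable_mult_right) auto
  have "(LINT y|lborel. ?f y) = ?c *\<^sub>R (LINT x|lborel. ?f (0 + ?c * x))"
    using lborel_integral_real_affine[of ?c ?f 0] c by simp
  then have "(LINT x|lborel. ?f (0 + ?c * x)) = complex_of_real (exp (- t\<^sup>2 / (4 * a)) / ?c)"
    using c unfolding 1 by (simp add: scaleR_conv_of_real field_simps)
  then show "(LINT x|lborel. iexp (t * x) * of_real (exp (- a * x\<^sup>2)))
           = complex_of_real (sqrt (pi / a) * exp (- t\<^sup>2 / (4 * a)))"
    unfolding eq using a by (simp add: real_sqrt_divide real_sqrt_mult)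
qed

text \<open>Both the oscillating factor and the Gaussian are products over the coordinates, so the
  one-dimensional formula applies factor by factor.\<close>

lemma integral_gaussian_iexp:
  fixes x :: "'a::euclidean_space"
  assumes a: "0 < a"
  shows "(LINT \<xi>|lborel. iexp (x \<bullet> \<xi>) * of_real (exp (- a * (norm \<xi>)\<^sup>2)))
    = complex_of_real ((pi / a) powr (DIM('a) / 2) * exp (- (norm x)\<^sup>2 / (4 * a)))"
proof -
  let ?f = "\<lambda>b y. iexp (x \<bullet> b * y) * of_real (exp (- a * y\<^sup>2))"
  have n: "(norm z)\<^sup>2 = (\<Sum>b\<in>Basis. (z \<bullet> b)\<^sup>2)" for z :: 'a
    by (simp only: power2_norm_eq_inner euclidean_inner[of z z]) (simp add: power2_eq_square)
  have eq: "iexp (x \<bullet> \<xi>) * of_real (exp (- a * (norm \<xi>)\<^sup>2)) = (\<Prod>b\<in>Basis. ?f b (\<xi> \<bullet> b))" for \<xi>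
    by (simp add: euclidean_inner[of x \<xi>] n prod.distrib exp_sum sum_distrib_left
        flip: of_real_prod sum_negf)
  have "(LINT \<xi>|lborel. iexp (x \<bullet> \<xi>) * of_real (exp (- a * (norm \<xi>)\<^sup>2)))
      = (\<Prod>b\<in>Basis. complex_of_real (sqrt (pi / a) * exp (- (x \<bullet> b)\<^sup>2 / (4 * a))))"
    unfolding eq
    by (subst integral_lborel_prod_Basis) (simp_all only: integral_gaussian_iexp_real[OF a])
  also have "\<dots> = complex_of_real ((pi / a) powr (DIM('a) / 2) * exp (- (norm x)\<^sup>2 / (4 * a)))"
    using a by (simp add: prod.distrib n sum_divide_distrib powr_half_sqrt_powr powr_realpow exp_sum
        real_sqrt_power flip: of_real_prod sum_negf)
  finally show ?thesis .
qed

text \<open>The product majorant is integrable on the product space. In most uses one variable is a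
  position and the other a frequency, each controlled by its own factor.\<close>

lemma integral_swap_dominated:
  fixes F :: "'a::euclidean_space \<Rightarrow> 'b::euclidean_space \<Rightarrow> complex"
  assumes [measurable]: "case_prod F \<in> borel_measurable (lborel \<Otimes>\<^sub>M lborel)"
    and f: "integrable lborel f" and g: "integrable lborel g"
    and bd: "\<And>x y. norm (F x y) \<le> f x * g y"
  shows "(LINT x|lborel. LINT y|lborel. F x y) = (LINT y|lborel. LINT x|lborel. F x y)"
proof -
  have [measurable]: "f \<in> borel_measurable lborel" "g \<in> borel_measurable lborel"
    using f g by auto
  have "integrable (lborel \<Otimes>\<^sub>M lborel) (\<lambda>(x, y). f x * g y)"
  proof (rule lborel_pair.Fubini_integrable)
    show "integrable lborel (\<lambda>x. LINT y|lborel. norm (case (x, y) of (x, y) \<Rightarrow> f x * g y))"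
      using f by (simp add: abs_mult)
    show "AE x in lborel. integrable lborel (\<lambda>y. case (x, y) of (x, y) \<Rightarrow> f x * g y)"
      using g by simp
  qed simp
  then have "integrable (lborel \<Otimes>\<^sub>M lborel) (case_prod F)"
  proof (rule Bochner_Integration.integrable_bound)
    have "norm (F x y) \<le> \<bar>f x * g y\<bar>" for x y
      using bd[of x y] by linarith
    then show "AE x in lborel \<Otimes>\<^sub>M lborel. norm (case_prod F x) \<le> norm (case x of (x, y) \<Rightarrow> f x * g y)"
      by (auto simp: case_prod_beta)
  qed simp
  from lborel_pair.Fubini_integral[OF this] show ?thesis by simp
qed

section \<open>Changes of variable and integrable majorants\<close>

lemma integral_lborel_translate:
  fixes f :: "'a::euclidean_space \<Rightarrow> 'c::{banach,second_countable_topology}"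
  assumes [measurable]: "f \<in> borel_measurable borel"
  shows "(LINT y|lborel. f (c + y)) = (LINT y|lborel. f y)"
  by (subst (2) lborel_distr_plus[symmetric, of c], subst integral_distr) auto

lemma integral_lborel_scale:
  fixes f :: "'a::euclidean_space \<Rightarrow> 'c::{banach,second_countable_topology}"
  assumes [measurable]: "f \<in> borel_measurable borel" and c: "0 < c"
  shows "(LINT y|lborel. f y) = c ^ DIM('a) *\<^sub>R (LINT y|lborel. f (t + c *\<^sub>R y))"
  using c by (subst lborel_affine[of c t]) (auto simp: integral_density integral_distr)

lemma powr_dim_bound_prod:
  fixes \<xi> :: "'a::euclidean_space"
  shows "(\<Prod>b\<in>Basis. (1 + (\<xi> \<bullet> b)\<^sup>2)) \<le> (1 + (norm \<xi>)\<^sup>2) ^ DIM('a)"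
proof -
  have "(\<Prod>b\<in>Basis. (1 + (\<xi> \<bullet> b)\<^sup>2)) \<le> (\<Prod>b\<in>(Basis::'a set). (1 + (norm \<xi>)\<^sup>2))"
    by (intro prod_mono) (auto simp: power2_le_iff_abs_le Basis_le_norm)
  then show ?thesis by simp
qed

lemma integrable_inverse_norm_power:
  "integrable lborel (\<lambda>\<xi>::'a::euclidean_space. inverse ((1 + (norm \<xi>)\<^sup>2) ^ DIM('a)))"
proof (rule Bochner_Integration.integrable_bound)
  have "integrable lborel (\<lambda>x::real. inverse (1 + x\<^sup>2))"
    using integrable_inverse_1_plus_square by (simp add: set_integrable_def)
  then show "integrable lborel (\<lambda>\<xi>::'a. \<Prod>b\<in>Basis. inverse (1 + (\<xi> \<bullet> b)\<^sup>2))"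
    by (rule integrable_lborel_prod_Basis)
  have "inverse ((1 + (norm \<xi>)\<^sup>2) ^ DIM('a)) \<le> (\<Prod>b\<in>Basis. inverse (1 + (\<xi> \<bullet> b)\<^sup>2))" for \<xi> :: 'a
    using powr_dim_bound_prod[of \<xi>]
      prod_inversef[of "\<lambda>b. 1 + (\<xi> \<bullet> b)\<^sup>2" Basis]
    by (auto simp: comp_def intro!: le_imp_inverse_le prod_pos add_pos_nonneg)
  then show "AE \<xi>::'a in lborel. norm (inverse ((1 + (norm \<xi>)\<^sup>2) ^ DIM('a)))
      \<le> norm (\<Prod>b\<in>Basis. inverse (1 + (\<xi> \<bullet> b)\<^sup>2))"
    by (auto simp: abs_of_nonneg prod_nonneg)
qed simp

lemma integrable_exp_norm_powr:
  assumes t: "0 < t" and s: "0 < s"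
  shows "integrable lborel (\<lambda>\<xi>::'a::euclidean_space. exp (- t * norm \<xi> powr s))"
proof -
  have "((\<lambda>r::real. (1 + r\<^sup>2) ^ DIM('a) * exp (- t * r powr s)) \<longlongrightarrow> 0) at_top"
    using t s by real_asymp
  then have "\<forall>\<^sub>F r in at_top. (1 + r\<^sup>2) ^ DIM('a) * exp (- t * r powr s) < 1"
    by (rule order_tendstoD) simp
  then obtain R where R: "\<And>r. r \<ge> R \<Longrightarrow> (1 + r\<^sup>2) ^ DIM('a) * exp (- t * r powr s) < 1"
    by (auto simp: eventually_at_top_linorder)
  \<comment> \<open>The entry 1 bounds the product outside the ball of radius \<open>R\<close>,
    where the exponential has won; the other entry bounds it inside.\<close>
  define C where "C = max 1 ((1 + R\<^sup>2) ^ DIM('a))"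
  have "exp (- t * norm \<xi> powr s) \<le> C * inverse ((1 + (norm \<xi>)\<^sup>2) ^ DIM('a))" for \<xi> :: 'a
  proof -
    have "(1 + (norm \<xi>)\<^sup>2) ^ DIM('a) * exp (- t * norm \<xi> powr s) \<le> C"
    proof (cases "norm \<xi> \<ge> R")
      case True then show ?thesis unfolding C_def by (intro order_trans[OF less_imp_le[OF R] max.cobounded1])
    next
      case False
      then have "(1 + (norm \<xi>)\<^sup>2) ^ DIM('a) \<le> (1 + R\<^sup>2) ^ DIM('a)"
        by (intro power_mono add_left_mono) auto
      moreover have "exp (- t * norm \<xi> powr s) \<le> 1" using t by simp
      ultimately have "(1 + (norm \<xi>)\<^sup>2) ^ DIM('a) * exp (- t * norm \<xi> powr s) \<le> (1 + R\<^sup>2) ^ DIM('a) * 1"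
        by (intro mult_mono) auto
      then show ?thesis by (simp add: C_def)
    qed
    then show ?thesis by (simp add: field_simps add_pos_nonneg)
  qed
  then have "AE \<xi>::'a in lborel. norm (exp (- t * norm \<xi> powr s))
      \<le> norm (C * inverse ((1 + (norm \<xi>)\<^sup>2) ^ DIM('a)))"
    by (auto intro: order_trans[OF _ abs_ge_self])
  then show ?thesis
    by (rule Bochner_Integration.integrable_bound[rotated 2])
       (use integrable_inverse_norm_power in auto)
qed

lemma integrable_exp_norm_sq:
  "0 < a \<Longrightarrow> integrable lborel (\<lambda>\<xi>::'a::euclidean_space. exp (- a * (norm \<xi>)\<^sup>2))"
  using integrable_exp_norm_powr[of a 2, where 'a='a] by (simp add: powr_numeral)

section \<open>The symbol of the operator and the mixed kernel as its Fourier integral\<close>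

definition symb :: "real \<Rightarrow> 'a::euclidean_space \<Rightarrow> real" where
  "symb \<sigma> \<xi> = (norm \<xi>)\<^sup>2 + norm \<xi> powr (2 * \<sigma>)"

abbreviation symb_ft :: "real \<Rightarrow> real \<Rightarrow> 'a::euclidean_space \<Rightarrow> complex" where
  "symb_ft \<sigma> t x \<equiv> LINT \<xi>|lborel. iexp (x \<bullet> \<xi>) * of_real (exp (- t * symb \<sigma> \<xi>))"

text \<open>Vanishing at nonpositive times, the kernel itself cuts time integrals off at
  \<open>s = t\<close>, so that Duhamel terms carry no upper limit.\<close>

definition mker :: "real \<Rightarrow> real \<Rightarrow> 'a::euclidean_space \<Rightarrow> real" where
  "mker \<sigma> t x = (if t \<le> 0 then 0 else
     (1 / (2 * pi) ^ DIM('a)) *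
     Re (symb_ft \<sigma> t x))"

lemma symb_measurable [measurable]: "symb \<sigma> \<in> borel_measurable borel"
  unfolding symb_def[abs_def] by measurable

lemma symb_nonneg: "0 \<le> symb \<sigma> \<xi>"
  by (simp add: symb_def)

lemma symb_zero [simp]: "symb \<sigma> 0 = 0"
  by (simp add: symb_def)

lemma integrable_exp_symb:
  assumes "0 < t"
  shows "integrable lborel (\<lambda>\<xi>::'a::euclidean_space. exp (- t * symb \<sigma> \<xi>))"
  by (rule Bochner_Integration.integrable_bound[OF integrable_exp_norm_sq[OF assms]])
     (use assms in \<open>auto simp: symb_def\<close>)

text \<open>The double integral over \<open>y\<close> and \<xi> is dominated by
  \<open>G (x - y) * E \<xi>\<close>, so Fubini applies without any spatial decay of the fractional
  kernel. The inner integral over \<open>y\<close> then supplies the factor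
  \<open>exp (- t * (norm \<xi>)\<^sup>2)\<close>, and the two exponents add up to
  \<open>symb\<close>.\<close>

lemma mixed_heat_kernel_eq_mker:
  fixes x :: "'a::euclidean_space"
  assumes t: "0 < t" and s: "0 < \<sigma>"
  shows "mixed_heat_kernel \<sigma> t x = mker \<sigma> t x"
proof -
  define E where "E = (\<lambda>\<xi>::'a. exp (- t * norm \<xi> powr (2 * \<sigma>)))"
  define G where "G = (\<lambda>z::'a. exp (- (norm z)\<^sup>2 / (4 * t)))"
  have [measurable]: "E \<in> borel_measurable borel" "G \<in> borel_measurable borel"
    unfolding E_def G_def by measurable
  have iE: "integrable lborel E"
    unfolding E_def using integrable_exp_norm_powr[OF t, of "2 * \<sigma>"] s by simp
  have iG: "integrable lborel G"
    unfolding G_def using integrable_exp_norm_sq[of "1 / (4 * t)", where 'a='a] t by simp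
  have iGx: "integrable lborel (\<lambda>y. G (x - y))"
  proof -
    have "(\<lambda>y. G (x - y)) = (\<lambda>y. G (- x + y))"
      by (simp add: G_def norm_minus_commute)
    moreover have "integrable (distr lborel borel ((+) (- x))) G"
      unfolding lborel_distr_plus by (rule iG)
    ultimately show ?thesis by (simp add: integrable_distr_eq)
  qed
  define I where "I = (LINT y|lborel. LINT \<xi>|lborel. of_real (G (x - y)) * (iexp (y \<bullet> \<xi>) * of_real (E \<xi>)))"
  have iyE: "integrable lborel (\<lambda>\<xi>. iexp (y \<bullet> \<xi>) * of_real (E \<xi>))" for y
    by (rule Bochner_Integration.integrable_bound[OF iE]) (auto simp: norm_mult)
  have "(LINT y|lborel. G (x - y) * frac_heat_kernel \<sigma> t y) = 1 / (2 * pi) ^ DIM('a) * Re I"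
  proof -
    let ?J = "\<lambda>y. LINT \<xi>|lborel. iexp (y \<bullet> \<xi>) * of_real (E \<xi>)"
    \<comment> \<open>The Fourier integral is bounded in \<open>y\<close>; multiplied by the
      Gaussian it is integrable, and \<open>Re\<close> may be moved inside.\<close>
    have "norm (?J y) \<le> (LINT \<xi>|lborel. E \<xi>)" for y
      by (rule order_trans[OF integral_norm_bound]) (auto simp: norm_mult E_def)
    then have "integrable lborel (\<lambda>y. complex_of_real (G (x - y)) * ?J y)"
      by (intro Bochner_Integration.integrable_bound[OF integrable_mult_left[OF iGx, of "LINT \<xi>|lborel. E \<xi>"]])
         (auto simp: norm_mult abs_mult intro!: AE_I2 mult_left_mono intro: order_trans[OF _ abs_ge_self])
    then have "Re I = (LINT y|lborel. G (x - y) * Re (?J y))"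
      unfolding I_def by (simp flip: integral_Re)
    then show ?thesis
      by (simp add: frac_heat_kernel_def E_def mult.left_commute)
  qed
  moreover have "I = (LINT \<xi>|lborel. LINT y|lborel. of_real (G (x - y)) * (iexp (y \<bullet> \<xi>) * of_real (E \<xi>)))"
    unfolding I_def by (rule integral_swap_dominated[OF _ iGx iE]) (auto simp: norm_mult G_def E_def)
  moreover have "(LINT y|lborel. of_real (G (x - y)) * (iexp (y \<bullet> \<xi>) * of_real (E \<xi>)))
      = of_real ((4 * pi * t) powr (DIM('a) / 2)) * (iexp (x \<bullet> \<xi>) * of_real (exp (- t * symb \<sigma> \<xi>)))" for \<xi>
  proof -
    \<comment> \<open>Moving the center of the Gaussian to the origin splits off
      \<open>iexp (x \<bullet> \<xi>)\<close>.\<close>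
    have "(LINT y|lborel. of_real (G (x - y)) * (iexp (y \<bullet> \<xi>) * of_real (E \<xi>)))
        = (LINT z|lborel. of_real (G (x - (x + z))) * (iexp ((x + z) \<bullet> \<xi>) * of_real (E \<xi>)))"
      by (rule integral_lborel_translate[symmetric]) measurable
    also have "\<dots> = (LINT z|lborel. (iexp (x \<bullet> \<xi>) * of_real (E \<xi>)) * (iexp (\<xi> \<bullet> z) * of_real (exp (- (1 / (4 * t)) * (norm z)\<^sup>2))))"
      by (intro Bochner_Integration.integral_cong)
         (simp_all add: G_def inner_add_left inner_commute[of \<xi>] distrib_left exp_add)
    also have "\<dots> = (iexp (x \<bullet> \<xi>) * of_real (E \<xi>)) * of_real ((4 * pi * t) powr (DIM('a) / 2) * exp (- t * (norm \<xi>)\<^sup>2))"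
      using t by (simp only: integral_mult_right_zero, subst integral_gaussian_iexp) (auto simp: mult_ac)
    also have "\<dots> = of_real ((4 * pi * t) powr (DIM('a) / 2)) * (iexp (x \<bullet> \<xi>) * of_real (exp (- t * symb \<sigma> \<xi>)))"
      by (simp add: E_def symb_def distrib_left exp_add exp_diff exp_minus field_simps)
    finally show ?thesis .
  qed
  ultimately have *: "(LINT y|lborel. G (x - y) * frac_heat_kernel \<sigma> t y) = (4 * pi * t) powr (DIM('a) / 2) * mker \<sigma> t x"
    using t by (simp add: mker_def)
  have "mixed_heat_kernel \<sigma> t x = (4 * pi * t) powr (- real DIM('a) / 2) * ((4 * pi * t) powr (DIM('a) / 2) * mker \<sigma> t x)"
    unfolding *[symmetric] mixed_heat_kernel_def G_def ..
  also have "\<dots> = mker \<sigma> t x"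
    using t by (simp add: mult.assoc[symmetric] flip: powr_add)
  finally show ?thesis .
qed

section \<open>Positivity of the kernel\<close>

abbreviation gauss_ft :: "real \<Rightarrow> ('a::euclidean_space \<Rightarrow> real) \<Rightarrow> 'a \<Rightarrow> complex" where
  "gauss_ft a m x \<equiv>
     LINT \<xi>|lborel. iexp (x \<bullet> \<xi>) * of_real (exp (- a * (norm \<xi>)\<^sup>2) * m \<xi>)"

text \<open>Positive definiteness, tested through Gaussian regularisations because \<open>m\<close>
  itself, for instance the constant 1, need not be integrable. Quantifying over every parameter
  \<open>a\<close> is what makes the class stable under multiplication by mixtures of
  Gaussians.\<close>

definition pos_def_mult :: "('a::euclidean_space \<Rightarrow> real) \<Rightarrow> bool" where
  "pos_def_mult m \<longleftrightarrow> m \<in> borel_measurable borel \<and> bounded (range m) \<and>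
     (\<forall>a>0. \<forall>x. gauss_ft a m x \<in> \<real>\<^sub>\<ge>\<^sub>0)"

lemma pos_def_mult_integrable:
  fixes m :: "'a::euclidean_space \<Rightarrow> real"
  assumes m [measurable]: "m \<in> borel_measurable borel" and bd: "\<And>\<xi>. \<bar>m \<xi>\<bar> \<le> B" and a: "0 < a"
  shows "integrable lborel (\<lambda>\<xi>. iexp (x \<bullet> \<xi>) * of_real (exp (- a * (norm \<xi>)\<^sup>2) * m \<xi>))"
proof (rule Bochner_Integration.integrable_bound)
  show "integrable lborel (\<lambda>\<xi>::'a. B * exp (- a * (norm \<xi>)\<^sup>2))"
    by (intro integrable_mult_right integrable_exp_norm_sq a)
  show "AE \<xi> in lborel. norm (iexp (x \<bullet> \<xi>) * of_real (exp (- a * (norm \<xi>)\<^sup>2) * m \<xi>))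
      \<le> norm (B * exp (- a * (norm \<xi>)\<^sup>2))"
    using bd by (intro AE_I2) (auto simp: norm_mult abs_mult mult.commute intro!: mult_right_mono order_trans[OF bd abs_ge_self])
qed measurable

lemma pos_def_mult_one: "pos_def_mult (\<lambda>_::'a::euclidean_space. 1)"
  unfolding pos_def_mult_def mult_1_right
proof (intro conjI allI impI)
  fix a :: real and x :: 'a assume "0 < a"
  then show "(LINT \<xi>|lborel. iexp (x \<bullet> \<xi>) * of_real (exp (- a * (norm \<xi>)\<^sup>2))) \<in> \<real>\<^sub>\<ge>\<^sub>0"
    unfolding integral_gaussian_iexp[OF \<open>0 < a\<close>] complex_nonneg_Reals_iff by simp
qed auto

lemma pos_def_mult_bound:
  assumes "pos_def_mult m" obtains B where "0 < B" "\<And>\<xi>. \<bar>m \<xi>\<bar> \<le> B"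
  using assms unfolding pos_def_mult_def bounded_pos by auto

lemma pos_def_mult_add:
  assumes f: "pos_def_mult f" and g: "pos_def_mult g"
  shows "pos_def_mult (\<lambda>\<xi>. f \<xi> + g \<xi>)"
proof -
  obtain B C where B: "\<And>\<xi>. \<bar>f \<xi>\<bar> \<le> B" and C: "\<And>\<xi>. \<bar>g \<xi>\<bar> \<le> C"
    by (meson pos_def_mult_bound f g)
  have [measurable]: "f \<in> borel_measurable borel" "g \<in> borel_measurable borel"
    using f g by (auto simp: pos_def_mult_def)
  have "bounded (range (\<lambda>\<xi>. f \<xi> + g \<xi>))"
    unfolding bounded_iff using B C
    by (intro exI[of _ "B + C"]) (auto intro: order_trans[OF abs_triangle_ineq add_mono])
  moreover have "gauss_ft a (\<lambda>\<xi>. f \<xi> + g \<xi>) x \<in> \<real>\<^sub>\<ge>\<^sub>0"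
    if "a > 0" for a x
  proof -
    have "gauss_ft a (\<lambda>\<xi>. f \<xi> + g \<xi>) x = gauss_ft a f x + gauss_ft a g x"
      by (subst Bochner_Integration.integral_add[symmetric])
         (simp_all only: pos_def_mult_integrable[OF _ B that] pos_def_mult_integrable[OF _ C that]
            \<open>f \<in> borel_measurable borel\<close> \<open>g \<in> borel_measurable borel\<close> distrib_left of_real_add)
    also have "\<dots> \<in> \<real>\<^sub>\<ge>\<^sub>0"
      using f g that by (intro nonneg_Reals_add_I) (auto simp: pos_def_mult_def)
    finally show ?thesis .
  qed
  ultimately show ?thesis by (auto simp: pos_def_mult_def)
qed

lemma pos_def_mult_scale:
  assumes f: "pos_def_mult f" and c: "0 \<le> c"
  shows "pos_def_mult (\<lambda>\<xi>. c * f \<xi>)"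
proof -
  have [measurable]: "f \<in> borel_measurable borel"
    using f by (auto simp: pos_def_mult_def)
  have "bounded (range (\<lambda>\<xi>. c * f \<xi>))"
    using f bounded_scaling[of "range f" c] by (simp add: pos_def_mult_def image_image)
  moreover have "gauss_ft a (\<lambda>\<xi>. c * f \<xi>) x \<in> \<real>\<^sub>\<ge>\<^sub>0"
    if "a > 0" for a x
  proof -
    have "gauss_ft a (\<lambda>\<xi>. c * f \<xi>) x = complex_of_real c * gauss_ft a f x"
      by (subst integral_mult_right_zero[symmetric]) (auto simp: mult_ac)
    also have "\<dots> \<in> \<real>\<^sub>\<ge>\<^sub>0"
      using f that c by (intro nonneg_Reals_mult_I) (auto simp: pos_def_mult_def)
    finally show ?thesis .
  qed
  ultimately show ?thesis by (auto simp: pos_def_mult_def)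
qed

lemma pos_def_mult_sum:
  assumes "finite A" and "\<And>k. k \<in> A \<Longrightarrow> pos_def_mult (f k)"
  shows "pos_def_mult (\<lambda>\<xi>. \<Sum>k\<in>A. f k \<xi>)"
  using assms
proof (induction rule: finite_induct)
  case empty
  show ?case using pos_def_mult_scale[OF pos_def_mult_one, of 0] by simp
next
  case (insert k A)
  then show ?case using pos_def_mult_add[of "f k" "\<lambda>\<xi>. \<Sum>k\<in>A. f k \<xi>"] by simp
qed

text \<open>The Gaussian in the definition is the integrable majorant, and the nonnegative reals are
  closed in the complex plane.\<close>

lemma pos_def_mult_limit:
  fixes f :: "nat \<Rightarrow> 'a::euclidean_space \<Rightarrow> real"
  assumes f: "\<And>n. pos_def_mult (f n)" and bd: "\<And>n \<xi>. \<bar>f n \<xi>\<bar> \<le> B"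
    and lim: "\<And>\<xi>. (\<lambda>n. f n \<xi>) \<longlonglongrightarrow> g \<xi>"
  shows "pos_def_mult g"
proof -
  have fm [measurable]: "f n \<in> borel_measurable borel" for n
    using f by (auto simp: pos_def_mult_def)
  have [measurable]: "g \<in> borel_measurable borel"
    by (rule borel_measurable_LIMSEQ_metric[OF fm lim])
  have gB: "\<bar>g \<xi>\<bar> \<le> B" for \<xi>
    by (rule LIMSEQ_le_const2[OF tendsto_rabs[OF lim]]) (use bd in auto)
  have "gauss_ft a g x \<in> \<real>\<^sub>\<ge>\<^sub>0"
    if a: "a > 0" for a x
  proof (rule closed_sequentially[OF closed_nonneg_Reals_complex])
    show "gauss_ft a (f n) x \<in> \<real>\<^sub>\<ge>\<^sub>0" for n
      using f a by (auto simp: pos_def_mult_def)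
    show "(\<lambda>n. gauss_ft a (f n) x) \<longlonglongrightarrow> gauss_ft a g x"
    proof (rule integral_dominated_convergence)
      show "integrable lborel (\<lambda>\<xi>::'a. exp (- a * (norm \<xi>)\<^sup>2) * B)"
        by (intro integrable_mult_right integrable_mult_left integrable_exp_norm_sq a)
      show "AE \<xi> in lborel. norm (iexp (x \<bullet> \<xi>) * of_real (exp (- a * (norm \<xi>)\<^sup>2) * f n \<xi>))
          \<le> exp (- a * (norm \<xi>)\<^sup>2) * B" for n
        using bd by (auto simp: norm_mult abs_mult)
      show "AE \<xi> in lborel. (\<lambda>n. iexp (x \<bullet> \<xi>) * of_real (exp (- a * (norm \<xi>)\<^sup>2) * f n \<xi>))
          \<longlonglongrightarrow> iexp (x \<bullet> \<xi>) * of_real (exp (- a * (norm \<xi>)\<^sup>2) * g \<xi>)"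
        by (intro AE_I2 tendsto_intros lim)
    qed measurable
  qed
  then show ?thesis
    using gB by (auto simp: pos_def_mult_def bounded_iff)
qed

text \<open>A Laplace transform in \<open>\<bar>\<xi>\<bar>\<^sup>2\<close> is a mixture of Gaussians, so multiplying by it only
  averages over the parameter \<open>a\<close> of the definition.\<close>
lemma pos_def_mult_laplace:
  fixes f :: "'a::euclidean_space \<Rightarrow> real"
  assumes f: "pos_def_mult f" and w: "integrable lborel w" and w0: "\<And>l. 0 \<le> w l"
    and wneg: "\<And>l. l < 0 \<Longrightarrow> w l = 0"
  shows "pos_def_mult (\<lambda>\<xi>. f \<xi> * (LINT l|lborel. w l * exp (- l * (norm \<xi>)\<^sup>2)))"
proof -
  define L where "L = (\<lambda>\<xi>::'a. LINT l|lborel. w l * exp (- l * (norm \<xi>)\<^sup>2))"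
  have [measurable]: "f \<in> borel_measurable borel" "w \<in> borel_measurable borel"
    using f w by (auto simp: pos_def_mult_def)
  have [measurable]: "L \<in> borel_measurable borel"
    unfolding L_def by measurable
  obtain B where B0: "B > 0" and B: "\<And>\<xi>. \<bar>f \<xi>\<bar> \<le> B" by (meson pos_def_mult_bound f)
  have wle: "w l * exp (- l * (norm \<xi>)\<^sup>2) \<le> w l" for l and \<xi> :: 'a
    using w0[of l] wneg[of l] by (cases "l < 0") (auto simp: mult_left_le)
  have iwe: "integrable lborel (\<lambda>l. w l * exp (- l * (norm \<xi>)\<^sup>2))" for \<xi> :: 'a
    by (rule Bochner_Integration.integrable_bound[OF w]) (use wle w0 in \<open>auto simp: abs_mult\<close>)
  have L: "\<bar>L \<xi>\<bar> \<le> (LINT l|lborel. w l)" for \<xi>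
    unfolding L_def using w0
    by (subst abs_of_nonneg) (simp, intro integral_mono iwe w wle)
  have fL: "\<bar>f \<xi> * L \<xi>\<bar> \<le> B * (LINT l|lborel. w l)" for \<xi>
    unfolding abs_mult using B L B0 by (intro mult_mono) auto
  have "gauss_ft a (\<lambda>\<xi>. f \<xi> * L \<xi>) x \<in> \<real>\<^sub>\<ge>\<^sub>0"
    if a: "a > 0" for a x
  proof -
    let ?F = "\<lambda>\<xi> l. complex_of_real (w l) *
      (iexp (x \<bullet> \<xi>) * of_real (exp (- (a + l) * (norm \<xi>)\<^sup>2) * f \<xi>))"
    have "iexp (x \<bullet> \<xi>) * of_real (exp (- a * (norm \<xi>)\<^sup>2) * (f \<xi> * L \<xi>)) = (LINT l|lborel. ?F \<xi> l)" for \<xi>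
    proof -
      have "complex_of_real (L \<xi>) = (LINT l|lborel. complex_of_real (w l * exp (- l * (norm \<xi>)\<^sup>2)))"
        unfolding L_def by (rule integral_complex_of_real[symmetric])
      then have "iexp (x \<bullet> \<xi>) * of_real (exp (- a * (norm \<xi>)\<^sup>2) * (f \<xi> * L \<xi>))
         = (LINT l|lborel. (iexp (x \<bullet> \<xi>) * of_real (exp (- a * (norm \<xi>)\<^sup>2) * f \<xi>)) * of_real (w l * exp (- l * (norm \<xi>)\<^sup>2)))"
        by (subst integral_mult_right_zero) (simp add: mult_ac)
      also have "\<dots> = (LINT l|lborel. ?F \<xi> l)"
        by (intro Bochner_Integration.integral_cong refl)
           (simp add: ring_distribs exp_add exp_diff exp_minus field_simps)
      finally show ?thesis .
    qed
    then have "gauss_ft a (\<lambda>\<xi>. f \<xi> * L \<xi>) x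
       = (LINT \<xi>|lborel. LINT l|lborel. ?F \<xi> l)" by simp
    also have "\<dots> = (LINT l|lborel. LINT \<xi>|lborel. ?F \<xi> l)"
    proof (rule integral_swap_dominated)
      show "integrable lborel (\<lambda>\<xi>::'a. B * exp (- a * (norm \<xi>)\<^sup>2))"
        by (intro integrable_mult_right integrable_mult_left integrable_exp_norm_sq a)
      show "norm (?F \<xi> l) \<le> B * exp (- a * (norm \<xi>)\<^sup>2) * w l" for \<xi> l
      proof -
        have "norm (?F \<xi> l) = (w l * exp (- l * (norm \<xi>)\<^sup>2)) * (exp (- a * (norm \<xi>)\<^sup>2) * \<bar>f \<xi>\<bar>)"
        proof -
          have "norm (?F \<xi> l) = w l * (exp (- (a + l) * (norm \<xi>)\<^sup>2) * \<bar>f \<xi>\<bar>)"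
            using w0[of l] by (simp add: norm_mult abs_mult)
          moreover have "exp (- (a + l) * (norm \<xi>)\<^sup>2) = exp (- l * (norm \<xi>)\<^sup>2) * exp (- a * (norm \<xi>)\<^sup>2)"
            by (simp add: ring_distribs flip: exp_add)
          ultimately show ?thesis by simp
        qed
        also have "\<dots> \<le> w l * (exp (- a * (norm \<xi>)\<^sup>2) * B)"
          by (intro mult_mono wle B) (auto simp: w0)
        finally show ?thesis by (simp add: mult_ac)
      qed
    qed (use w in auto)
    also have "\<dots> \<in> \<real>\<^sub>\<ge>\<^sub>0"
    proof -
      let ?J = "\<lambda>l. gauss_ft (a + l) f x"
      \<comment> \<open>For \<open>l < 0\<close> the parameter \<open>a + l\<close> could fail to be
        positive, beyond the reach of \<open>pos_def_mult\<close>; there the weight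
        vanishes.\<close>
      have J: "complex_of_real (w l) * ?J l = complex_of_real (w l * Re (?J l)) \<and> 0 \<le> w l * Re (?J l)" for l
      proof (cases "l < 0")
        case False
        then have "0 < a + l" using a by simp
        then have "?J l \<in> \<real>\<^sub>\<ge>\<^sub>0" using f unfolding pos_def_mult_def by blast
        then show ?thesis using w0[of l] by (auto simp: complex_nonneg_Reals_iff complex_eq_iff)
      qed (use wneg in auto)
      then have "(LINT l|lborel. LINT \<xi>|lborel. ?F \<xi> l) = (LINT l|lborel. complex_of_real (w l * Re (?J l)))"
        by (simp only: integral_mult_right_zero)
      also have "\<dots> = complex_of_real (LINT l|lborel. w l * Re (?J l))" by (rule integral_complex_of_real)
      finally show ?thesis using J by simp
    qed
    finally show ?thesis .
  qed
  then show ?thesis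
    using fL by (auto simp: pos_def_mult_def bounded_iff L_def)
qed

text \<open>Exponential series: the powers of \<open>L\<close> come from iterating the previous
  lemma, the coefficients are nonnegative, and all partial sums are bounded by
  \<open>exp (t * B)\<close>. Probabilistically this is the Laplace transform of a compound Poisson
  subordinator, up to its normalising factor.\<close>

lemma pos_def_mult_exp_laplace:
  fixes w :: "real \<Rightarrow> real"
  defines "L \<equiv> \<lambda>\<xi>::'a::euclidean_space. LINT l|lborel. w l * exp (- l * (norm \<xi>)\<^sup>2)"
  assumes w: "integrable lborel w" and w0: "\<And>l. 0 \<le> w l" and wneg: "\<And>l. l < 0 \<Longrightarrow> w l = 0"
    and t: "0 \<le> t"
  shows "pos_def_mult (\<lambda>\<xi>. exp (t * L \<xi>))"
proof -
  have pow: "pos_def_mult (\<lambda>\<xi>. L \<xi> ^ k)" for k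
  proof (induction k)
    case 0
    show ?case using pos_def_mult_one by simp
  next
    case (Suc k)
    from pos_def_mult_laplace[OF this w w0 wneg] show ?case
      by (simp add: L_def mult.commute)
  qed
  obtain B where B: "B > 0" "\<And>\<xi>. \<bar>L \<xi>\<bar> \<le> B"
    using pos_def_mult_bound[OF pow[of 1]] by auto
  let ?S = "\<lambda>n \<xi>. \<Sum>k<n. (t ^ k / fact k) * L \<xi> ^ k"
  show ?thesis
  proof (rule pos_def_mult_limit)
    show "pos_def_mult (?S n)" for n
      using t by (intro pos_def_mult_sum pos_def_mult_scale pow) auto
    show "\<bar>?S n \<xi>\<bar> \<le> exp (t * B)" for n \<xi>
    proof -
      have "\<bar>?S n \<xi>\<bar> \<le> (\<Sum>k<n. (t * B) ^ k / fact k)"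
        by (rule order_trans[OF sum_abs])
           (use t B in \<open>auto simp: abs_mult power_abs power_mult_distrib intro!: sum_mono divide_right_mono mult_left_mono power_mono\<close>)
      also have "\<dots> \<le> (\<Sum>k. (t * B) ^ k / fact k)"
        using t B summable_exp[of "t * B"]
        by (intro sum_le_suminf) (auto simp: divide_inverse mult.commute)
      finally show ?thesis by (simp add: exp_def divide_inverse mult.commute)
    qed
    show "(\<lambda>n. ?S n \<xi>) \<longlonglongrightarrow> exp (t * L \<xi>)" for \<xi>
      using exp_converges[of "t * L \<xi>"] by (simp add: sums_def power_mult_distrib divide_inverse mult_ac)
  qed
qed

text \<open>Integrand of the Bernstein representation of \<open>r powr s\<close>, with
  \<open>z\<close> standing for \<open>- l * r\<close>. The power of \<open>l\<close> is, up to a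
  constant, the Levy density of the \<open>s\<close>-stable subordinator.\<close>

abbreviation levy :: "real \<Rightarrow> real \<Rightarrow> real \<Rightarrow> real" where
  "levy s l z \<equiv> indicator {0<..} l * l powr (- 1 - s) * (1 - exp z)"

text \<open>Near 0 the bound \<open>1 - exp (- l) \<le> l\<close> gains one power of
  \<open>l\<close>, and \<open>s < 1\<close> suffices; on \<open>{1..}\<close> the bound 1 leaves a
  tail that is integrable because \<open>s > 0\<close>.\<close>

lemma integrable_levy_density:
  fixes s :: real
  assumes s: "0 < s" "s < 1"
  shows "integrable lborel (\<lambda>l. levy s l (- l))"
proof -
  have c: "integrable lborel (\<lambda>x. indicator S x * x powr a)"
    if "(\<lambda>x. x powr a) integrable_on S" "S \<in> sets borel" for a and S :: "real set"
  proof -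
    have "(\<lambda>x. x powr a) absolutely_integrable_on S"
      using that by (intro nonnegative_absolutely_integrable_1) auto
    then have "integrable lebesgue (\<lambda>x. indicator S x * x powr a)"
      by (simp add: set_integrable_def)
    then show ?thesis using that(2) by (subst (asm) integrable_completion) auto
  qed
  have "integrable lborel (\<lambda>l. indicator {0..1} l * l powr (- s) + indicator {1..} l * l powr (- 1 - s))"
    using s by (intro Bochner_Integration.integrable_add c integrable_on_powr_from_0
        has_integral_integrable[OF has_integral_powr_to_inf]) auto
  then show ?thesis
  proof (rule Bochner_Integration.integrable_bound)
    have "norm (levy s l (- l))
       \<le> indicator {0..1} l * l powr (- s) + indicator {1..} l * l powr (- 1 - s)" for l :: real
    proof (cases "l > 0")
      case l: True
      have e: "0 \<le> 1 - exp (- l)" "1 - exp (- l) \<le> 1" "1 - exp (- l) \<le> l"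
        using l exp_ge_add_one_self[of "- l"] by auto
      show ?thesis
      proof (cases "l \<le> 1")
        case True
        have "l powr (- 1 - s) * (1 - exp (- l)) \<le> l powr (- 1 - s) * l"
          using e by (intro mult_left_mono) auto
        also have "\<dots> = l powr (- s)"
          using l powr_add[of l "- 1 - s" 1] by simp
        finally have "l powr (- 1 - s) * (1 - exp (- l)) \<le> l powr (- s)" .
        moreover have "- 1 \<le> exp (- 1 :: real)"
          by (rule order_trans[of _ 0]) auto
        ultimately show ?thesis using l True e by (auto simp: indicator_def abs_mult)
      next
        case False
        then show ?thesis using l e by (auto simp: indicator_def abs_mult mult_left_le)
      qed
    qed auto
    then show "AE l in lborel. norm (levy s l (- l))
       \<le> norm (indicator {0..1} l * l powr (- s) + indicator {1..} l * l powr (- 1 - s))"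
      by (intro AE_I2) (auto intro: order_trans[OF _ abs_ge_self])
  qed measurable
qed

text \<open>This integral is the normalising constant by which the density is divided later; its
  part over \<open>{1..2}\<close> already keeps it away from 0.\<close>

lemma integral_levy_density_pos:
  fixes s :: real
  assumes s: "0 < s" "s < 1"
  shows "0 < (LINT l|lborel. levy s l (- l))"
proof -
  let ?c = "2 powr (- 1 - s) * (1 - exp (- 1 :: real))"
  have "0 < ?c" by simp
  also have "?c = (LINT l|lborel. ?c * indicator {1..2::real} l)" by simp
  also have "\<dots> \<le> (LINT l|lborel. levy s l (- l))"
  proof (rule integral_mono)
    show "?c * indicator {1..2::real} l \<le> levy s l (- l)" for l
    proof (cases "l \<in> {1..2}")
      case True
      then show ?thesis using s by (auto intro!: mult_mono powr_mono2')
    next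
      case False
      then show ?thesis by (cases "l > 0") auto
    qed
    show "integrable lborel (\<lambda>l. ?c * indicator {1..2::real} l)"
      by (intro integrable_mult_right) (simp add: integrable_indicator_iff)
  qed (rule integrable_levy_density[OF s])
  finally show ?thesis .
qed

text \<open>The power of \<open>l\<close> is homogeneous of degree \<open>- 1 - s\<close>, so
  replacing \<open>l\<close> by \<open>r * l\<close> costs \<open>r powr (1 + s)\<close>, and the
  change of variable gives one factor \<open>r\<close> back.\<close>

lemma
  fixes s r :: real
  assumes s: "0 < s" "s < 1" and r: "0 < r"
  shows integrable_levy_density_scaled:
      "integrable lborel (\<lambda>l. levy s l (- l * r))" (is ?I)
    and integral_levy_density_scaled:
      "(LINT l|lborel. levy s l (- l * r))
        = r powr s * (LINT l|lborel. levy s l (- l))" (is ?E)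
proof -
  let ?f = "\<lambda>l. levy s l (- l) :: real"
  have eq: "levy s l (- l * r) = r powr (1 + s) * ?f (0 + r * l)" for l
    using r powr_add[of r "1 + s" "- 1 - s"]
    by (cases "l > 0") (auto simp: powr_mult indicator_def zero_less_mult_iff mult_ac)
  show ?I unfolding eq
    using r by (intro integrable_mult_right lborel_integrable_real_affine integrable_levy_density s) auto
  have "(LINT l|lborel. ?f l) = r * (LINT l|lborel. ?f (0 + r * l))"
    using lborel_integral_real_affine[of r ?f 0] r by simp
  then show ?E unfolding eq using r by (simp add: powr_add)
qed

text \<open>Subordination. For a truncated Levy measure of total mass \<open>B n\<close> the
  exponent is \<open>B n - L n \<xi>\<close>, so its exponential is a positive constant times
  \<open>exp (t * L n \<xi>)\<close>, which the series lemma covers. Removing the truncation gives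
  the fractional power.\<close>

lemma pos_def_mult_stable:
  assumes s: "0 < \<sigma>" "\<sigma> < 1" and t: "0 \<le> t"
  shows "pos_def_mult (\<lambda>\<xi>::'a::euclidean_space. exp (- t * norm \<xi> powr (2 * \<sigma>)))"
proof -
  define c where "c = (LINT l|lborel. levy \<sigma> l (- l))"
  have c: "0 < c" unfolding c_def by (rule integral_levy_density_pos[OF s])
  \<comment> \<open>Cutting off both ends makes the weight integrable, which the full density is not
    near 0. Dividing by \<open>c\<close> makes the limit exactly
    \<open>norm \<xi> powr (2 * \<sigma>)\<close>.\<close>
  define w where "w = (\<lambda>n l. indicator {1 / real (Suc n)..real (Suc n)} l * (l powr (- 1 - \<sigma>) / c))"
  define B where "B = (\<lambda>n. LINT l|lborel. w n l)"
  define L where "L = (\<lambda>n (\<xi>::'a). LINT l|lborel. w n l * exp (- l * (norm \<xi>)\<^sup>2))"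
  have [measurable]: "w n \<in> borel_measurable borel" for n unfolding w_def by measurable
  have w0: "0 \<le> w n l" for n l using c by (simp add: w_def)
  have wneg: "w n l = 0" if "l < 0" for n l
  proof -
    have "0 < 1 / real (Suc n)" by simp
    then have "l \<notin> {1 / real (Suc n)..real (Suc n)}" using that by (simp only: atLeastAtMost_iff) linarith
    then show ?thesis by (simp add: w_def)
  qed
  have w_int: "integrable lborel (w n)" for n
  proof -
    have "set_integrable lborel {1 / real (Suc n)..real (Suc n)} (\<lambda>l. l powr (- 1 - \<sigma>) / c)"
      unfolding set_integrable_def
    proof (rule borel_integrable_compact)
      have "0 < l" if "l \<in> {1 / real (Suc n)..real (Suc n)}" for l
        using that less_le_trans[of 0 "1 / real (Suc n)" l] by simp
      then show "continuous_on {1 / real (Suc n)..real (Suc n)} (\<lambda>l. l powr (- 1 - \<sigma>) / c)"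
        using c by (intro continuous_intros) force+
    qed simp
    then show ?thesis by (simp add: set_integrable_def w_def)
  qed
  have we_le: "w n l * exp (- l * r) \<le> w n l" if "0 \<le> r" for n l and r :: real
    using that w0[of n l] wneg[of l n] by (cases "l < 0") (auto simp: mult_left_le)
  have we_int: "integrable lborel (\<lambda>l. w n l * exp (- l * r))" if "0 \<le> r" for n and r :: real
    by (rule Bochner_Integration.integrable_bound[OF w_int[of n]]) (use that we_le w0 in \<open>auto simp: abs_mult\<close>)
  have BL: "B n - L n \<xi> = (LINT l|lborel. w n l * (1 - exp (- l * (norm \<xi>)\<^sup>2)))" for n \<xi>
    unfolding B_def L_def by (subst Bochner_Integration.integral_diff[symmetric], rule w_int, rule we_int, simp, simp add: algebra_simps)
  have BL0: "0 \<le> B n - L n \<xi>" for n \<xi>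
    unfolding BL using we_le[of "(norm \<xi>)\<^sup>2" n] by (intro Bochner_Integration.integral_nonneg) (auto simp: algebra_simps)
  have lim: "(\<lambda>n. B n - L n \<xi>) \<longlonglongrightarrow> norm \<xi> powr (2 * \<sigma>)" for \<xi>
  proof (cases "\<xi> = 0")
    case True
    then show ?thesis unfolding BL by simp
  next
    case False
    define r where "r = (norm \<xi>)\<^sup>2"
    have r: "0 < r" using False by (simp add: r_def)
    let ?g = "\<lambda>l. levy \<sigma> l (- l * r) / c"
    have "(\<lambda>n. LINT l|lborel. w n l * (1 - exp (- l * r))) \<longlonglongrightarrow> (LINT l|lborel. ?g l)"
    proof (rule integral_dominated_convergence)
      show "integrable lborel ?g"
        using integrable_levy_density_scaled[OF s r] by simp
      \<comment> \<open>For fixed \<open>l > 0\<close> the sequence is eventually constant, namely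
        once the truncation interval contains \<open>l\<close>.\<close>
      have "(\<lambda>n. w n l * (1 - exp (- l * r))) \<longlonglongrightarrow> ?g l" for l
      proof (cases "l > 0")
        case True
        obtain N where N: "max l (1 / l) \<le> real N" using real_arch_simple by blast
        have "w n l * (1 - exp (- l * r)) = ?g l" if "n \<ge> N" for n
        proof -
          have "l \<le> real (Suc n)" "1 / l \<le> real (Suc n)" using N that by auto
          then have "l \<in> {1 / real (Suc n)..real (Suc n)}" using True by (simp add: field_simps del: of_nat_Suc)
          then show ?thesis using True by (simp add: w_def)
        qed
        then show ?thesis
          by (intro tendsto_eventually) (auto simp: eventually_sequentially)
      next
        case False
        then have "w n l = 0" for n
          using wneg[of l n] by (cases "l = 0") (auto simp: w_def)
        then show ?thesis using False by simp
      qed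
      then show "AE l in lborel. (\<lambda>n. w n l * (1 - exp (- l * r))) \<longlonglongrightarrow> ?g l" by simp
      have "norm (w n l * (1 - exp (- l * r))) \<le> ?g l" for n l
      proof (cases "l > 0")
        case True
        then have "0 \<le> 1 - exp (- l * r)" using r by simp
        then show ?thesis using True c by (auto simp: w_def indicator_def abs_mult)
      next
        case False
        then have "w n l = 0"
          using wneg[of l n] by (cases "l = 0") (auto simp: w_def)
        then show ?thesis using False by simp
      qed
      then show "AE l in lborel. norm (w n l * (1 - exp (- l * r))) \<le> ?g l" for n by simp
    qed measurable
    moreover have "(LINT l|lborel. ?g l) = r powr \<sigma>"
      using integral_levy_density_scaled[OF s r] c by (simp add: c_def)
    moreover have "r powr \<sigma> = norm \<xi> powr (2 * \<sigma>)"
      using False by (simp add: r_def powr_powr flip: powr_numeral)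
    ultimately show ?thesis unfolding BL r_def by simp
  qed
  show ?thesis
  proof (rule pos_def_mult_limit)
    show "pos_def_mult (\<lambda>\<xi>. exp (- t * (B n - L n \<xi>)))" for n
      using pos_def_mult_scale[OF pos_def_mult_exp_laplace[OF w_int[of n] w0 wneg t], of "exp (- t * B n)"]
      by (simp add: L_def right_diff_distrib flip: exp_add)
    show "\<bar>exp (- t * (B n - L n \<xi>))\<bar> \<le> 1" for n \<xi>
      using BL0[of n \<xi>] t by simp
    show "(\<lambda>n. exp (- t * (B n - L n \<xi>))) \<longlonglongrightarrow> exp (- t * norm \<xi> powr (2 * \<sigma>))" for \<xi>
      by (intro tendsto_intros lim)
  qed
qed

text \<open>The local part of the operator supplies exactly the Gaussian that
  \<open>pos_def_mult\<close> asks for, with \<open>a = t\<close>.\<close>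

lemma mker_integral_nonneg:
  assumes s: "0 < \<sigma>" "\<sigma> < 1" and t: "0 < t"
  shows "(symb_ft \<sigma> t x) \<in> \<real>\<^sub>\<ge>\<^sub>0"
proof -
  have "(LINT \<xi>|lborel. iexp (x \<bullet> \<xi>) * of_real (exp (- t * (norm \<xi>)\<^sup>2) * exp (- t * norm \<xi> powr (2 * \<sigma>)))) \<in> \<real>\<^sub>\<ge>\<^sub>0"
    using pos_def_mult_stable[OF s, of t, where 'a='a] t unfolding pos_def_mult_def by auto
  then show ?thesis by (simp add: symb_def distrib_left flip: exp_add)
qed

lemma mker_nonneg:
  assumes s: "0 < \<sigma>" "\<sigma> < 1"
  shows "0 \<le> mker \<sigma> t x"
  using mker_integral_nonneg[OF s, of t x] by (auto simp: mker_def complex_nonneg_Reals_iff)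

text \<open>Lying in the nonnegative reals includes having imaginary part 0, so the
  \<open>Re\<close> in \<open>mker\<close> loses nothing.\<close>

lemma complex_of_real_mker:
  fixes x :: "'a::euclidean_space"
  assumes s: "0 < \<sigma>" "\<sigma> < 1" and t: "0 < t"
  shows "complex_of_real (mker \<sigma> t x) = complex_of_real (1 / (2 * pi) ^ DIM('a)) *
     (symb_ft \<sigma> t x)"
  using mker_integral_nonneg[OF s t, of x] t by (auto simp: mker_def complex_nonneg_Reals_iff complex_eq_iff)

lemma mker_measurable_pair [measurable]:
  "(\<lambda>(t, x::'a::euclidean_space). mker \<sigma> t x) \<in> borel_measurable (borel \<Otimes>\<^sub>M borel)"
  unfolding mker_def by measurable

lemma mker_measurable [measurable]: "mker \<sigma> t \<in> borel_measurable borel"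
  unfolding mker_def[abs_def] by measurable

lemma mker_bound:
  fixes x :: "'a::euclidean_space"
  assumes t: "0 < t"
  shows "\<bar>mker \<sigma> t x\<bar> \<le> 1 / (2 * pi) ^ DIM('a) * (LINT \<xi>|(lborel::'a measure). exp (- t * symb \<sigma> \<xi>))"
proof -
  have "\<bar>Re (symb_ft \<sigma> t x)\<bar>
      \<le> (LINT \<xi>|(lborel::'a measure). exp (- t * symb \<sigma> \<xi>))"
    by (intro order_trans[OF abs_Re_le_cmod] order_trans[OF integral_norm_bound]) (simp add: norm_mult)
  then show ?thesis using t by (simp add: mker_def abs_mult divide_right_mono)
qed

text \<open>Eventually the times exceed \<open>t / 2\<close>, which fixes one integrable majorant
  for all of them; the shift by \<open>N\<close> discards the earlier ones.\<close>

lemma mker_continuous_time: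
  fixes x :: "'a::euclidean_space"
  assumes t: "0 < t" and lim: "\<tau> \<longlonglongrightarrow> t"
  shows "(\<lambda>n. mker \<sigma> (\<tau> n) x) \<longlonglongrightarrow> mker \<sigma> t x"
proof -
  have ev: "\<forall>\<^sub>F n in sequentially. t / 2 < \<tau> n"
    using lim t by (intro order_tendstoD(1)) auto
  then obtain N where N: "\<And>n. n \<ge> N \<Longrightarrow> t / 2 < \<tau> n" by (auto simp: eventually_sequentially)
  have "(\<lambda>n. LINT \<xi>|lborel. iexp (x \<bullet> \<xi>) * of_real (exp (- \<tau> (n + N) * symb \<sigma> \<xi>)))
      \<longlonglongrightarrow> (symb_ft \<sigma> t x)"
  proof (rule integral_dominated_convergence)
    show "integrable lborel (\<lambda>\<xi>::'a. exp (- (t/2) * symb \<sigma> \<xi>))"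
      using t by (intro integrable_exp_symb) simp
    have "(t/2) * symb \<sigma> \<xi> \<le> \<tau> (n + N) * symb \<sigma> \<xi>" for n and \<xi> :: 'a
      using N[of "n + N"] by (intro mult_right_mono symb_nonneg) simp
    then show "AE \<xi> in lborel. norm (iexp (x \<bullet> \<xi>) * of_real (exp (- \<tau> (n + N) * symb \<sigma> \<xi>)))
       \<le> exp (- (t/2) * symb \<sigma> \<xi>)" for n
      by (auto simp: norm_mult)
    show "AE \<xi> in lborel. (\<lambda>n. iexp (x \<bullet> \<xi>) * of_real (exp (- \<tau> (n + N) * symb \<sigma> \<xi>)))
      \<longlonglongrightarrow> iexp (x \<bullet> \<xi>) * of_real (exp (- t * symb \<sigma> \<xi>))"
      by (intro AE_I2 tendsto_intros LIMSEQ_ignore_initial_segment lim)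
  qed measurable
  moreover have "\<not> \<tau> (n + N) \<le> 0" "\<not> t \<le> 0" for n
    using N[of "n + N"] t by auto
  ultimately have "(\<lambda>n. mker \<sigma> (\<tau> (n + N)) x) \<longlonglongrightarrow> mker \<sigma> t x"
    unfolding mker_def if_not_P by (simp only: if_False) (intro tendsto_intros tendsto_Re)
  then show ?thesis by (rule LIMSEQ_offset)
qed

section \<open>Mass, convolution, and decay of the kernel\<close>

text \<open>A Gaussian average of \<open>exp (- t * symb \<sigma> \<xi>)\<close> around
  \<open>- y\<close> at scale \<open>2 * sqrt \<delta>\<close>, lacking only the normalising power
  of \<open>pi\<close>.\<close>

abbreviation damped :: "real \<Rightarrow> real \<Rightarrow> real \<Rightarrow> 'a::euclidean_space \<Rightarrow> real" where
  "damped \<sigma> t \<delta> y \<equiv>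
     LINT z|lborel. exp (- t * symb \<sigma> ((2 * sqrt \<delta>) *\<^sub>R z - y)) * exp (- (norm z)\<^sup>2)"

text \<open>The factor \<open>exp (- \<delta> \<bar>x\<bar>\<^sup>2)\<close> makes Fubini applicable before the integrability of the
  kernel is known.\<close>
lemma mker_damped_fourier:
  fixes y :: "'a::euclidean_space"
  assumes s: "0 < \<sigma>" "\<sigma> < 1" and t: "0 < t" and d: "0 < \<delta>"
  shows "(LINT x|lborel. of_real (mker \<sigma> t x * exp (- \<delta> * (norm x)\<^sup>2)) * iexp (x \<bullet> y))
    = complex_of_real ((damped \<sigma> t \<delta> y) / pi powr (DIM('a) / 2))"
proof -
  let ?E = "\<lambda>\<xi>::'a. exp (- t * symb \<sigma> \<xi>)"
  let ?G = "\<lambda>x::'a. exp (- \<delta> * (norm x)\<^sup>2)"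
  have iE: "integrable lborel ?E" by (rule integrable_exp_symb[OF t])
  have iG: "integrable lborel ?G" by (rule integrable_exp_norm_sq[OF d])
  let ?c = "1 / (2 * pi) ^ DIM('a)"
  let ?F = "\<lambda>x \<xi>. of_real (?c * ?E \<xi>) * (iexp ((\<xi> + y) \<bullet> x) * of_real (?G x))"
  have "(LINT x|lborel. of_real (mker \<sigma> t x * ?G x) * iexp (x \<bullet> y))
     = (LINT x|lborel. LINT \<xi>|lborel. ?F x \<xi>)"
  proof (intro Bochner_Integration.integral_cong refl)
    fix x
    have xy: "(\<xi> + y) \<bullet> x = x \<bullet> \<xi> + x \<bullet> y" for \<xi>
      by (subst inner_commute) (rule inner_add_right)
    have "of_real (mker \<sigma> t x * ?G x) * iexp (x \<bullet> y)
       = (of_real (?c * ?G x) * iexp (x \<bullet> y)) * (LINT \<xi>|lborel. iexp (x \<bullet> \<xi>) * of_real (?E \<xi>))"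
      by (simp only: of_real_mult complex_of_real_mker[OF s t] mult_ac)
    also have "\<dots> = (LINT \<xi>|lborel. (of_real (?c * ?G x) * iexp (x \<bullet> y)) * (iexp (x \<bullet> \<xi>) * of_real (?E \<xi>)))"
      by (rule integral_mult_right_zero[symmetric])
    also have "\<dots> = (LINT \<xi>|lborel. ?F x \<xi>)"
      by (intro Bochner_Integration.integral_cong refl)
         (simp add: xy distrib_left exp_add)
    finally show "of_real (mker \<sigma> t x * ?G x) * iexp (x \<bullet> y) = (LINT \<xi>|lborel. ?F x \<xi>)" .
  qed
  also have "\<dots> = (LINT \<xi>|lborel. LINT x|lborel. ?F x \<xi>)"
  proof (rule integral_swap_dominated)
    show "integrable lborel ?G" by (rule iG)
    show "integrable lborel (\<lambda>\<xi>. ?c * ?E \<xi>)" using iE by (intro integrable_mult_right)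
    show "norm (?F x \<xi>) \<le> ?G x * (?c * ?E \<xi>)" for x \<xi> by (simp add: norm_mult norm_power norm_divide mult.commute)
  qed measurable
  also have "\<dots> = (LINT \<xi>|lborel. complex_of_real (?c * ?E \<xi> * ((pi / \<delta>) powr (DIM('a) / 2) * exp (- (norm (\<xi> + y))\<^sup>2 / (4 * \<delta>)))))"
    by (simp only: integral_mult_right_zero integral_gaussian_iexp[OF d] of_real_mult)
  also have "\<dots> = complex_of_real (LINT \<xi>|lborel. ?c * ?E \<xi> * ((pi / \<delta>) powr (DIM('a) / 2) * exp (- (norm (\<xi> + y))\<^sup>2 / (4 * \<delta>))))"
    by (rule integral_complex_of_real)
  \<comment> \<open>The Gaussian in \<xi> is centered at \<open>- y\<close> and has width of order
    \<open>sqrt \<delta>\<close>; in the variable \<open>z\<close> it becomes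
    \<open>exp (- (norm z)\<^sup>2)\<close>.\<close>
  also have "(LINT \<xi>|lborel. ?c * ?E \<xi> * ((pi / \<delta>) powr (DIM('a) / 2) * exp (- (norm (\<xi> + y))\<^sup>2 / (4 * \<delta>))))
      = (2 * sqrt \<delta>) ^ DIM('a) * (LINT z|lborel. ?c * ?E (- y + (2 * sqrt \<delta>) *\<^sub>R z) * ((pi / \<delta>) powr (DIM('a) / 2) * exp (- (norm (- y + (2 * sqrt \<delta>) *\<^sub>R z + y))\<^sup>2 / (4 * \<delta>))))"
    using d by (subst integral_lborel_scale[of _ "2 * sqrt \<delta>" "- y"]) auto
  also have "\<dots> = (LINT z|lborel. (2 * sqrt \<delta>) ^ DIM('a) * ?c * (pi / \<delta>) powr (DIM('a) / 2) * (?E ((2 * sqrt \<delta>) *\<^sub>R z - y) * exp (- (norm z)\<^sup>2)))"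
    using d by (subst integral_mult_right_zero[symmetric], intro Bochner_Integration.integral_cong refl)
       (simp add: power_mult_distrib mult_ac)
  also have "(2 * sqrt \<delta>) ^ DIM('a) * ?c * (pi / \<delta>) powr (DIM('a) / 2) = 1 / pi powr (DIM('a) / 2)"
  proof -
    have h: "u powr (DIM('a) / 2) = sqrt u ^ DIM('a)" if "u > 0" for u
      using that by (simp add: powr_half_sqrt_powr powr_realpow real_sqrt_power)
    have p: "pi ^ DIM('a) = sqrt pi ^ DIM('a) * sqrt pi ^ DIM('a)" 
      by (simp flip: power_mult_distrib)
    show ?thesis using d
      by (subst h, simp, subst h, simp) (simp add: p real_sqrt_divide power_divide power_mult_distrib field_simps)
  qed
  finally show ?thesis
    by (simp only: integral_mult_right_zero) (simp add: mult.commute)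
qed

lemma gaussian_normalised:
  "(LINT z|lborel. exp (- (norm (z::'a::euclidean_space))\<^sup>2)) = pi powr (DIM('a) / 2)"
proof -
  have "complex_of_real (LINT z|lborel. exp (- (norm (z::'a))\<^sup>2)) = complex_of_real (pi powr (DIM('a) / 2))"
    using integral_gaussian_iexp[of 1 "0::'a"] by simp
  then show ?thesis by (simp only: of_real_eq_iff)
qed

text \<open>The average concentrates at its center \<open>- y\<close>, and \<open>symb\<close> is
  even. Continuity of \<open>symb\<close> at the origin is where \<sigma> has to be
  positive.\<close>

lemma damped_limit:
  fixes y :: "'a::euclidean_space"
  assumes t: "0 < t" and s: "0 < \<sigma>"
  shows "(\<lambda>n. (damped \<sigma> t (1 / real (Suc n)) y) / pi powr (DIM('a) / 2))
    \<longlonglongrightarrow> exp (- t * symb \<sigma> y)"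
proof -
  have c: "continuous_on UNIV (symb \<sigma> :: 'a \<Rightarrow> real)"
    unfolding symb_def[abs_def] using s by (intro continuous_intros continuous_on_powr') auto
  have "(\<lambda>n. damped \<sigma> t (1 / real (Suc n)) y)
     \<longlonglongrightarrow> (LINT z|lborel. exp (- t * symb \<sigma> y) * exp (- (norm (z::'a))\<^sup>2))"
  proof (rule integral_dominated_convergence)
    show "integrable lborel (\<lambda>z::'a. exp (- (norm z)\<^sup>2))"
      using integrable_exp_norm_sq[of 1, where 'a='a] by simp
    show "AE z in lborel. norm (exp (- t * symb \<sigma> ((2 * sqrt (1 / real (Suc n))) *\<^sub>R z - y)) * exp (- (norm z)\<^sup>2)) \<le> exp (- (norm z)\<^sup>2)" for n
      using t symb_nonneg[where 'a='a, of \<sigma>] by (auto simp: mult_le_cancel_right1)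
    have "(\<lambda>n. symb \<sigma> ((2 * sqrt (1 / real (Suc n))) *\<^sub>R z - y)) \<longlonglongrightarrow> symb \<sigma> y" for z :: 'a
    proof -
      have "(\<lambda>n. sqrt (1 / real (Suc n))) \<longlonglongrightarrow> sqrt 0"
        using LIMSEQ_inverse_real_of_nat by (intro tendsto_real_sqrt) (simp add: divide_inverse)
      then have "(\<lambda>n. (2 * sqrt (1 / real (Suc n))) *\<^sub>R z - y) \<longlonglongrightarrow> (2 * sqrt 0) *\<^sub>R z - y"
        by (intro tendsto_diff tendsto_scaleR tendsto_mult tendsto_const)
      then have "(\<lambda>n. symb \<sigma> ((2 * sqrt (1 / real (Suc n))) *\<^sub>R z - y)) \<longlonglongrightarrow> symb \<sigma> ((2 * sqrt 0) *\<^sub>R z - y)"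
        using continuous_on_tendsto_compose[OF c] by simp
      then show ?thesis by (simp add: symb_def)
    qed
    then show "AE z in lborel. (\<lambda>n. exp (- t * symb \<sigma> ((2 * sqrt (1 / real (Suc n))) *\<^sub>R z - y)) * exp (- (norm z)\<^sup>2))
      \<longlonglongrightarrow> exp (- t * symb \<sigma> y) * exp (- (norm z)\<^sup>2)"
      by (intro AE_I2 tendsto_intros)
  qed measurable
  then have "(\<lambda>n. damped \<sigma> t (1 / real (Suc n)) y)
     \<longlonglongrightarrow> exp (- t * symb \<sigma> y) * pi powr (DIM('a) / 2)"
    by (simp only: integral_mult_right_zero gaussian_normalised)
  from tendsto_divide[OF this tendsto_const[of "pi powr (DIM('a) / 2)"]] show ?thesis by simp
qed

text \<open>Because the kernel is nonnegative, the damped integrands increase as the damping is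
  removed. Convergence of their integrals to \<open>exp (- t * symb \<sigma> 0) = 1\<close> then
  yields integrability and the value at once.\<close>

lemma
  assumes s: "0 < \<sigma>" "\<sigma> < 1" and t: "0 < t"
  shows mker_integrable: "integrable lborel (mker \<sigma> t :: 'a::euclidean_space \<Rightarrow> real)" (is ?I)
    and mker_integral: "(LINT x|lborel. mker \<sigma> t (x::'a)) = 1" (is ?E)
proof -
  let ?G = "\<lambda>n x::'a. exp (- (1 / real (Suc n)) * (norm x)\<^sup>2)"
  obtain B where B: "\<And>x::'a. \<bar>mker \<sigma> t x\<bar> \<le> B" using mker_bound[OF t] by blast
  have i: "integrable lborel (\<lambda>x::'a. mker \<sigma> t x * ?G n x)" for n
  proof (rule Bochner_Integration.integrable_bound)
    show "integrable lborel (\<lambda>x::'a. B * ?G n x)"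
      by (intro integrable_mult_right integrable_exp_norm_sq) simp
    show "AE x::'a in lborel. norm (mker \<sigma> t x * ?G n x) \<le> norm (B * ?G n x)"
      by (intro AE_I2) (auto simp: abs_mult intro!: mult_right_mono order_trans[OF B abs_ge_self])
  qed measurable
  have "has_bochner_integral lborel (mker \<sigma> t :: 'a \<Rightarrow> real) 1"
  proof (rule has_bochner_integral_monotone_convergence)
    show "integrable lborel (\<lambda>x::'a. mker \<sigma> t x * ?G n x)" for n by (rule i)
    show "AE x::'a in lborel. mono (\<lambda>n. mker \<sigma> t x * ?G n x)"
    proof (intro AE_I2 monoI mult_left_mono mker_nonneg s)
      fix x :: 'a and m n :: nat assume "m \<le> n"
      then have "1 / real (Suc n) * (norm x)\<^sup>2 \<le> 1 / real (Suc m) * (norm x)\<^sup>2"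
        by (intro mult_right_mono) (auto simp: frac_le)
      then show "?G m x \<le> ?G n x" by simp
    qed
    have "(\<lambda>n. 1 / real (Suc n)) \<longlonglongrightarrow> 0"
      using LIMSEQ_inverse_real_of_nat by (simp add: divide_inverse)
    then have "(\<lambda>n. mker \<sigma> t x * ?G n x) \<longlonglongrightarrow> mker \<sigma> t x * exp (- 0 * (norm x)\<^sup>2)" for x
      by (intro tendsto_mult tendsto_const tendsto_exp tendsto_minus)
    then show "AE x in lborel. (\<lambda>n. mker \<sigma> t x * ?G n x) \<longlonglongrightarrow> mker \<sigma> t x" by simp
    have "(LINT x|lborel. mker \<sigma> t (x::'a) * ?G n x)
      = (damped \<sigma> t (1 / real (Suc n)) (0::'a)) / pi powr (DIM('a) / 2)" for n
      using mker_damped_fourier[OF s t, of "1 / real (Suc n)" "0::'a"]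
      by (simp only: inner_zero_right of_real_0 mult_zero_right exp_zero mult_1_right integral_complex_of_real of_real_eq_iff) simp
    then show "(\<lambda>n. LINT x|lborel. mker \<sigma> t (x::'a) * ?G n x) \<longlonglongrightarrow> 1"
      using damped_limit[OF t s(1), of "0::'a"] by simp
  qed measurable
  then show ?I ?E by (simp_all add: has_bochner_integral_iff)
qed

lemma mker_nn_integral:
  assumes s: "0 < \<sigma>" "\<sigma> < 1" and t: "0 < t"
  shows "(\<integral>\<^sup>+x. ennreal (mker \<sigma> t (x::'a::euclidean_space)) \<partial>lborel) = 1"
  by (subst nn_integral_eq_integral[OF mker_integrable[OF s t]])
     (simp_all add: mker_nonneg[OF s] mker_integral[OF s t])

text \<open>Now that the kernel is known to be integrable it serves as its own majorant, and the
  damping can be removed at every frequency.\<close>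

lemma mker_fourier:
  fixes y :: "'a::euclidean_space"
  assumes s: "0 < \<sigma>" "\<sigma> < 1" and t: "0 < t"
  shows "(LINT x|lborel. of_real (mker \<sigma> t x) * iexp (x \<bullet> y)) = of_real (exp (- t * symb \<sigma> y))"
proof (rule LIMSEQ_unique)
  let ?G = "\<lambda>n x::'a. exp (- (1 / real (Suc n)) * (norm x)\<^sup>2)"
  let ?f = "\<lambda>n. LINT x|lborel. of_real (mker \<sigma> t x * ?G n x) * iexp (x \<bullet> y)"
  show "?f \<longlonglongrightarrow> (LINT x|lborel. of_real (mker \<sigma> t x) * iexp (x \<bullet> y))"
  proof (rule integral_dominated_convergence)
    show "integrable lborel (mker \<sigma> t :: 'a \<Rightarrow> real)" by (rule mker_integrable[OF s t])
    show "AE x in lborel. norm (of_real (mker \<sigma> t x * ?G n x) * iexp (x \<bullet> y)) \<le> mker \<sigma> t x" for n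
      using mker_nonneg[OF s, of t, where 'a='a] by (auto simp: norm_mult abs_mult mult_left_le)
    have "(\<lambda>n. 1 / real (Suc n)) \<longlonglongrightarrow> 0"
      using LIMSEQ_inverse_real_of_nat by (simp add: divide_inverse)
    then have "(\<lambda>n. of_real (mker \<sigma> t x * ?G n x) * iexp (x \<bullet> y))
      \<longlonglongrightarrow> of_real (mker \<sigma> t x * exp (- 0 * (norm x)\<^sup>2)) * iexp (x \<bullet> y)" for x
      by (intro tendsto_mult tendsto_of_real tendsto_const tendsto_exp tendsto_minus)
    then show "AE x in lborel. (\<lambda>n. of_real (mker \<sigma> t x * ?G n x) * iexp (x \<bullet> y))
      \<longlonglongrightarrow> of_real (mker \<sigma> t x) * iexp (x \<bullet> y)" by simp
  qed measurable
  show "?f \<longlonglongrightarrow> complex_of_real (exp (- t * symb \<sigma> y))"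
    using tendsto_of_real[OF damped_limit[OF t s(1), of y], where 'a=complex]
    by (subst mker_damped_fourier[OF s t]) simp_all
qed

section \<open>Semigroup property, continuity in L^1 and concentration at time 0\<close>

lemma nn_integral_lborel_reflect:
  fixes f :: "'a::euclidean_space \<Rightarrow> ennreal"
  assumes [measurable]: "f \<in> borel_measurable borel"
  shows "(\<integral>\<^sup>+y. f (x - y) \<partial>lborel) = (\<integral>\<^sup>+y. f y \<partial>lborel)"
proof -
  have "lborel = density (distr lborel borel (\<lambda>y::'a. x + (-1) *\<^sub>R y)) (\<lambda>_. ennreal (\<bar>- 1\<bar> ^ DIM('a)))"
    by (rule lborel_affine) simp
  then have "lborel = distr lborel borel (\<lambda>y::'a. x - y)" by (simp add: density_1)
  then have "(\<integral>\<^sup>+y. f y \<partial>lborel) = (\<integral>\<^sup>+y. f y \<partial>distr lborel borel (\<lambda>y::'a. x - y))" by simp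
  then show ?thesis by (simp add: nn_integral_distr)
qed

text \<open>Only the first kernel is expanded as a Fourier integral. The interchange is then
  dominated by the integrable \<open>mker \<sigma> r\<close> in \<open>y\<close> and an exponential
  in \<xi>, and the \<open>y\<close>-integral is the transform of the second kernel.\<close>

lemma mker_chapman_kolmogorov_integral:
  fixes x :: "'a::euclidean_space"
  assumes s: "0 < \<sigma>" "\<sigma> < 1" and t: "0 < t" and r: "0 < r"
  shows "(LINT y|lborel. mker \<sigma> t (x - y) * mker \<sigma> r y) = mker \<sigma> (t + r) x"
proof -
  let ?c = "1 / (2 * pi) ^ DIM('a)"
  let ?E = "\<lambda>\<xi>::'a. exp (- t * symb \<sigma> \<xi>)"
  let ?F = "\<lambda>y \<xi>. (of_real (?c * ?E \<xi>) * iexp (x \<bullet> \<xi>)) * (of_real (mker \<sigma> r y) * iexp (y \<bullet> (- \<xi>)))"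
  have "complex_of_real (LINT y|lborel. mker \<sigma> t (x - y) * mker \<sigma> r y)
     = (LINT y|lborel. complex_of_real (mker \<sigma> t (x - y) * mker \<sigma> r y))"
    by (rule integral_complex_of_real[symmetric])
  also have "\<dots> = (LINT y|lborel. LINT \<xi>|lborel. ?F y \<xi>)"
  proof (intro Bochner_Integration.integral_cong refl)
    fix y
    have "complex_of_real (mker \<sigma> t (x - y) * mker \<sigma> r y) =
       (of_real ?c * of_real (mker \<sigma> r y)) * (LINT \<xi>|lborel. iexp ((x - y) \<bullet> \<xi>) * of_real (?E \<xi>))"
      by (simp only: of_real_mult complex_of_real_mker[OF s t] mult_ac)
    also have "\<dots> = (LINT \<xi>|lborel. (of_real ?c * of_real (mker \<sigma> r y)) * (iexp ((x - y) \<bullet> \<xi>) * of_real (?E \<xi>)))"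
      by (rule integral_mult_right_zero[symmetric])
    also have "\<dots> = (LINT \<xi>|lborel. ?F y \<xi>)"
      by (intro Bochner_Integration.integral_cong refl)
         (simp add: inner_diff_left right_diff_distrib exp_diff exp_minus field_simps)
    finally show "complex_of_real (mker \<sigma> t (x - y) * mker \<sigma> r y) = (LINT \<xi>|lborel. ?F y \<xi>)" .
  qed
  also have "\<dots> = (LINT \<xi>|lborel. LINT y|lborel. ?F y \<xi>)"
  proof (rule integral_swap_dominated)
    show "integrable lborel (\<lambda>y::'a. mker \<sigma> r y)" by (rule mker_integrable[OF s r])
    show "integrable lborel (\<lambda>\<xi>. ?c * ?E \<xi>)" by (intro integrable_mult_right integrable_exp_symb[OF t])
    show "norm (?F y \<xi>) \<le> mker \<sigma> r y * (?c * ?E \<xi>)" for y \<xi>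
      using mker_nonneg[OF s, of r y] by (simp add: norm_mult norm_power norm_divide mult.commute)
  qed measurable
  also have "\<dots> = (LINT \<xi>|lborel. of_real ?c * (iexp (x \<bullet> \<xi>) * of_real (exp (- (t + r) * symb \<sigma> \<xi>))))"
  proof (intro Bochner_Integration.integral_cong refl)
    fix \<xi> :: 'a
    have "(LINT y|lborel. ?F y \<xi>) = (of_real (?c * ?E \<xi>) * iexp (x \<bullet> \<xi>)) * of_real (exp (- r * symb \<sigma> (- \<xi>)))"
      by (simp only: integral_mult_right_zero mker_fourier[OF s r])
    also have "\<dots> = of_real ?c * (iexp (x \<bullet> \<xi>) * (of_real (?E \<xi> * exp (- r * symb \<sigma> \<xi>))))"
      by (simp add: symb_def)
    also have "?E \<xi> * exp (- r * symb \<sigma> \<xi>) = exp (- (t + r) * symb \<sigma> \<xi>)"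
      by (simp add: algebra_simps flip: exp_add)
    finally show "(LINT y|lborel. ?F y \<xi>) = of_real ?c * (iexp (x \<bullet> \<xi>) * of_real (exp (- (t + r) * symb \<sigma> \<xi>)))" .
  qed
  also have "\<dots> = complex_of_real (mker \<sigma> (t + r) x)"
    using t r by (simp only: integral_mult_right_zero complex_of_real_mker[OF s add_pos_pos[OF t r], of x])
  finally show ?thesis by (simp only: of_real_eq_iff)
qed

lemma mker_chapman_kolmogorov:
  fixes x :: "'a::euclidean_space"
  assumes s: "0 < \<sigma>" "\<sigma> < 1" and t: "0 < t" and r: "0 < r"
  shows "(\<integral>\<^sup>+y. ennreal (mker \<sigma> t (x - y)) * ennreal (mker \<sigma> r y) \<partial>lborel) = ennreal (mker \<sigma> (t + r) x)"
proof -
  obtain B where B: "\<And>x::'a. \<bar>mker \<sigma> t x\<bar> \<le> B" using mker_bound[OF t] by blast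
  have "integrable lborel (\<lambda>y. mker \<sigma> t (x - y) * mker \<sigma> r y)"
    by (rule Bochner_Integration.integrable_bound[OF integrable_mult_right[OF mker_integrable[OF s r], of B]])
       (use mker_nonneg[OF s] in \<open>auto simp: abs_mult intro!: mult_right_mono order_trans[OF B abs_ge_self]\<close>)
  then have "(\<integral>\<^sup>+y. ennreal (mker \<sigma> t (x - y) * mker \<sigma> r y) \<partial>lborel)
      = ennreal (LINT y|lborel. mker \<sigma> t (x - y) * mker \<sigma> r y)"
    by (intro nn_integral_eq_integral AE_I2 mult_nonneg_nonneg mker_nonneg s)
  then show ?thesis
    by (simp add: mker_chapman_kolmogorov_integral[OF s t r] ennreal_mult mker_nonneg[OF s])
qed

text \<open>Scheffe's lemma: pointwise convergence, with masses that never exceed the mass 1 of the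
  limit.\<close>

lemma mker_L1_continuous:
  assumes s: "0 < \<sigma>" "\<sigma> < 1" and t: "0 < t" and lim: "\<tau> \<longlonglongrightarrow> t"
  shows "(\<lambda>n. \<integral>\<^sup>+x. ennreal \<bar>mker \<sigma> (\<tau> n) x - mker \<sigma> t (x::'a::euclidean_space)\<bar> \<partial>lborel) \<longlonglongrightarrow> 0"
proof -
  have "(\<lambda>n. \<integral>\<^sup>+x. norm (mker \<sigma> (\<tau> n) x - mker \<sigma> t (x::'a)) \<partial>lborel) \<longlonglongrightarrow> 0"
  proof (rule Scheffe_lemma2)
    have "(\<integral>\<^sup>+x. ennreal (norm (mker \<sigma> (\<tau> n) (x::'a))) \<partial>lborel) \<le> 1" for n
    proof (cases "\<tau> n \<le> 0")
      case True
      then show ?thesis by (simp add: mker_def)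
    next
      case False
      then show ?thesis by (simp add: mker_nonneg[OF s] mker_nn_integral[OF s])
    qed
    moreover have "(\<integral>\<^sup>+x. ennreal (norm (mker \<sigma> t (x::'a))) \<partial>lborel) = 1"
      by (simp add: mker_nonneg[OF s] mker_nn_integral[OF s t])
    ultimately show "(\<integral>\<^sup>+x. ennreal (norm (mker \<sigma> (\<tau> n) (x::'a))) \<partial>lborel) \<le> (\<integral>\<^sup>+x. ennreal (norm (mker \<sigma> t (x::'a))) \<partial>lborel)" for n
      by simp
  qed (use mker_continuous_time[OF t lim] mker_integrable[OF s t] in auto)
  then show ?thesis by simp
qed

text \<open>Markov's inequality for the function \<open>1 - exp (- (norm x)\<^sup>2)\<close>, which
  is at least \<open>c\<close> where \<open>\<delta> \<le> norm x\<close>. Its mean under the kernel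
  is \<open>1 - ?J t\<close>, by the damped Fourier formula with damping parameter 1, and tends to 0
  with \<open>t\<close>.\<close>

lemma mker_approx_identity:
  assumes s: "0 < \<sigma>" "\<sigma> < 1" and d: "0 < \<delta>" and e: "0 < e"
  shows "\<exists>t0>0. \<forall>t. 0 < t \<and> t < t0 \<longrightarrow>
    (\<integral>\<^sup>+x. indicator {x. \<delta> \<le> norm x} x * ennreal (mker \<sigma> t (x::'a::euclidean_space)) \<partial>lborel) \<le> ennreal e"
proof -
  define c where "c = 1 - exp (- \<delta>\<^sup>2)"
  have c: "0 < c" using d by (simp add: c_def)
  let ?J = "\<lambda>t. (LINT z|lborel. exp (- t * symb \<sigma> (2 *\<^sub>R z - 0)) * exp (- (norm (z::'a))\<^sup>2)) / pi powr (DIM('a) / 2)"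
  have "((\<lambda>t. LINT z|lborel. exp (- t * symb \<sigma> (2 *\<^sub>R z - 0)) * exp (- (norm (z::'a))\<^sup>2)) \<longlongrightarrow>
       (LINT z|lborel. exp (- (norm (z::'a))\<^sup>2))) (at_right 0)"
  proof (rule tendsto_at_right_sequentially[OF zero_less_one])
    fix S :: "nat \<Rightarrow> real" assume S: "\<And>n. 0 < S n" "S \<longlonglongrightarrow> 0"
    show "(\<lambda>n. LINT z|lborel. exp (- S n * symb \<sigma> (2 *\<^sub>R z - 0)) * exp (- (norm (z::'a))\<^sup>2))
      \<longlonglongrightarrow> (LINT z|lborel. exp (- (norm (z::'a))\<^sup>2))"
    proof (rule integral_dominated_convergence)
      show "integrable lborel (\<lambda>z::'a. exp (- (norm z)\<^sup>2))"
        using integrable_exp_norm_sq[of 1, where 'a='a] by simp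
      have "0 \<le> S n * symb \<sigma> (2 *\<^sub>R z)" for n and z :: 'a
        using S(1)[of n] symb_nonneg by (intro mult_nonneg_nonneg) auto
      then show "AE z::'a in lborel. norm (exp (- S n * symb \<sigma> (2 *\<^sub>R z - 0)) * exp (- (norm z)\<^sup>2)) \<le> exp (- (norm z)\<^sup>2)" for n
        by (auto simp: mult_le_cancel_right1)
      have "(\<lambda>n. exp (- S n * symb \<sigma> (2 *\<^sub>R z - 0)) * exp (- (norm z)\<^sup>2)) \<longlonglongrightarrow> exp (- 0 * symb \<sigma> (2 *\<^sub>R z - 0)) * exp (- (norm z)\<^sup>2)" for z :: 'a
        by (intro tendsto_intros S)
      then show "AE z::'a in lborel. (\<lambda>n. exp (- S n * symb \<sigma> (2 *\<^sub>R z - 0)) * exp (- (norm z)\<^sup>2)) \<longlonglongrightarrow> exp (- (norm z)\<^sup>2)"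
        by simp
    qed measurable
  qed
  from tendsto_divide[OF this tendsto_const[of "pi powr (DIM('a) / 2)"]]
  have "(?J \<longlongrightarrow> 1) (at_right 0)" by (simp add: gaussian_normalised)
  then have "\<forall>\<^sub>F t in at_right 0. 1 - c * e < ?J t"
    using c e by (intro order_tendstoD) auto
  then obtain t0 where t0: "0 < t0" "\<And>t. 0 < t \<Longrightarrow> t < t0 \<Longrightarrow> 1 - c * e < ?J t"
    by (auto simp: eventually_at_right_field)
  have "(\<integral>\<^sup>+x. indicator {x. \<delta> \<le> norm x} x * ennreal (mker \<sigma> t (x::'a)) \<partial>lborel) \<le> ennreal e"
    if t: "0 < t" "t < t0" for t
  proof -
    let ?g = "\<lambda>x::'a. mker \<sigma> t x - mker \<sigma> t x * exp (- 1 * (norm x)\<^sup>2)"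
    have i: "integrable lborel (\<lambda>x::'a. mker \<sigma> t x * exp (- 1 * (norm x)\<^sup>2))"
      by (rule Bochner_Integration.integrable_bound[OF mker_integrable[OF s t(1)]])
         (auto simp: abs_mult mult_left_le)
    have g0: "0 \<le> ?g x" for x
      using mker_nonneg[OF s, of t x] by (simp add: mult_left_le)
    have J: "(LINT x|lborel. mker \<sigma> t (x::'a) * exp (- 1 * (norm x)\<^sup>2)) = ?J t"
      using mker_damped_fourier[OF s t(1) zero_less_one, of "0::'a"]
      by (simp only: inner_zero_right of_real_0 mult_zero_right exp_zero mult_1_right integral_complex_of_real of_real_eq_iff) simp
    have "(\<integral>\<^sup>+x. indicator {x. \<delta> \<le> norm x} x * ennreal (mker \<sigma> t (x::'a)) \<partial>lborel) \<le> (\<integral>\<^sup>+x. ennreal (1 / c * ?g x) \<partial>lborel)"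
    proof (rule nn_integral_mono)
      fix x :: 'a
      show "indicator {x. \<delta> \<le> norm x} x * ennreal (mker \<sigma> t x) \<le> ennreal (1 / c * ?g x)"
      proof (cases "\<delta> \<le> norm x")
        case True
        then have "\<delta>\<^sup>2 \<le> (norm x)\<^sup>2" using d by (intro power_mono) auto
        then have "c \<le> 1 - exp (- 1 * (norm x)\<^sup>2)" by (simp add: c_def)
        then have "mker \<sigma> t x * c \<le> mker \<sigma> t x * (1 - exp (- 1 * (norm x)\<^sup>2))"
          by (intro mult_left_mono mker_nonneg s)
        then show ?thesis using True c by (auto simp: field_simps intro!: ennreal_leI)
      qed simp
    qed
    also have "\<dots> = ennreal (LINT x|lborel. 1 / c * ?g x)"
      using c g0 by (intro nn_integral_eq_integral integrable_mult_right Bochner_Integration.integrable_diff i mker_integrable[OF s t(1)]) auto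
    also have "(LINT x|lborel. 1 / c * ?g x) = 1 / c * (1 - ?J t)"
      by (simp only: integral_mult_right_zero Bochner_Integration.integral_diff[OF mker_integrable[OF s t(1)] i] mker_integral[OF s t(1)] J)
    also have "\<dots> \<le> e" using t0(2)[OF t] c by (simp add: field_simps)
    finally show ?thesis by (simp add: ennreal_leI)
  qed
  then show ?thesis using t0(1) by blast
qed

text \<open>Since \<open>symb\<close> is small near the origin, a small ball of frequencies
  contributes at least a multiple of \<open>exp (- e' * t)\<close>. Up to frequency 1 the integrand
  is nonnegative, and beyond that it is of order \<open>exp (- 2 * t)\<close>.\<close>

lemma mker_lower_bound:
  assumes s: "0 < \<sigma>" "\<sigma> < 1" and e: "0 < e"
  shows "\<exists>c>0. \<exists>t0. \<forall>t\<ge>t0. \<forall>x::'a::euclidean_space. norm x \<le> 1 \<longrightarrow> c * exp (- e * t) \<le> mker \<sigma> t x"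
proof -
  \<comment> \<open>With a rate of at most 1 the main term \<open>exp (- t * e')\<close> outlasts
    the high-frequency error of order \<open>exp (- 2 * t)\<close>.\<close>
  define e' where "e' = min e 1"
  have e': "0 < e'" "e' \<le> 1" "e' \<le> e" using e by (auto simp: e'_def)
  have c: "continuous_on UNIV (symb \<sigma> :: 'a \<Rightarrow> real)"
    unfolding symb_def[abs_def] using s by (intro continuous_intros continuous_on_powr') auto
  then have "(symb \<sigma> \<longlongrightarrow> symb \<sigma> (0::'a)) (at (0::'a))"
    unfolding continuous_on_eq_continuous_at[OF open_UNIV] isCont_def by (rule bspec) (rule UNIV_I)
  then obtain r0 where r0: "0 < r0" "\<And>\<xi>::'a. norm \<xi> < r0 \<Longrightarrow> symb \<sigma> \<xi> < e'"
  proof -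
    assume a: "(symb \<sigma> \<longlongrightarrow> symb \<sigma> (0::'a)) (at (0::'a))" and th: "\<And>r0. 0 < r0 \<Longrightarrow> (\<And>\<xi>::'a. norm \<xi> < r0 \<Longrightarrow> symb \<sigma> \<xi> < e') \<Longrightarrow> thesis"
    have "\<forall>\<^sub>F \<xi>::'a in at 0. symb \<sigma> \<xi> < e'" using a e'(1) by (intro order_tendstoD) auto
    then obtain d where d: "d > 0" "\<And>\<xi>::'a. \<xi> \<noteq> 0 \<Longrightarrow> dist \<xi> 0 < d \<Longrightarrow> symb \<sigma> \<xi> < e'"
      by (auto simp: eventually_at)
    show thesis
    proof (rule th[OF d(1)])
      fix \<xi> :: 'a assume "norm \<xi> < d"
      then show "symb \<sigma> \<xi> < e'" using d(2)[of \<xi>] e' by (cases "\<xi> = 0") auto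
    qed
  qed
  define r where "r = min r0 1"
  have r: "0 < r" "r \<le> 1" "r \<le> r0" using r0 by (auto simp: r_def)
  define V where "V = measure lborel (ball (0::'a) r)"
  have V: "0 < V" unfolding V_def using content_ball_pos[OF r(1)] by simp
  define D where "D = (LINT \<xi>|(lborel::'a measure). exp (- 1 * symb \<sigma> \<xi>))"
  have D0: "0 \<le> D" by (simp add: D_def)
  \<comment> \<open>Chosen so that from \<open>t0\<close> on the high-frequency error is at most
    half of the main term.\<close>
  define t0 where "t0 = max 1 (exp 2 * D * 4 / V)"
  define C where "C = 1 / (2 * pi) ^ DIM('a)"
  have C: "0 < C" by (simp add: C_def)
  have "C * (V / 4) * exp (- e * t) \<le> mker \<sigma> t x" if t: "t0 \<le> t" and x: "norm x \<le> 1" for t and x :: 'a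
  proof -
    have t1: "1 \<le> t" "exp 2 * D * 4 / V \<le> t" using t by (auto simp: t0_def)
    let ?I = "\<lambda>\<xi>::'a. iexp (x \<bullet> \<xi>) * of_real (exp (- t * symb \<sigma> \<xi>))"
    have iI: "integrable lborel ?I"
      by (rule Bochner_Integration.integrable_bound[OF integrable_exp_symb[of t \<sigma>]]) (use t1 in \<open>auto simp: norm_mult\<close>)
    have Re: "Re (?I \<xi>) = cos (x \<bullet> \<xi>) * exp (- t * symb \<sigma> \<xi>)" for \<xi>
      by (simp add: Re_exp exp_eq_polar)
    have i1: "integrable lborel (\<lambda>\<xi>::'a. 1 / 2 * exp (- t * e') * indicator (ball 0 r) \<xi>)"
      by (intro integrable_mult_right) (use emeasure_lborel_ball_finite[of "0::'a" r] in \<open>auto simp: integrable_indicator_iff\<close>)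
    have i2: "integrable lborel (\<lambda>\<xi>::'a. exp (- 2 * (t - 1)) * exp (- 1 * symb \<sigma> \<xi>))"
      by (intro integrable_mult_right integrable_exp_symb) simp
    have "1 / 2 * exp (- t * e') * V - exp (- 2 * (t - 1)) * D
       = (LINT \<xi>|lborel. 1 / 2 * exp (- t * e') * indicator (ball (0::'a) r) \<xi> - exp (- 2 * (t - 1)) * exp (- 1 * symb \<sigma> \<xi>))"
      by (subst Bochner_Integration.integral_diff[OF i1 i2]) (simp add: V_def D_def)
    also have "\<dots> \<le> (LINT \<xi>|lborel. Re (?I \<xi>))"
    proof (rule integral_mono)
      show "integrable lborel (\<lambda>\<xi>. Re (?I \<xi>))" using iI by (rule integrable_Re)
      show "integrable lborel (\<lambda>\<xi>. 1 / 2 * exp (- t * e') * indicator (ball (0::'a) r) \<xi> - exp (- 2 * (t - 1)) * exp (- 1 * symb \<sigma> \<xi>))"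
        by (intro Bochner_Integration.integrable_diff i1 i2)
      fix \<xi> :: 'a
      show "1 / 2 * exp (- t * e') * indicator (ball (0::'a) r) \<xi> - exp (- 2 * (t - 1)) * exp (- 1 * symb \<sigma> \<xi>) \<le> Re (?I \<xi>)"
      proof (cases "norm \<xi> \<le> 1")
        case True
        \<comment> \<open>The phase stays below \<open>pi / 3\<close>, so low frequencies cannot
          cancel each other.\<close>
        have "\<bar>x \<bullet> \<xi>\<bar> \<le> norm x * norm \<xi>" by (rule Cauchy_Schwarz_ineq2)
        also have "\<dots> \<le> 1 * 1" using x True by (intro mult_mono) auto
        finally have "\<bar>x \<bullet> \<xi>\<bar> \<le> pi / 3" using pi_gt3 by simp
        then have "cos (pi / 3) \<le> cos \<bar>x \<bullet> \<xi>\<bar>" by (intro cos_monotone_0_pi_le) auto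
        then have cos: "1 / 2 \<le> cos (x \<bullet> \<xi>)" by (simp add: cos_60)
        have "1 / 2 * exp (- t * e') * indicator (ball (0::'a) r) \<xi> \<le> cos (x \<bullet> \<xi>) * exp (- t * symb \<sigma> \<xi>)"
        proof (cases "\<xi> \<in> ball 0 r")
          case True
          then have "t * symb \<sigma> \<xi> \<le> t * e'" using r0(2)[of \<xi>] r t1 by (intro mult_left_mono) auto
          then have "exp (- t * e') \<le> exp (- t * symb \<sigma> \<xi>)" by simp
          then have "1 / 2 * exp (- t * e') \<le> cos (x \<bullet> \<xi>) * exp (- t * symb \<sigma> \<xi>)"
            using cos by (intro mult_mono) auto
          then show ?thesis using True by simp
        qed (use cos in auto)
        moreover have "0 \<le> exp (- 2 * (t - 1)) * exp (- 1 * symb \<sigma> \<xi>)" by simp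
        ultimately show ?thesis unfolding Re by linarith
      next
        case False
        \<comment> \<open>Both parts of the symbol are at least 1 here. Of the time
          \<open>t\<close>, the portion \<open>t - 1\<close> pays for the decay and the last unit
          keeps the bound integrable.\<close>
        then have "1 \<le> (norm \<xi>)\<^sup>2" "1 \<le> norm \<xi> powr (2 * \<sigma>)"
          using s by (auto intro: ge_one_powr_ge_zero)
        then have "(t - 1) * 2 \<le> (t - 1) * symb \<sigma> \<xi>"
          using t1 unfolding symb_def by (intro mult_left_mono) auto
        then have "exp (- t * symb \<sigma> \<xi>) \<le> exp (- 2 * (t - 1)) * exp (- 1 * symb \<sigma> \<xi>)"
          by (simp add: algebra_simps flip: exp_add)
        moreover have "- 1 * exp (- t * symb \<sigma> \<xi>) \<le> cos (x \<bullet> \<xi>) * exp (- t * symb \<sigma> \<xi>)"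
          by (intro mult_right_mono) auto
        moreover have "\<xi> \<notin> ball 0 r" using False r by auto
        ultimately show ?thesis unfolding Re by simp
      qed
    qed
    also have "\<dots> = Re (LINT \<xi>|lborel. ?I \<xi>)" by (rule integral_Re[OF iI])
    finally have "1 / 2 * exp (- t * e') * V - exp (- 2 * (t - 1)) * D \<le> Re (LINT \<xi>|lborel. ?I \<xi>)" .
    moreover have "mker \<sigma> t x = C * Re (LINT \<xi>|lborel. ?I \<xi>)"
      using t1 by (simp add: mker_def C_def)
    ultimately have "C * (1 / 2 * exp (- t * e') * V - exp (- 2 * (t - 1)) * D) \<le> mker \<sigma> t x"
      using C by (simp only: mult_left_mono less_imp_le)
    moreover have "V / 4 * exp (- e * t) \<le> 1 / 2 * exp (- t * e') * V - exp (- 2 * (t - 1)) * D"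
    proof -
      have "exp (- 2 * (t - 1)) * D = exp (- t) * (exp 2 * D * exp (- t))"
        by (simp add: algebra_simps flip: exp_add)
      also have "\<dots> \<le> exp (- t * e') * (V / 4)"
      proof (intro mult_mono)
        show "exp (- t) \<le> exp (- t * e')" using e' t1 by (simp add: mult_left_le)
        have "exp 2 * D * 4 \<le> t * V" using t1(2) V by (simp add: field_simps)
        also have "\<dots> \<le> exp t * V"
        proof (rule mult_right_mono)
          show "t \<le> exp t" using exp_ge_add_one_self[of t] by linarith
        qed (use V in simp)
        finally show "exp 2 * D * exp (- t) \<le> V / 4" by (simp add: exp_minus field_simps)
      qed (use D0 in auto)
      finally have "exp (- 2 * (t - 1)) * D \<le> exp (- t * e') * (V / 4)" .
      moreover have "V / 4 * exp (- e * t) \<le> exp (- t * e') * (V / 4)"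
        using e' t1 V by (simp add: mult.commute)
      ultimately show ?thesis by (simp add: field_simps)
    qed
    then have "C * (V / 4 * exp (- e * t)) \<le> C * (1 / 2 * exp (- t * e') * V - exp (- 2 * (t - 1)) * D)"
      using C by (intro mult_left_mono) auto
    ultimately show ?thesis by (simp only: mult.assoc)
  qed
  then show ?thesis using C V by (intro exI[of _ "C * (V / 4)"] conjI exI[of _ t0]) auto
qed

section \<open>Semigroups of convolution kernels\<close>

text \<open>The value at infinity makes this, for positive \<open>p\<close>, an increasing bijection
  of the extended half-line, so that the Picard limit may be infinite somewhere.\<close>

definition ennpow :: "real \<Rightarrow> ennreal \<Rightarrow> ennreal" where
  "ennpow p x = (if x = \<top> then \<top> else ennreal (enn2real x powr p))"

lemma ennpow_ennreal [simp]: "0 \<le> r \<Longrightarrow> ennpow p (ennreal r) = ennreal (r powr p)"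
  by (simp add: ennpow_def)

lemma ennpow_top [simp]: "ennpow p \<top> = \<top>"
  by (simp add: ennpow_def)

lemma ennpow_mono: "0 \<le> p \<Longrightarrow> x \<le> y \<Longrightarrow> ennpow p x \<le> ennpow p y"
  by (cases x; cases y) (auto simp: top_unique intro!: powr_mono2)

lemma ennpow_inverse: "p \<noteq> 0 \<Longrightarrow> ennpow p (ennpow (1 / p) x) = x"
  by (cases x) (auto simp: powr_powr)

text \<open>An increasing map with the increasing inverse \<open>ennpow (1 / p)\<close> commutes
  with suprema; no continuity argument is involved.\<close>

lemma ennpow_SUP:
  assumes p: "0 < p"
  shows "ennpow p (SUP n\<in>A. a n) = (SUP n\<in>A. ennpow p (a n))"
proof (rule antisym)
  let ?S = "SUP n\<in>A. ennpow p (a n)"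
  have "a n \<le> ennpow (1 / p) ?S" if "n \<in> A" for n
  proof -
    have "a n = ennpow (1 / p) (ennpow p (a n))" using ennpow_inverse[of "1 / p" "a n"] p by simp
    also have "\<dots> \<le> ennpow (1 / p) ?S" using p that by (intro ennpow_mono SUP_upper) auto
    finally show ?thesis .
  qed
  then have "ennpow p (SUP n\<in>A. a n) \<le> ennpow p (ennpow (1 / p) ?S)"
    using p by (intro ennpow_mono SUP_least) auto
  then show "ennpow p (SUP n\<in>A. a n) \<le> ?S" using p by (simp add: ennpow_inverse)
  show "?S \<le> ennpow p (SUP n\<in>A. a n)"
    using p by (intro SUP_least ennpow_mono SUP_upper) auto
qed

lemma ennpow_measurable [measurable]: "ennpow p \<in> borel_measurable borel"
  unfolding ennpow_def[abs_def] by measurable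

lemma nn_integral_lborel_translate:
  fixes f :: "'a::euclidean_space \<Rightarrow> ennreal"
  assumes [measurable]: "f \<in> borel_measurable borel"
  shows "(\<integral>\<^sup>+y. f (c + y) \<partial>lborel) = (\<integral>\<^sup>+y. f y \<partial>lborel)"
  by (subst (2) lborel_distr_plus[symmetric, of c], subst nn_integral_distr) auto

text \<open>Instantiated locally as a measurability rule, so that curried families of functions can
  be handled automatically.\<close>

lemma measurable_uncurry:
  assumes "case_prod g \<in> borel_measurable (borel \<Otimes>\<^sub>M borel)"
    and [measurable]: "f \<in> borel_measurable M" "f' \<in> borel_measurable M"
  shows "(\<lambda>z. g (f z) (f' z)) \<in> borel_measurable M"
  using measurable_compose[OF measurable_Pair[OF assms(2,3)] assms(1)] by simp

text \<open>The interface between Fourier analysis and the nonlinear problem. Mass, convolution and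
  continuity are stated with nonnegative integrals, ready for Tonelli's theorem.\<close>

locale heat_semigroup =
  fixes K :: "real \<Rightarrow> 'a::euclidean_space \<Rightarrow> real"
  assumes K_pair [measurable]: "(\<lambda>(t, x). K t x) \<in> borel_measurable (borel \<Otimes>\<^sub>M borel)"
    and K_nonneg: "\<And>t x. 0 \<le> K t x"
    and K_nonpos_time: "\<And>t x. t \<le> 0 \<Longrightarrow> K t x = 0"
    and K_mass: "\<And>t. 0 < t \<Longrightarrow> (\<integral>\<^sup>+x. ennreal (K t x) \<partial>lborel) = 1"
    and K_conv: "\<And>t s x. 0 < t \<Longrightarrow> 0 < s \<Longrightarrow>
      (\<integral>\<^sup>+y. ennreal (K t (x - y)) * ennreal (K s y) \<partial>lborel) = ennreal (K (t + s) x)"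
    and K_L1_continuous: "\<And>t \<tau>. 0 < t \<Longrightarrow> \<tau> \<longlonglongrightarrow> t \<Longrightarrow>
      (\<lambda>n. \<integral>\<^sup>+x. ennreal \<bar>K (\<tau> n) x - K t x\<bar> \<partial>lborel) \<longlonglongrightarrow> 0"
    and K_approx_identity: "\<And>\<delta> e. 0 < \<delta> \<Longrightarrow> 0 < e \<Longrightarrow> \<exists>t0>0. \<forall>t. 0 < t \<and> t < t0 \<longrightarrow>
      (\<integral>\<^sup>+x. indicator {x. \<delta> \<le> norm x} x * ennreal (K t x) \<partial>lborel) \<le> ennreal e"
begin

abbreviation kdist :: "real \<Rightarrow> real \<Rightarrow> ennreal" where
  "kdist t' t \<equiv> \<integral>\<^sup>+z. ennreal \<bar>K t' z - K t z\<bar> \<partial>lborel"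

lemma K_measurable [measurable (raw)]:
  assumes [measurable]: "f \<in> borel_measurable M" "g \<in> borel_measurable M"
  shows "(\<lambda>x. K (f x) (g x)) \<in> borel_measurable M"
proof -
  have "(\<lambda>x. case_prod K (f x, g x)) \<in> borel_measurable M" by measurable
  then show ?thesis by simp
qed

lemma K_mass_reflect: "0 < t \<Longrightarrow> (\<integral>\<^sup>+y. ennreal (K t (x - y)) \<partial>lborel) = 1"
  by (subst nn_integral_lborel_reflect[of "\<lambda>y. ennreal (K t y)"]) (simp_all add: K_mass)

definition S :: "real \<Rightarrow> ('a \<Rightarrow> ennreal) \<Rightarrow> 'a \<Rightarrow> ennreal" where
  "S t \<phi> x = (if t \<le> 0 then \<phi> x else \<integral>\<^sup>+y. ennreal (K t (x - y)) * \<phi> y \<partial>lborel)"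

abbreviation slice ::
    "real set \<Rightarrow> (real \<Rightarrow> 'a \<Rightarrow> ennreal) \<Rightarrow> real \<Rightarrow> 'a \<Rightarrow> real \<Rightarrow> ennreal" where
  "slice I g t x s \<equiv> \<integral>\<^sup>+y. indicator I s * (ennreal (K (t - s) (x - y)) * g s y) \<partial>lborel"

text \<open>The starting time \<open>a\<close> is a parameter so that the equation can be restarted.
  The upper limit \<open>t\<close> is implicit, since \<open>K (t - s)\<close> vanishes for
  \<open>s \<ge> t\<close>.\<close>

definition duhamel :: "real \<Rightarrow> (real \<Rightarrow> 'a \<Rightarrow> ennreal) \<Rightarrow> real \<Rightarrow> 'a \<Rightarrow> ennreal" where
  "duhamel a g t x = (\<integral>\<^sup>+s. slice {a<..} g t x s \<partial>lborel)"

lemma S_measurable [measurable (raw)]: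
  assumes [measurable]: "\<phi> \<in> borel_measurable borel" "f \<in> borel_measurable M" "g \<in> borel_measurable M"
  shows "(\<lambda>z. S (f z) \<phi> (g z)) \<in> borel_measurable M"
  unfolding S_def by measurable

lemma S_mono: "(\<And>y. \<phi> y \<le> \<psi> y) \<Longrightarrow> S t \<phi> x \<le> S t \<psi> x"
  by (auto simp: S_def intro!: nn_integral_mono mult_left_mono)

lemma S_add:
  assumes [measurable]: "\<phi> \<in> borel_measurable borel" "\<psi> \<in> borel_measurable borel"
  shows "S t (\<lambda>y. \<phi> y + \<psi> y) x = S t \<phi> x + S t \<psi> x"
  by (simp add: S_def distrib_left nn_integral_add)

lemma S_le_AE:
  assumes "0 < t" "AE y in lborel. \<phi> y \<le> c"
  shows "S t \<phi> x \<le> c"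
proof -
  have "S t \<phi> x \<le> (\<integral>\<^sup>+y. ennreal (K t (x - y)) * c \<partial>lborel)"
    using assms by (auto simp: S_def intro!: nn_integral_mono_AE mult_left_mono elim!: eventually_mono)
  also have "\<dots> = c" using assms(1) by (simp add: nn_integral_multc K_mass_reflect)
  finally show ?thesis .
qed

lemma S_le: "(\<And>y. \<phi> y \<le> c) \<Longrightarrow> S t \<phi> x \<le> c"
  by (cases "t \<le> 0") (simp add: S_def, auto intro: S_le_AE)

lemma K_conv_shift:
  assumes "0 < t" "0 < s"
  shows "(\<integral>\<^sup>+z. ennreal (K t (x - z)) * ennreal (K s (z - y)) \<partial>lborel) = ennreal (K (t + s) (x - y))"
proof -
  have "(\<integral>\<^sup>+z. ennreal (K t (x - z)) * ennreal (K s (z - y)) \<partial>lborel)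
     = (\<integral>\<^sup>+z. ennreal (K t (x - (y + z))) * ennreal (K s ((y + z) - y)) \<partial>lborel)"
    by (rule nn_integral_lborel_translate[symmetric]) measurable
  then show ?thesis using K_conv[OF assms, of "x - y"] by (simp add: diff_diff_eq)
qed

lemma S_S:
  assumes [measurable]: "\<phi> \<in> borel_measurable borel" and t: "0 \<le> t" and s: "0 \<le> s"
  shows "S t (S s \<phi>) x = S (t + s) \<phi> x"
proof (cases "t = 0 \<or> s = 0")
  case True
  then show ?thesis using t s by (auto simp: S_def)
next
  case False
  then have t: "0 < t" and s: "0 < s" using t s by auto
  have "S t (S s \<phi>) x = (\<integral>\<^sup>+z. \<integral>\<^sup>+y. ennreal (K t (x - z)) * ennreal (K s (z - y)) * \<phi> y \<partial>lborel \<partial>lborel)"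
    using t s by (simp add: S_def nn_integral_cmult[symmetric] mult.assoc)
  also have "\<dots> = (\<integral>\<^sup>+y. \<integral>\<^sup>+z. ennreal (K t (x - z)) * ennreal (K s (z - y)) * \<phi> y \<partial>lborel \<partial>lborel)"
    by (intro lborel_pair.Fubini') measurable
  also have "\<dots> = (\<integral>\<^sup>+y. ennreal (K (t + s) (x - y)) * \<phi> y \<partial>lborel)"
    by (intro nn_integral_cong) (simp add: nn_integral_multc K_conv_shift[OF t s])
  finally show ?thesis using t s by (simp add: S_def)
qed

lemma duhamel_mono_AE:
  assumes "\<And>s. a < s \<Longrightarrow> s < t \<Longrightarrow> AE y in lborel. g s y \<le> g' s y"
  shows "duhamel a g t x \<le> duhamel a g' t x"
  unfolding duhamel_def
proof (rule nn_integral_mono)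
  fix s
  show "slice {a<..} g t x s \<le> slice {a<..} g' t x s"
  proof (cases "a < s \<and> s < t")
    case True
    with assms[of s] show ?thesis
      by (intro nn_integral_mono_AE) (auto intro!: mult_left_mono elim!: eventually_mono)
  qed (auto simp: K_nonpos_time)
qed

lemma duhamel_cong:
  assumes "\<And>s y. a < s \<Longrightarrow> s < t \<Longrightarrow> g s y = g' s y"
  shows "duhamel a g t x = duhamel a g' t x"
  using assms by (intro antisym duhamel_mono_AE) auto

lemma duhamel_measurable [measurable (raw)]:
  assumes [measurable]: "case_prod g \<in> borel_measurable (borel \<Otimes>\<^sub>M borel)"
    "f1 \<in> borel_measurable M" "f2 \<in> borel_measurable M"
  shows "(\<lambda>z. duhamel a g (f1 z) (f2 z)) \<in> borel_measurable M"
proof -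
  note [measurable (raw)] = measurable_uncurry[OF assms(1)]
  show ?thesis unfolding duhamel_def by measurable
qed

lemma duhamel_le_integral:
  assumes bd: "\<And>s. a < s \<Longrightarrow> s < t \<Longrightarrow> AE y in lborel. g s y \<le> c s"
  shows "duhamel a g t x \<le> (\<integral>\<^sup>+s. c s * indicator {a<..<t} s \<partial>lborel)"
proof -
  have "duhamel a g t x \<le> duhamel a (\<lambda>s _. c s) t x" by (rule duhamel_mono_AE[OF bd])
  also have "\<dots> \<le> (\<integral>\<^sup>+s. c s * indicator {a<..<t} s \<partial>lborel)"
    unfolding duhamel_def
  proof (intro nn_integral_mono)
    fix s
    show "(\<integral>\<^sup>+y. indicator {a<..} s * (ennreal (K (t - s) (x - y)) * c s) \<partial>lborel) \<le> c s * indicator {a<..<t} s"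
    proof (cases "a < s \<and> s < t")
      case True
      then show ?thesis by (simp add: nn_integral_multc K_mass_reflect)
    qed (auto simp: K_nonpos_time)
  qed
  finally show ?thesis .
qed

lemma duhamel_le:
  assumes bd: "\<And>s. a < s \<Longrightarrow> s < t \<Longrightarrow> AE y in lborel. g s y \<le> C" and at: "a \<le> t"
  shows "duhamel a g t x \<le> C * ennreal (t - a)"
proof -
  have "duhamel a g t x \<le> (\<integral>\<^sup>+s. C * indicator {a<..<t} s \<partial>lborel)" by (rule duhamel_le_integral[OF bd])
  also have "\<dots> = C * ennreal (t - a)" using at by (simp add: nn_integral_cmult)
  finally show ?thesis .
qed

text \<open>By Chapman-Kolmogorov the flow carries every time slice from \<open>t0\<close> on to
  \<open>t\<close>; the order of integration is free because all integrands are nonnegative.\<close>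

lemma S_duhamel:
  assumes g [measurable]: "case_prod g \<in> borel_measurable (borel \<Otimes>\<^sub>M borel)"
    and t: "t0 < t"
  shows "S (t - t0) (duhamel a g t0) x = (\<integral>\<^sup>+s. slice {a<..<t0} g t x s \<partial>lborel)"
proof -
  note [measurable (raw)] = measurable_uncurry[OF g]
  let ?d = "t - t0"
  have d: "0 < ?d" using t by simp
  let ?f = "\<lambda>z s y. ennreal (K ?d (x - z)) * (indicator {a<..} s * (ennreal (K (t0 - s) (z - y)) * g s y))"
  have "S ?d (duhamel a g t0) x = (\<integral>\<^sup>+z. \<integral>\<^sup>+s. \<integral>\<^sup>+y. ?f z s y \<partial>lborel \<partial>lborel \<partial>lborel)"
    using d by (simp add: S_def duhamel_def nn_integral_cmult[symmetric])
  also have "\<dots> = (\<integral>\<^sup>+s. \<integral>\<^sup>+z. \<integral>\<^sup>+y. ?f z s y \<partial>lborel \<partial>lborel \<partial>lborel)"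
    by (intro lborel_pair.Fubini') measurable
  also have "\<dots> = (\<integral>\<^sup>+s. \<integral>\<^sup>+y. \<integral>\<^sup>+z. ?f z s y \<partial>lborel \<partial>lborel \<partial>lborel)"
    by (intro nn_integral_cong lborel_pair.Fubini') measurable
  also have "\<dots> = (\<integral>\<^sup>+s. slice {a<..<t0} g t x s \<partial>lborel)"
  proof (intro nn_integral_cong)
    fix s y
    show "(\<integral>\<^sup>+z. ?f z s y \<partial>lborel) = indicator {a<..<t0} s * (ennreal (K (t - s) (x - y)) * g s y)"
    proof (cases "a < s \<and> s < t0")
      case True
      have "(\<integral>\<^sup>+z. ?f z s y \<partial>lborel) = (\<integral>\<^sup>+z. g s y * (ennreal (K ?d (x - z)) * ennreal (K (t0 - s) (z - y))) \<partial>lborel)"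
        using True by (intro nn_integral_cong) (simp add: mult_ac)
      also have "\<dots> = g s y * (\<integral>\<^sup>+z. ennreal (K ?d (x - z)) * ennreal (K (t0 - s) (z - y)) \<partial>lborel)"
        by (rule nn_integral_cmult) measurable
      also have "(\<integral>\<^sup>+z. ennreal (K ?d (x - z)) * ennreal (K (t0 - s) (z - y)) \<partial>lborel) = ennreal (K (t - s) (x - y))"
        using K_conv_shift[OF d, of "t0 - s" x y] True by simp
      finally show ?thesis using True by (simp add: mult.commute)
    qed (auto simp: K_nonpos_time)
  qed
  finally show ?thesis .
qed

text \<open>This is the restart property: sources before \<open>t0\<close> enter only through the
  state that they have produced at \<open>t0\<close>.\<close>

lemma duhamel_split:
  assumes g [measurable]: "case_prod g \<in> borel_measurable (borel \<Otimes>\<^sub>M borel)"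
    and a: "a \<le> t0" and t: "t0 < t"
  shows "duhamel a g t x = S (t - t0) (duhamel a g t0) x + duhamel t0 g t x"
proof -
  note [measurable (raw)] = measurable_uncurry[OF g]
  have "duhamel a g t x = (\<integral>\<^sup>+s. slice {a<..<t0} g t x s
     + slice {t0<..} g t x s \<partial>lborel)"
    unfolding duhamel_def
  proof (rule nn_integral_cong_AE, use AE_lborel_singleton[of t0] in eventually_elim)
    fix s assume "s \<noteq> t0"
    then have "s < t0 \<or> t0 < s" by auto
    then show "slice {a<..} g t x s
      = slice {a<..<t0} g t x s
     + slice {t0<..} g t x s"
      using a by (auto simp: indicator_def)
  qed
  also have "\<dots> = S (t - t0) (duhamel a g t0) x + duhamel t0 g t x"
    unfolding S_duhamel[OF g t] unfolding duhamel_def by (rule nn_integral_add) measurable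
  finally show ?thesis .
qed

end

section \<open>The minimal solution\<close>

locale minimal_solution = heat_semigroup K
  for K :: "real \<Rightarrow> 'a::euclidean_space \<Rightarrow> real" +
  fixes h :: "real \<Rightarrow> real" and p :: real and u0 :: "'a \<Rightarrow> real"
  assumes h_cont: "continuous_on UNIV h" and h_nonneg: "\<And>t. 0 \<le> h t" and p: "1 < p"
    and u0_meas [measurable]: "u0 \<in> borel_measurable borel" and u0_nonneg: "\<And>x. 0 \<le> u0 x"
    and u0_bdd: "\<exists>B. \<forall>x. u0 x \<le> B"
begin

abbreviation U0 :: "'a \<Rightarrow> ennreal" where "U0 \<equiv> \<lambda>y. ennreal (u0 y)"

definition src :: "(real \<Rightarrow> 'a \<Rightarrow> ennreal) \<Rightarrow> real \<Rightarrow> 'a \<Rightarrow> ennreal" where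
  "src W s y = ennreal (h s) * ennpow p (W s y)"

definition Phi :: "(real \<Rightarrow> 'a \<Rightarrow> ennreal) \<Rightarrow> real \<Rightarrow> 'a \<Rightarrow> ennreal" where
  "Phi W t x = S t U0 x + duhamel 0 (src W) t x"

definition V :: "nat \<Rightarrow> real \<Rightarrow> 'a \<Rightarrow> ennreal" where
  "V n = (Phi ^^ n) (\<lambda>_ _. 0)"

definition U :: "real \<Rightarrow> 'a \<Rightarrow> ennreal" where
  "U t x = (SUP n. V n t x)"

lemma V_0: "V 0 = (\<lambda>_ _. 0)" and V_Suc: "V (Suc n) = Phi (V n)"
  by (simp_all add: V_def)

lemma h_measurable [measurable]: "h \<in> borel_measurable borel"
  using h_cont by (rule borel_measurable_continuous_onI)

lemma src_mono: "W s y \<le> W' s y \<Longrightarrow> src W s y \<le> src W' s y"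
  unfolding src_def using p by (intro mult_left_mono ennpow_mono) auto

lemma src_pair [measurable]:
  assumes "case_prod W \<in> borel_measurable (borel \<Otimes>\<^sub>M borel)"
  shows "case_prod (src W) \<in> borel_measurable (borel \<Otimes>\<^sub>M borel)"
proof -
  note [measurable (raw)] = measurable_uncurry[OF assms]
  show ?thesis unfolding src_def case_prod_beta' by measurable
qed

lemma Phi_pair:
  assumes "case_prod W \<in> borel_measurable (borel \<Otimes>\<^sub>M borel)"
  shows "case_prod (Phi W) \<in> borel_measurable (borel \<Otimes>\<^sub>M borel)"
proof -
  note [measurable] = src_pair[OF assms]
  show ?thesis unfolding Phi_def case_prod_beta' by measurable
qed

lemma V_pair [measurable]: "case_prod (V n) \<in> borel_measurable (borel \<Otimes>\<^sub>M borel)"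
proof (induction n)
  case (Suc n)
  then show ?case unfolding V_Suc by (rule Phi_pair)
qed (simp add: V_0)

lemma U_pair [measurable]: "case_prod U \<in> borel_measurable (borel \<Otimes>\<^sub>M borel)"
proof -
  have "case_prod U = (\<lambda>z. SUP n. case_prod (V n) z)"
    by (auto simp: fun_eq_iff U_def)
  then show ?thesis by simp
qed

lemma U_measurable [measurable]: "U t \<in> borel_measurable borel"
  using measurable_uncurry[OF U_pair, of "\<lambda>_. t" borel "\<lambda>x. x"] by simp

lemma Phi_mono: "(\<And>s y. W s y \<le> W' s y) \<Longrightarrow> Phi W t x \<le> Phi W' t x"
  unfolding Phi_def by (intro add_left_mono duhamel_mono_AE AE_I2 src_mono)

lemma V_incseq: "incseq V"
proof (rule incseq_SucI)
  show "V n \<le> V (Suc n)" for n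
  proof (induction n)
    case 0
    show ?case by (simp add: V_0 le_fun_def)
  next
    case (Suc n)
    then show ?case unfolding V_Suc[of n] V_Suc[of "Suc n"] le_fun_def by (auto intro: Phi_mono)
  qed
qed

lemma V_mono: "m \<le> n \<Longrightarrow> V m s y \<le> V n s y"
  using incseqD[OF V_incseq] by (auto simp: le_fun_def)

text \<open>Monotone convergence, once in space and once in time, as \<open>ennpow\<close> commutes
  with suprema. The equation holds at every point, also where both sides are infinite.\<close>

lemma U_eq: "U t x = S t U0 x + duhamel 0 (src U) t x"
proof -
  have "duhamel 0 (src U) t x = (\<integral>\<^sup>+s. \<integral>\<^sup>+y. (SUP n. indicator {0<..} s * (ennreal (K (t - s) (x - y)) * src (V n) s y)) \<partial>lborel \<partial>lborel)"
    unfolding duhamel_def src_def U_def using p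
    by (simp add: ennpow_SUP SUP_mult_left_ennreal)
  also have "\<dots> = (\<integral>\<^sup>+s. (SUP n. slice {0<..} (src (V n)) t x s) \<partial>lborel)"
  proof (intro nn_integral_cong nn_integral_monotone_convergence_SUP)
    show "incseq (\<lambda>n y. indicator {0<..} s * (ennreal (K (t - s) (x - y)) * src (V n) s y))" for s
      by (auto simp: incseq_def le_fun_def intro!: mult_left_mono src_mono V_mono)
    show "(\<lambda>y. indicator {0<..} s * (ennreal (K (t - s) (x - y)) * src (V n) s y)) \<in> borel_measurable lborel" for n s
    proof -
      note [measurable (raw)] = measurable_uncurry[OF src_pair[OF V_pair]]
      show ?thesis by measurable
    qed
  qed
  also have "\<dots> = (SUP n. duhamel 0 (src (V n)) t x)"
    unfolding duhamel_def
  proof (intro nn_integral_monotone_convergence_SUP)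
    show "incseq (\<lambda>n s. slice {0<..} (src (V n)) t x s)"
      by (auto simp: incseq_def le_fun_def intro!: nn_integral_mono mult_left_mono src_mono V_mono)
    show "(\<lambda>s. slice {0<..} (src (V n)) t x s) \<in> borel_measurable lborel" for n
    proof -
      note [measurable (raw)] = measurable_uncurry[OF src_pair[OF V_pair]]
      show ?thesis by measurable
    qed
  qed
  finally have "S t U0 x + duhamel 0 (src U) t x = (SUP n. V (Suc n) t x)"
    by (simp add: V_Suc Phi_def ennreal_SUP_add_right)
  also have "\<dots> = U t x"
    unfolding U_def
  proof (rule antisym)
    show "(SUP n. V (Suc n) t x) \<le> (SUP n. V n t x)"
      by (intro SUP_least SUP_upper UNIV_I)
    show "(SUP n. V n t x) \<le> (SUP n. V (Suc n) t x)"
      by (intro SUP_mono') (simp add: V_mono)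
  qed
  finally show ?thesis ..
qed

text \<open>Only monotonicity of nonnegative integrals enters, and these ignore null sets in
  \<open>y\<close>. Hence \<open>W\<close> may be a mild solution, which satisfies its equation
  almost everywhere and may fail to be jointly measurable.\<close>

lemma V_le_supersolution:
  assumes W: "\<And>t. 0 \<le> t \<Longrightarrow> t \<le> b \<Longrightarrow> AE x in lborel. Phi W t x \<le> W t x"
    and t: "0 \<le> t" "t \<le> b"
  shows "AE x in lborel. V n t x \<le> W t x"
  using t
proof (induction n arbitrary: t)
  case 0
  show ?case by (simp add: V_0)
next
  case (Suc n)
  have "V (Suc n) t x \<le> Phi W t x" for x
    unfolding V_Suc Phi_def
  proof (intro add_left_mono duhamel_mono_AE)
    fix s assume "0 < s" "s < t"
    then have "AE y in lborel. V n s y \<le> W s y" using Suc by auto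
    then show "AE y in lborel. src (V n) s y \<le> src W s y"
      by (rule eventually_mono) (rule src_mono)
  qed
  with W[OF Suc.prems] show ?case
    by (auto elim!: eventually_mono intro: order_trans)
qed

lemma U_le_supersolution:
  assumes "\<And>t. 0 \<le> t \<Longrightarrow> t \<le> b \<Longrightarrow> AE x in lborel. Phi W t x \<le> W t x"
    and "0 \<le> t" "t \<le> b"
  shows "AE x in lborel. U t x \<le> W t x"
proof -
  have "AE x in lborel. \<forall>n. V n t x \<le> W t x"
    unfolding AE_all_countable using V_le_supersolution[OF assms] by blast
  then show ?thesis by (rule eventually_mono) (auto simp: U_def intro: SUP_least)
qed

section \<open>Boundedness up to a time and continuation beyond it\<close>

definition bounded_upto :: "real \<Rightarrow> bool" where
  "bounded_upto b \<longleftrightarrow> (\<exists>B\<ge>0. \<forall>s x. 0 \<le> s \<and> s \<le> b \<longrightarrow> U s x \<le> ennreal B)"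

lemma h_bounded:
  obtains H where "0 \<le> H" "\<And>s. a \<le> s \<Longrightarrow> s \<le> b \<Longrightarrow> h s \<le> H"
proof -
  have "bounded (h ` {a..b})"
    by (intro compact_imp_bounded compact_continuous_image continuous_on_subset[OF h_cont]) auto
  then obtain H where H: "\<forall>s\<in>{a..b}. \<bar>h s\<bar> \<le> H" by (auto simp: bounded_iff)
  show thesis
    by (rule that[of "max 0 H"]) (use H in \<open>force+\<close>)
qed

lemma src_le:
  assumes "W s y \<le> ennreal B" "0 \<le> B" "h s \<le> H"
  shows "src W s y \<le> ennreal (H * B powr p)"
proof -
  have "src W s y \<le> ennreal (h s) * ennpow p (ennreal B)"
    unfolding src_def using p assms by (intro mult_left_mono ennpow_mono) auto
  also have "\<dots> \<le> ennreal (H * B powr p)"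
    using assms h_nonneg[of s] by (auto simp: ennreal_mult[symmetric] intro!: ennreal_leI mult_right_mono)
  finally show ?thesis .
qed

text \<open>The right-hand side of \<open>U_eq\<close> depends on \<open>U\<close> only through
  integrals, so an almost everywhere bound inserted there returns a bound at every point.\<close>

lemma bounded_uptoI:
  assumes AE: "\<And>s. 0 \<le> s \<Longrightarrow> s \<le> b \<Longrightarrow> AE x in lborel. U s x \<le> ennreal B" and B: "0 \<le> B"
  shows "bounded_upto b"
proof -
  obtain H where H: "0 \<le> H" "\<And>s. 0 \<le> s \<Longrightarrow> s \<le> b \<Longrightarrow> h s \<le> H" using h_bounded[of 0 b] by blast
  obtain B0 where B0: "0 \<le> B0" "\<And>x. u0 x \<le> B0" using u0_bdd u0_nonneg by (meson order_trans)
  have "U s x \<le> ennreal (B0 + H * B powr p * \<bar>b\<bar>)" if s: "0 \<le> s" "s \<le> b" for s x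
  proof -
    have "U s x \<le> ennreal (B0) + ennreal (H * B powr p) * ennreal (s - 0)"
      unfolding U_eq[of s x]
    proof (intro add_mono S_le duhamel_le)
      show "U0 y \<le> ennreal (B0)" for y using B0(2) by (rule ennreal_leI)
      fix r assume r: "0 < r" "r < s"
      then have "AE y in lborel. U r y \<le> ennreal B" using AE[of r] s by simp
      then show "AE y in lborel. src U r y \<le> ennreal (H * B powr p)"
        by (rule eventually_mono) (use r s in \<open>auto intro!: src_le H B\<close>)
    qed (use s in auto)
    also have "\<dots> \<le> ennreal (B0) + ennreal (H * B powr p) * ennreal \<bar>b\<bar>"
      using s by (intro add_left_mono mult_left_mono ennreal_leI) auto
    also have "\<dots> = ennreal (B0 + H * B powr p * \<bar>b\<bar>)"
      using H(1) B0(1) by (simp add: ennreal_mult[symmetric] ennreal_plus[symmetric] del: ennreal_plus)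
    finally show ?thesis .
  qed
  then show ?thesis unfolding bounded_upto_def
    by (intro exI[of _ "B0 + H * B powr p * \<bar>b\<bar>"]) (use H(1) B0(1) in auto)
qed

lemma bounded_upto_0: "bounded_upto 0"
proof -
  obtain B0 where B0: "0 \<le> B0" "\<And>x. u0 x \<le> B0" using u0_bdd u0_nonneg by (meson order_trans)
  have "duhamel 0 (src U) 0 x \<le> 0 * ennreal (0 - 0)" for x
    by (rule duhamel_le) auto
  then have "U 0 x = ennreal (u0 x)" for x
    by (simp add: U_eq[of 0] S_def)
  then show ?thesis
    using B0 unfolding bounded_upto_def
    by (intro exI[of _ "B0"]) (auto intro!: ennreal_leI)
qed

lemma bounded_upto_mono: "bounded_upto b \<Longrightarrow> a \<le> b \<Longrightarrow> bounded_upto a"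
  unfolding bounded_upto_def by (meson order_trans)

text \<open>The supersolution follows \<open>U\<close> up to \<open>t0\<close> and then jumps to the
  constant \<open>2 * M\<close>: one \<open>M\<close> covers the free flow of \<open>U t0\<close>,
  the other the source accumulated over a time of at most \<delta>.\<close>

lemma bounded_upto_extend:
  assumes t0: "0 \<le> t0" "bounded_upto t0" and M: "0 \<le> M" "AE x in lborel. U t0 x \<le> ennreal M"
    and H: "\<And>s. t0 \<le> s \<Longrightarrow> s \<le> t0 + \<delta> \<Longrightarrow> h s \<le> H"
    and \<delta>: "0 \<le> \<delta>" "\<delta> * (H * (2 * M) powr p) \<le> M"
  shows "bounded_upto (t0 + \<delta>)"
proof -
  obtain B where B: "0 \<le> B" "\<And>s x. 0 \<le> s \<Longrightarrow> s \<le> t0 \<Longrightarrow> U s x \<le> ennreal B"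
    using t0(2) unfolding bounded_upto_def by blast
  define W where "W = (\<lambda>t x. if t \<le> t0 then U t x else ennreal (2 * M))"
  have Wp: "case_prod W \<in> borel_measurable (borel \<Otimes>\<^sub>M borel)"
  proof -
    note [measurable (raw)] = measurable_uncurry[OF U_pair]
    show ?thesis unfolding W_def case_prod_beta' by measurable
  qed
  \<comment> \<open>Up to time \<open>t0\<close> only values of \<open>W\<close> before
    \<open>t0\<close> enter, and these are those of \<open>U\<close>.\<close>
  have eqU: "Phi W t x = U t x" if "t \<le> t0" for t x
    unfolding U_eq[of t x] Phi_def using that
    by (intro arg_cong2[of _ _ _ _ "(+)"] refl duhamel_cong) (simp add: src_def W_def)
  have "Phi W t x \<le> W t x" if t: "0 \<le> t" "t \<le> t0 + \<delta>" for t x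
  proof (cases "t \<le> t0")
    case True
    then show ?thesis using eqU[OF True, of x] by (simp add: W_def)
  next
    case False
    then have t': "t0 < t" by simp
    have "Phi W t x = S (t - t0) (S t0 U0) x + (S (t - t0) (duhamel 0 (src W) t0) x + duhamel t0 (src W) t x)"
      unfolding Phi_def using duhamel_split[OF src_pair[OF Wp] t0(1) t'] t0 t' by (simp add: S_S)
    also have "\<dots> = S (t - t0) (\<lambda>y. Phi W t0 y) x + duhamel t0 (src W) t x"
      unfolding Phi_def using src_pair[OF Wp] by (subst S_add) (auto simp: add.assoc)
    also have "\<dots> = S (t - t0) (U t0) x + duhamel t0 (src W) t x"
      by (simp add: eqU)
    also have "\<dots> \<le> ennreal M + ennreal (H * (2 * M) powr p) * ennreal (t - t0)"
    proof (intro add_mono S_le_AE M duhamel_le AE_I2)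
      fix s y assume "t0 < s" "s < t"
      then show "src W s y \<le> ennreal (H * (2 * M) powr p)"
        using t M by (intro src_le H) (auto simp: W_def)
    qed (use t' in auto)
    also have "\<dots> \<le> ennreal M + ennreal M"
    proof (rule add_left_mono)
      have H0: "0 \<le> H" using h_nonneg[of t0] H[of t0] \<delta> by simp
      have "(t - t0) * (H * (2 * M) powr p) \<le> \<delta> * (H * (2 * M) powr p)"
        using t H0 by (intro mult_right_mono) auto
      then have "H * (2 * M) powr p * (t - t0) \<le> M" using \<delta> by (simp add: mult.commute)
      then show "ennreal (H * (2 * M) powr p) * ennreal (t - t0) \<le> ennreal M"
        using H0 t' by (simp add: ennreal_mult[symmetric] ennreal_leI)
    qed
    also have "\<dots> = W t x" using t' M(1) by (simp add: W_def flip: ennreal_plus)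
    finally show ?thesis .
  qed
  then have UW: "AE x in lborel. U s x \<le> W s x" if "0 \<le> s" "s \<le> t0 + \<delta>" for s
    using that by (intro U_le_supersolution[of "t0 + \<delta>"]) auto
  have WB: "W s x \<le> ennreal (max B (2 * M))" if "0 \<le> s" for s x
    using B(2)[of s x] that by (auto simp: W_def intro: order_trans[OF _ ennreal_leI])
  show ?thesis
  proof (rule bounded_uptoI)
    fix s assume "0 \<le> s" "s \<le> t0 + \<delta>"
    then show "AE x in lborel. U s x \<le> ennreal (max B (2 * M))"
      using UW[of s] WB[of s] by (auto elim!: eventually_mono intro: order_trans)
  qed (use B(1) in simp)
qed

end

section \<open>Continuity in time\<close>

lemma Linf_norm_le:
  assumes "v \<in> borel_measurable borel" "AE x in lborel. \<bar>v x\<bar> \<le> B"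
  shows "Linf_norm v \<le> ereal B"
  unfolding Linf_norm_def using assms by (intro esssup_I) auto

lemma Linf_norm_nonneg: "0 \<le> Linf_norm (v :: 'a::euclidean_space \<Rightarrow> real)"
proof -
  have "esssup (lborel :: 'a measure) (\<lambda>_. 0 :: ereal) \<le> Linf_norm v"
    unfolding Linf_norm_def by (rule esssup_mono) auto
  then show ?thesis by (simp add: esssup_const)
qed

lemma AE_le_Linf_norm:
  assumes "Linf_norm v \<le> ereal B"
  shows "AE x in lborel. \<bar>v x\<bar> \<le> B"
  using esssup_AE[of "\<lambda>x. ereal \<bar>v x\<bar>" lborel]
proof (rule eventually_mono)
  fix x assume "ereal \<bar>v x\<bar> \<le> esssup lborel (\<lambda>x. ereal \<bar>v x\<bar>)"
  then have "ereal \<bar>v x\<bar> \<le> ereal B" using assms unfolding Linf_norm_def by (rule order_trans)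
  then show "\<bar>v x\<bar> \<le> B" by simp
qed

lemma tendsto_Linf_zeroI:
  assumes "\<And>e. 0 < e \<Longrightarrow> eventually (\<lambda>n. Linf_norm (w n) \<le> ereal e) F"
  shows "((\<lambda>n. Linf_norm (w n)) \<longlongrightarrow> 0) F"
proof (rule order_tendstoI)
  fix a :: ereal assume "a < 0"
  then show "\<forall>\<^sub>F n in F. a < Linf_norm (w n)"
    by (intro always_eventually allI less_le_trans[OF _ Linf_norm_nonneg])
next
  fix a :: ereal assume "0 < a"
  then obtain e where "0 < ereal e" "ereal e < a" using ereal_dense2 by blast
  then show "\<forall>\<^sub>F n in F. Linf_norm (w n) < a"
    using assms[of e] by (auto elim!: eventually_mono)
qed

context heat_semigroup
begin

lemma K_integrable:
  assumes "0 < t" shows "integrable lborel (\<lambda>y. K t (x - y))"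
  using K_mass_reflect[OF assms, of x] by (intro integrableI_nonneg) (auto simp: K_nonneg)

lemma K_mult_integrable:
  assumes "0 < t" and [measurable]: "\<phi> \<in> borel_measurable borel" and bd: "AE y in lborel. \<bar>\<phi> y\<bar> \<le> B"
  shows "integrable lborel (\<lambda>y. K t (x - y) * \<phi> y)"
proof (rule Bochner_Integration.integrable_bound)
  show "integrable lborel (\<lambda>y. K t (x - y) * B)" by (intro integrable_mult_left K_integrable assms)
  show "AE y in lborel. norm (K t (x - y) * \<phi> y) \<le> norm (K t (x - y) * B)"
    using bd by (rule eventually_mono) (auto simp: abs_mult intro!: mult_left_mono)
qed measurable

lemma S_eq_integral:
  assumes t: "0 < t" and [measurable]: "\<phi> \<in> borel_measurable borel"
    and bd: "AE y in lborel. 0 \<le> \<phi> y \<and> \<phi> y \<le> B"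
  shows "S t (\<lambda>y. ennreal (\<phi> y)) x = ennreal (LINT y|lborel. K t (x - y) * \<phi> y)"
    and "0 \<le> (LINT y|lborel. K t (x - y) * \<phi> y)"
    and "(LINT y|lborel. K t (x - y) * \<phi> y) \<le> B"
proof -
  have i: "integrable lborel (\<lambda>y. K t (x - y) * \<phi> y)"
    by (intro K_mult_integrable[OF t, where B=B] eventually_mono[OF bd]) auto
  have nn: "AE y in lborel. 0 \<le> K t (x - y) * \<phi> y"
    using bd by (rule eventually_mono) (auto simp: K_nonneg)
  show eq: "S t (\<lambda>y. ennreal (\<phi> y)) x = ennreal (LINT y|lborel. K t (x - y) * \<phi> y)"
    using t nn_integral_eq_integral[OF i nn] by (simp add: S_def ennreal_mult' K_nonneg)
  show nn': "0 \<le> (LINT y|lborel. K t (x - y) * \<phi> y)"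
    using nn by (rule integral_nonneg_AE)
  have "AE y in (lborel :: 'a measure). (0::real) \<le> B" using bd by (rule eventually_mono) auto
  then have B: "0 \<le> B" by (simp add: eventually_const_iff ae_filter_eq_bot_iff)
  have "S t (\<lambda>y. ennreal (\<phi> y)) x \<le> ennreal B"
  proof (rule S_le_AE[OF t])
    show "AE y in lborel. ennreal (\<phi> y) \<le> ennreal B"
      using bd by (rule eventually_mono) (simp add: ennreal_leI)
  qed
  then show "(LINT y|lborel. K t (x - y) * \<phi> y) \<le> B"
    unfolding eq using B by simp
qed

text \<open>Controls how much a Duhamel term with bounded source changes between \<open>t\<close>
  and \<open>t'\<close>. As the kernel is 0 at nonpositive times, the sources between
  \<open>t\<close> and \<open>t'\<close> are included.\<close>

definition drift :: "real \<Rightarrow> real \<Rightarrow> real \<Rightarrow> ennreal" where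
  "drift b t t' = (\<integral>\<^sup>+s. indicator {0<..<b} s * kdist (t' - s) (t - s) \<partial>lborel)"

lemma K_diff_le_2: "kdist t' t \<le> 2"
proof -
  have m: "(\<integral>\<^sup>+z. ennreal (K t z) \<partial>lborel) \<le> 1" for t
    by (cases "t \<le> 0") (simp_all add: K_nonpos_time K_mass)
  have "kdist t' t \<le> (\<integral>\<^sup>+z. ennreal (K t' z) + ennreal (K t z) \<partial>lborel)"
  proof (rule nn_integral_mono)
    fix z
    have "\<bar>K t' z - K t z\<bar> \<le> K t' z + K t z" using K_nonneg[of t' z] K_nonneg[of t z] by linarith
    then show "ennreal \<bar>K t' z - K t z\<bar> \<le> ennreal (K t' z) + ennreal (K t z)"
      by (simp add: K_nonneg flip: ennreal_plus)
  qed
  also have "\<dots> = (\<integral>\<^sup>+z. ennreal (K t' z) \<partial>lborel) + (\<integral>\<^sup>+z. ennreal (K t z) \<partial>lborel)"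
    by (rule nn_integral_add) measurable
  also have "\<dots> \<le> 1 + 1" by (intro add_mono m)
  finally show ?thesis by (simp add: one_add_one)
qed

text \<open>For \<open>s < t\<close> this is continuity in L^1; for \<open>s > t\<close> both
  kernels eventually vanish; the single time \<open>s = t\<close> is null. The constant 2
  dominates.\<close>

lemma drift_tendsto:
  assumes lim: "X \<longlonglongrightarrow> t"
  shows "(\<lambda>n. drift b t (X n)) \<longlonglongrightarrow> 0"
proof -
  have "(\<lambda>n. drift b t (X n)) \<longlonglongrightarrow> (\<integral>\<^sup>+s. 0 \<partial>(lborel :: real measure))"
    unfolding drift_def
  proof (rule nn_integral_dominated_convergence[where w="\<lambda>s. 2 * indicator {0<..<b} s"])
    show "(\<integral>\<^sup>+s. 2 * indicator {0<..<b} s \<partial>lborel) < \<infinity>"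
      by (simp add: nn_integral_cmult_indicator) (cases "0 \<le> b"; simp add: ennreal_mult_less_top)
    show "AE s in lborel. indicator {0<..<b} s * kdist (X n - s) (t - s) \<le> 2 * indicator {0<..<b} s" for n
      by (intro AE_I2) (auto simp: indicator_def K_diff_le_2)
    have "(\<lambda>n. kdist (X n - s) (t - s)) \<longlonglongrightarrow> 0" if "s \<noteq> t" for s
    proof (cases "s < t")
      case True
      then show ?thesis by (intro K_L1_continuous tendsto_diff lim tendsto_const) simp
    next
      case False
      with that have "t < s" by simp
      with lim have "\<forall>\<^sub>F n in sequentially. X n < s" by (rule order_tendstoD)
      then have "\<forall>\<^sub>F n in sequentially. (kdist (X n - s) (t - s)) = 0"
        by (rule eventually_mono) (use \<open>t < s\<close> in \<open>simp add: K_nonpos_time\<close>)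
      then show ?thesis by (rule tendsto_eventually)
    qed
    then have "(\<lambda>n. indicator {0<..<b} s * kdist (X n - s) (t - s)) \<longlonglongrightarrow> 0" if "s \<noteq> t" for s
      using that by (cases "s \<in> {0<..<b}") auto
    then show "AE s in lborel. (\<lambda>n. indicator {0<..<b} s * kdist (X n - s) (t - s)) \<longlonglongrightarrow> 0"
      using AE_lborel_singleton[of t] by (auto elim!: eventually_mono)
  qed measurable
  then show ?thesis by simp
qed

text \<open>Bounding one kernel by the other plus their absolute difference avoids subtraction in
  the extended half-line and treats both orders of \<open>t\<close> and \<open>t'\<close>
  alike.\<close>

lemma duhamel_drift:
  assumes g: "case_prod g \<in> borel_measurable (borel \<Otimes>\<^sub>M borel)"
    and bd: "\<And>s y. 0 < s \<Longrightarrow> s < b \<Longrightarrow> g s y \<le> C" and t: "t \<le> b" "t' \<le> b"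
  shows "duhamel 0 g t' x \<le> duhamel 0 g t x + C * drift b t t'"
proof -
  note [measurable (raw)] = measurable_uncurry[OF g]
  have "duhamel 0 g t' x \<le> (\<integral>\<^sup>+s. slice {0<..} g t x s
     + C * (indicator {0<..<b} s * kdist (t' - s) (t - s)) \<partial>lborel)"
    unfolding duhamel_def
  proof (rule nn_integral_mono)
    fix s
    show "slice {0<..} g t' x s
      \<le> slice {0<..} g t x s
     + C * (indicator {0<..<b} s * kdist (t' - s) (t - s))"
    proof (cases "0 < s \<and> s < b")
      case True
      have "slice {0<..} g t' x s
        \<le> (\<integral>\<^sup>+y. ennreal (K (t - s) (x - y)) * g s y + C * ennreal \<bar>K (t' - s) (x - y) - K (t - s) (x - y)\<bar> \<partial>lborel)"
      proof (rule nn_integral_mono)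
        fix y
        have "ennreal (K (t' - s) (x - y)) \<le> ennreal (K (t - s) (x - y)) + ennreal \<bar>K (t' - s) (x - y) - K (t - s) (x - y)\<bar>"
          by (simp add: K_nonneg flip: ennreal_plus)
        then have "ennreal (K (t' - s) (x - y)) * g s y \<le> (ennreal (K (t - s) (x - y)) + ennreal \<bar>K (t' - s) (x - y) - K (t - s) (x - y)\<bar>) * g s y"
          by (rule mult_right_mono) simp
        also have "\<dots> \<le> ennreal (K (t - s) (x - y)) * g s y + C * ennreal \<bar>K (t' - s) (x - y) - K (t - s) (x - y)\<bar>"
          unfolding distrib_right using bd[of s y] True
          by (intro add_left_mono) (auto simp: mult.commute intro!: mult_right_mono)
        finally show "indicator {0<..} s * (ennreal (K (t' - s) (x - y)) * g s y)
          \<le> ennreal (K (t - s) (x - y)) * g s y + C * ennreal \<bar>K (t' - s) (x - y) - K (t - s) (x - y)\<bar>"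
          using True by simp
      qed
      also have "\<dots> = (\<integral>\<^sup>+y. ennreal (K (t - s) (x - y)) * g s y \<partial>lborel)
        + C * (\<integral>\<^sup>+y. ennreal \<bar>K (t' - s) (x - y) - K (t - s) (x - y)\<bar> \<partial>lborel)"
        by (simp add: nn_integral_add nn_integral_cmult)
      also have "(\<integral>\<^sup>+y. ennreal \<bar>K (t' - s) (x - y) - K (t - s) (x - y)\<bar> \<partial>lborel)
         = (kdist (t' - s) (t - s))"
        by (rule nn_integral_lborel_reflect[of "\<lambda>z. ennreal \<bar>K (t' - s) z - K (t - s) z\<bar>"]) measurable
      finally show ?thesis using True by simp
    qed (use t in \<open>auto simp: K_nonpos_time\<close>)
  qed
  also have "\<dots> = duhamel 0 g t x + C * drift b t t'"
    unfolding duhamel_def drift_def by (subst nn_integral_add) (simp_all add: nn_integral_cmult)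
  finally show ?thesis .
qed

text \<open>At time 0, values nearby differ by less than \<open>e / 2\<close>, and values farther
  away than \<open>d\<close> carry too little kernel mass to matter. Applying the monotone
  \<open>S t\<close>, which does not increase constants, propagates this to all later times,
  uniformly in space.\<close>

lemma S_uniformly_continuous_time:
  assumes uc: "uniformly_continuous_on UNIV \<phi>" and bd: "\<And>x. 0 \<le> \<phi> x" "\<And>x. \<phi> x \<le> B"
    and e: "0 < e"
  obtains \<delta> where "0 < \<delta>"
    "\<And>t \<tau> x. 0 \<le> t \<Longrightarrow> 0 \<le> \<tau> \<Longrightarrow> \<tau> < \<delta> \<Longrightarrow>
       S (t + \<tau>) (\<lambda>y. ennreal (\<phi> y)) x \<le> S t (\<lambda>y. ennreal (\<phi> y)) x + ennreal e \<and>
       S t (\<lambda>y. ennreal (\<phi> y)) x \<le> S (t + \<tau>) (\<lambda>y. ennreal (\<phi> y)) x + ennreal e"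
proof -
  have [measurable]: "\<phi> \<in> borel_measurable borel"
    using uc by (intro borel_measurable_continuous_onI uniformly_continuous_imp_continuous)
  have B: "0 \<le> B" using bd[of 0] by linarith
  obtain d where d: "0 < d" "\<And>x y. dist x y < d \<Longrightarrow> dist (\<phi> x) (\<phi> y) < e / 2"
    using uc e unfolding uniformly_continuous_on_def by (metis UNIV_I half_gt_zero)
  \<comment> \<open>Multiplied by the bound \<open>B\<close>, this tail stays below
    \<open>e / 2\<close>; the \<open>+ 1\<close> covers \<open>B = 0\<close>.\<close>
  obtain t0 where t0: "0 < t0" "\<And>t. 0 < t \<Longrightarrow> t < t0 \<Longrightarrow>
      (\<integral>\<^sup>+x. indicator {x. d \<le> norm x} x * ennreal (K t x) \<partial>lborel) \<le> ennreal (e / (2 * (B + 1)))"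
    using K_approx_identity[OF d(1), of "e / (2 * (B + 1))"] e B by auto
  let ?\<phi> = "\<lambda>y. ennreal (\<phi> y)"
  have small: "S \<tau> ?\<phi> x \<le> ?\<phi> x + ennreal e \<and> ?\<phi> x \<le> S \<tau> ?\<phi> x + ennreal e"
    if \<tau>: "0 < \<tau>" "\<tau> < t0" for \<tau> x
  proof -
    let ?r = "\<lambda>y. ennreal (e / 2) + ennreal B * indicator {z. d \<le> norm z} (x - y)"
    have osc: "?\<phi> a \<le> ?\<phi> c + (ennreal (e / 2) + ennreal B * indicator {z. d \<le> norm z} (a - c))" for a c
    proof (cases "d \<le> norm (a - c)")
      case True
      have "\<phi> a \<le> \<phi> c + (e / 2 + B)" using bd(2)[of a] bd(1)[of c] e by simp
      then show ?thesis using True e B bd by (simp flip: ennreal_plus)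
    next
      case False
      then have "dist (\<phi> a) (\<phi> c) < e / 2" using d(2)[of a c] by (simp add: dist_norm)
      then have "\<phi> a \<le> \<phi> c + e / 2" unfolding dist_real_def by linarith
      then show ?thesis using False e bd by (simp flip: ennreal_plus)
    qed
    have sym: "indicator {z. d \<le> norm z} (y - x) = (indicator {z. d \<le> norm z} (x - y) :: ennreal)" for y
      by (simp add: indicator_def norm_minus_commute)
    have Sr: "S \<tau> ?r x \<le> ennreal e"
    proof -
      have "S \<tau> ?r x = (\<integral>\<^sup>+y. ennreal (K \<tau> (x - y)) * ennreal (e / 2) + ennreal B * (indicator {z. d \<le> norm z} (x - y) * ennreal (K \<tau> (x - y))) \<partial>lborel)"
        using \<tau> by (simp add: S_def distrib_left mult_ac)
      also have "\<dots> = ennreal (e / 2) + ennreal B * (\<integral>\<^sup>+y. indicator {z. d \<le> norm z} (x - y) * ennreal (K \<tau> (x - y)) \<partial>lborel)"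
        using \<tau> by (simp add: nn_integral_add nn_integral_multc nn_integral_cmult K_mass_reflect)
      also have "(\<integral>\<^sup>+y. indicator {z. d \<le> norm z} (x - y) * ennreal (K \<tau> (x - y)) \<partial>lborel)
         = (\<integral>\<^sup>+z. indicator {z. d \<le> norm z} z * ennreal (K \<tau> z) \<partial>lborel)"
        by (rule nn_integral_lborel_reflect[of "\<lambda>z. indicator {z. d \<le> norm z} z * ennreal (K \<tau> z)"]) measurable
      also have "ennreal (e / 2) + ennreal B * \<dots> \<le> ennreal (e / 2) + ennreal B * ennreal (e / (2 * (B + 1)))"
        by (intro add_left_mono mult_left_mono t0 \<tau>) auto
      also have "\<dots> = ennreal (e / 2 + B * (e / (2 * (B + 1))))"
        using B e by (simp add: ennreal_mult[symmetric] ennreal_plus[symmetric] del: ennreal_plus)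
      also have "\<dots> \<le> ennreal e"
        using B e by (intro ennreal_leI) (simp add: field_simps)
      finally show ?thesis .
    qed
    have "S \<tau> ?\<phi> x \<le> S \<tau> (\<lambda>y. ?\<phi> x + ?r y) x"
      by (intro S_mono) (use osc sym in metis)
    also have "\<dots> = S \<tau> (\<lambda>y. ?\<phi> x) x + S \<tau> ?r x" by (rule S_add) measurable
    also have "\<dots> \<le> ?\<phi> x + ennreal e" by (intro add_mono S_le Sr) auto
    finally have 1: "S \<tau> ?\<phi> x \<le> ?\<phi> x + ennreal e" .
    have "?\<phi> x = S \<tau> (\<lambda>y. ?\<phi> x) x" using \<tau> by (simp add: S_def nn_integral_multc K_mass_reflect)
    also have "\<dots> \<le> S \<tau> (\<lambda>y. ?\<phi> y + ?r y) x" by (intro S_mono osc)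
    also have "\<dots> = S \<tau> ?\<phi> x + S \<tau> ?r x" by (rule S_add) measurable
    also have "\<dots> \<le> S \<tau> ?\<phi> x + ennreal e" by (intro add_left_mono Sr)
    finally show ?thesis using 1 by blast
  qed
  show thesis
  proof (rule that[OF t0(1)])
    fix t \<tau> :: real and x :: 'a assume t: "0 \<le> t" and \<tau>: "0 \<le> \<tau>" "\<tau> < t0"
    have Se: "S t (\<lambda>y. f y + ennreal e) x \<le> S t f x + ennreal e" if [measurable]: "f \<in> borel_measurable borel" for f
    proof -
      have "S t (\<lambda>y. f y + ennreal e) x = S t f x + S t (\<lambda>_. ennreal e) x" by (rule S_add) measurable
      also have "\<dots> \<le> S t f x + ennreal e" by (intro add_left_mono S_le) simp
      finally show ?thesis .
    qed
    have small': "S \<tau> ?\<phi> x \<le> ?\<phi> x + ennreal e" "?\<phi> x \<le> S \<tau> ?\<phi> x + ennreal e" for x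
      using small[of \<tau> x] \<tau> by (cases "\<tau> = 0"; auto simp: S_def)+
    have "S t (S \<tau> ?\<phi>) x \<le> S t (\<lambda>y. ?\<phi> y + ennreal e) x" by (intro S_mono small')
    also have "\<dots> \<le> S t ?\<phi> x + ennreal e" by (rule Se) measurable
    finally have 1: "S t (S \<tau> ?\<phi>) x \<le> S t ?\<phi> x + ennreal e" .
    have "S t ?\<phi> x \<le> S t (\<lambda>y. S \<tau> ?\<phi> y + ennreal e) x" by (intro S_mono small')
    also have "\<dots> \<le> S t (S \<tau> ?\<phi>) x + ennreal e" by (rule Se) measurable
    finally show "S (t + \<tau>) ?\<phi> x \<le> S t ?\<phi> x + ennreal e \<and> S t ?\<phi> x \<le> S (t + \<tau>) ?\<phi> x + ennreal e"
      using 1 t \<tau> by (simp add: S_S)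
  qed
qed

end

section \<open>Comparison with mild solutions\<close>

context heat_semigroup
begin

text \<open>The difference is split as \<open>(K' - K) * \<phi> + K * (\<phi> - \<psi>)\<close>,
  writing \<open>K'\<close> for the kernel at time \<open>t'\<close>: the change of kernel is
  charged to the bound \<open>C\<close>, the change of function to the unit mass.\<close>

lemma K_integral_diff_le:
  assumes t: "0 < t" "0 < t'" and C: "0 \<le> C"
    and m: "\<phi> \<in> borel_measurable borel" "\<psi> \<in> borel_measurable borel"
    and bd: "AE y in lborel. \<bar>\<phi> y\<bar> \<le> C" "AE y in lborel. \<bar>\<psi> y\<bar> \<le> C"
    and diff: "AE y in lborel. \<bar>\<phi> y - \<psi> y\<bar> \<le> e"
    and small: "kdist t' t \<le> ennreal \<eta>" "0 \<le> \<eta>"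
  shows "\<bar>(LINT y|lborel. K t' (x - y) * \<phi> y) - (LINT y|lborel. K t (x - y) * \<psi> y)\<bar> \<le> C * \<eta> + e"
proof -
  have i1: "integrable lborel (\<lambda>y. K t' (x - y) * \<phi> y)"
    by (rule K_mult_integrable[OF t(2) m(1) bd(1)])
  have i2: "integrable lborel (\<lambda>y. K t (x - y) * \<psi> y)"
    by (rule K_mult_integrable[OF t(1) m(2) bd(2)])
  have i3: "integrable lborel (\<lambda>y. \<bar>K t' (x - y) - K t (x - y)\<bar>)"
    by (intro integrable_abs Bochner_Integration.integrable_diff K_integrable t)
  have i4: "integrable lborel (\<lambda>y. C * \<bar>K t' (x - y) - K t (x - y)\<bar>)"
    "integrable lborel (\<lambda>y. e * K t (x - y))"
    by (intro integrable_mult_right i3 K_integrable t)+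
  have "(LINT y|lborel. K t' (x - y) * \<phi> y) - (LINT y|lborel. K t (x - y) * \<psi> y)
      = (LINT y|lborel. K t' (x - y) * \<phi> y - K t (x - y) * \<psi> y)"
    by (rule Bochner_Integration.integral_diff[OF i1 i2, symmetric])
  also have "\<bar>\<dots>\<bar> \<le> (LINT y|lborel. \<bar>K t' (x - y) * \<phi> y - K t (x - y) * \<psi> y\<bar>)"
    by (rule integral_abs_bound)
  also have "\<dots> \<le> (LINT y|lborel. C * \<bar>K t' (x - y) - K t (x - y)\<bar> + e * K t (x - y))"
  proof (rule integral_mono_AE)
    show "integrable lborel (\<lambda>y. \<bar>K t' (x - y) * \<phi> y - K t (x - y) * \<psi> y\<bar>)"
      by (intro integrable_abs Bochner_Integration.integrable_diff i1 i2)
    show "integrable lborel (\<lambda>y. C * \<bar>K t' (x - y) - K t (x - y)\<bar> + e * K t (x - y))"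
      by (rule Bochner_Integration.integrable_add[OF i4])
    show "AE y in lborel. \<bar>K t' (x - y) * \<phi> y - K t (x - y) * \<psi> y\<bar> \<le> C * \<bar>K t' (x - y) - K t (x - y)\<bar> + e * K t (x - y)"
      using bd(1) diff
    proof eventually_elim
      case (elim y)
      have "K t' (x - y) * \<phi> y - K t (x - y) * \<psi> y = (K t' (x - y) - K t (x - y)) * \<phi> y + K t (x - y) * (\<phi> y - \<psi> y)"
        by (simp add: left_diff_distrib right_diff_distrib)
      also have "\<bar>\<dots>\<bar> \<le> \<bar>K t' (x - y) - K t (x - y)\<bar> * \<bar>\<phi> y\<bar> + K t (x - y) * \<bar>\<phi> y - \<psi> y\<bar>"
        by (rule order_trans[OF abs_triangle_ineq]) (simp add: abs_mult K_nonneg)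
      also have "\<dots> \<le> \<bar>K t' (x - y) - K t (x - y)\<bar> * C + K t (x - y) * e"
        using elim by (intro add_mono mult_left_mono K_nonneg) auto
      finally show ?case by (simp add: mult.commute)
    qed
  qed
  also have "\<dots> = C * (LINT y|lborel. \<bar>K t' (x - y) - K t (x - y)\<bar>) + e * (LINT y|lborel. K t (x - y))"
    by (simp add: Bochner_Integration.integral_add[OF i4])
  also have "(LINT y|lborel. K t (x - y)) = 1"
    using t by (subst integral_eq_nn_integral) (simp_all add: K_nonneg K_mass_reflect)
  also have "C * (LINT y|lborel. \<bar>K t' (x - y) - K t (x - y)\<bar>) \<le> C * \<eta>"
  proof (rule mult_left_mono[OF _ C])
    have "ennreal (LINT y|lborel. \<bar>K t' (x - y) - K t (x - y)\<bar>) = (\<integral>\<^sup>+y. ennreal \<bar>K t' (x - y) - K t (x - y)\<bar> \<partial>lborel)"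
      by (rule nn_integral_eq_integral[OF i3, symmetric]) simp
    also have "\<dots> = (kdist t' t)"
      by (rule nn_integral_lborel_reflect[of "\<lambda>z. ennreal \<bar>K t' z - K t z\<bar>"]) measurable
    also have "\<dots> \<le> ennreal \<eta>" by (rule small)
    finally show "(LINT y|lborel. \<bar>K t' (x - y) - K t (x - y)\<bar>) \<le> \<eta>"
      using small(2) by (simp add: ennreal_le_iff)
  qed
  finally show ?thesis by simp
qed

end

locale mild_problem = minimal_solution K h p u0
  for K :: "real \<Rightarrow> 'a::euclidean_space \<Rightarrow> real" and h :: "real \<Rightarrow> real" and p :: real and u0 :: "'a \<Rightarrow> real" +
  fixes \<sigma> :: real
  assumes kernel_eq: "\<And>t x. 0 < t \<Longrightarrow> mixed_heat_kernel \<sigma> t (x :: 'a) = K t x"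
    and u0_uc: "uniformly_continuous_on UNIV u0"
begin

abbreviation source :: "(real \<Rightarrow> 'a \<Rightarrow> real) \<Rightarrow> real \<Rightarrow> 'a \<Rightarrow> real" where
  "source g t x \<equiv> (LINT s:{0..t}|lborel. mixed_semigroup \<sigma> (t - s) (g s) x)"

abbreviation mild :: "ereal \<Rightarrow> (real \<Rightarrow> 'a \<Rightarrow> real) \<Rightarrow> bool" where
  "mild \<equiv> mild_solution \<sigma> h (\<lambda>r. r powr p) u0"

abbreviation blowup :: bool where
  "blowup \<equiv> blows_up_in_finite_time \<sigma> h (\<lambda>r. r powr p) u0"

section \<open>From nonnegative integrals to the Bochner integrals of mild solutions\<close>

lemma mixed_semigroup_eq: "0 < t \<Longrightarrow> mixed_semigroup \<sigma> t \<phi> x = (LINT y|lborel. K t (x - y) * \<phi> y)"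
  by (simp add: mixed_semigroup_def kernel_eq)

lemma S_U0:
  assumes t: "0 \<le> t"
  shows "S t U0 x = ennreal (mixed_semigroup \<sigma> t u0 x)" and "0 \<le> mixed_semigroup \<sigma> t u0 x"
proof -
  obtain B where B: "\<And>x. u0 x \<le> B" using u0_bdd by blast
  have "S t U0 x = ennreal (mixed_semigroup \<sigma> t u0 x) \<and> 0 \<le> mixed_semigroup \<sigma> t u0 x"
  proof (cases "t = 0")
    case True
    then show ?thesis by (simp add: S_def mixed_semigroup_def u0_nonneg)
  next
    case False
    then have "0 < t" using t by simp
    then show ?thesis
      using S_eq_integral[of t u0 B x] B u0_nonneg by (simp add: mixed_semigroup_eq)
  qed
  then show "S t U0 x = ennreal (mixed_semigroup \<sigma> t u0 x)" "0 \<le> mixed_semigroup \<sigma> t u0 x" by auto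
qed

text \<open>Measurability in \<open>s\<close> has to be a premise: without it the Bochner integral
  would collapse to 0 whatever the size of the integrand.\<close>

lemma
  assumes t: "0 \<le> t"
    and g: "\<And>s. 0 \<le> s \<Longrightarrow> s < t \<Longrightarrow> g s \<in> borel_measurable borel"
    and bd: "\<And>s. 0 \<le> s \<Longrightarrow> s < t \<Longrightarrow> AE y in lborel. 0 \<le> g s y \<and> g s y \<le> C"
    and meas: "(\<lambda>s. indicator {0..<t} s * (LINT y|lborel. K (t - s) (x - y) * g s y)) \<in> borel_measurable borel"
  shows duhamel_eq_integral:
      "duhamel 0 (\<lambda>s y. ennreal (g s y)) t x = ennreal (source g t x)" (is ?E)
    and duhamel_integral_nonneg:
      "0 \<le> (source g t x)" (is ?N)
proof -
  let ?F = "\<lambda>s. indicator {0..<t} s * (LINT y|lborel. K (t - s) (x - y) * g s y)"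
  note [measurable] = meas
  have F: "0 \<le> ?F s \<and> ?F s \<le> C * indicator {0..<t} s" for s
    using S_eq_integral(2,3)[of "t - s" "g s" C x] g[of s] bd[of s] by (auto simp: indicator_def)
  \<comment> \<open>At the endpoint \<open>s = t\<close> the semigroup is the identity and not an
    integral against a kernel; that point is split off and has measure 0.\<close>
  have "(\<lambda>s. indicator {0..t} s *\<^sub>R mixed_semigroup \<sigma> (t - s) (g s) x) = (\<lambda>s. ?F s + indicator {t} s * g t x)"
    using t by (auto simp: fun_eq_iff indicator_def mixed_semigroup_eq) (simp add: mixed_semigroup_def)
  then have "(source g t x) = (LINT s|lborel. ?F s + indicator {t} s * g t x)"
    by (simp add: set_lebesgue_integral_def)
  also have "\<dots> = (LINT s|lborel. ?F s)"
  proof (rule integral_cong_AE)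
    show "AE s in lborel. ?F s + indicator {t} s * g t x = ?F s"
      using AE_lborel_singleton[of t] by (rule eventually_mono) simp
  qed measurable
  finally have L: "(source g t x) = (LINT s|lborel. ?F s)" .
  have i: "integrable lborel ?F"
  proof (rule Bochner_Integration.integrable_bound)
    show "integrable lborel (\<lambda>s. C * indicator {0..<t} s)"
      by (intro integrable_mult_right) (use t in \<open>simp add: integrable_indicator_iff\<close>)
    show "AE s in lborel. norm (?F s) \<le> norm (C * indicator {0..<t} s)"
      using F by (intro AE_I2) (metis (no_types, lifting) abs_of_nonneg order_trans real_norm_def)
  qed measurable
  have "duhamel 0 (\<lambda>s y. ennreal (g s y)) t x = (\<integral>\<^sup>+s. ennreal (?F s) \<partial>lborel)"
    unfolding duhamel_def
  proof (rule nn_integral_cong_AE, use AE_lborel_singleton[of 0] in eventually_elim)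
    fix s :: real assume s: "s \<noteq> 0"
    show "(\<integral>\<^sup>+y. indicator {0<..} s * (ennreal (K (t - s) (x - y)) * ennreal (g s y)) \<partial>lborel) = ennreal (?F s)"
    proof (cases "0 < s \<and> s < t")
      case True
      then show ?thesis
        using S_eq_integral(1)[of "t - s" "g s" C x] g[of s] bd[of s] by (simp add: S_def)
    qed (use s in \<open>auto simp: K_nonpos_time\<close>)
  qed
  also have "\<dots> = ennreal (LINT s|lborel. ?F s)"
    using F by (intro nn_integral_eq_integral i AE_I2) blast
  finally show ?E unfolding L .
  show ?N unfolding L using F by (intro integral_nonneg_AE AE_I2) blast
qed

text \<open>Faithful only where \<open>U\<close> is finite, since \<open>enn2real\<close> sends
  infinity to 0.\<close>

abbreviation u :: "real \<Rightarrow> 'a \<Rightarrow> real" where "u \<equiv> \<lambda>t x. enn2real (U t x)"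

lemma U_mild_equation:
  assumes t: "0 \<le> t" and bd: "bounded_upto t"
  shows "u t x = mixed_semigroup \<sigma> t u0 x +
    (LINT s:{0..t}|lborel. mixed_semigroup \<sigma> (t - s) (\<lambda>y. h s * u s y powr p) x)"
proof -
  obtain B where B: "0 \<le> B" "\<And>s x. 0 \<le> s \<Longrightarrow> s \<le> t \<Longrightarrow> U s x \<le> ennreal B"
    using bd unfolding bounded_upto_def by blast
  obtain H where H: "0 \<le> H" "\<And>s. 0 \<le> s \<Longrightarrow> s \<le> t \<Longrightarrow> h s \<le> H" using h_bounded[of 0 t] by blast
  have Uu: "ennreal (u s y) = U s y" if "0 \<le> s" "s \<le> t" for s y
    using le_less_trans[OF B(2)[OF that, of y] ennreal_less_top] by simp
  have uB: "u s y \<le> B" if "0 \<le> s" "s \<le> t" for s y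
    by (rule enn2real_leI[OF B(1) B(2)[OF that]])
  let ?g = "\<lambda>s y. h s * u s y powr p"
  have srcg: "src U s y = ennreal (?g s y)" if "0 \<le> s" "s \<le> t" for s y
    unfolding src_def by (subst Uu[OF that, symmetric]) (simp add: ennreal_mult h_nonneg)
  have g: "0 \<le> ?g s y \<and> ?g s y \<le> H * B powr p" if "0 \<le> s" "s \<le> t" for s y
  proof -
    have "u s y powr p \<le> B powr p" using uB[OF that, of y] p by (intro powr_mono2) auto
    then have "h s * u s y powr p \<le> H * B powr p"
      using H that by (intro mult_mono) auto
    then show ?thesis by (simp add: h_nonneg)
  qed
  note [measurable (raw)] = measurable_uncurry[OF U_pair]
  have *: "duhamel 0 (\<lambda>s y. ennreal (?g s y)) t x = ennreal (source ?g t x)"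
      "0 \<le> (source ?g t x)"
  proof -
    have m: "(\<lambda>s. indicator {0..<t} s * (LINT y|lborel. K (t - s) (x - y) * ?g s y)) \<in> borel_measurable borel"
      by measurable
    have m': "?g s \<in> borel_measurable borel" for s
      by measurable
    have bd': "AE y in lborel. 0 \<le> ?g s y \<and> ?g s y \<le> H * B powr p" if "0 \<le> s" "s < t" for s
      using that by (intro AE_I2 g) auto
    show "duhamel 0 (\<lambda>s y. ennreal (?g s y)) t x = ennreal (source ?g t x)"
      by (rule duhamel_eq_integral[OF t m' bd' m])
    show "0 \<le> (source ?g t x)"
      by (rule duhamel_integral_nonneg[OF t m' bd' m])
  qed
  have "ennreal (u t x) = S t U0 x + duhamel 0 (src U) t x"
    unfolding Uu[OF t order_refl] by (rule U_eq)
  also have "duhamel 0 (src U) t x = duhamel 0 (\<lambda>s y. ennreal (?g s y)) t x"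
    by (rule duhamel_cong) (simp add: srcg)
  also have "S t U0 x + \<dots> = ennreal (mixed_semigroup \<sigma> t u0 x + (source ?g t x))"
    using * S_U0[OF t, of x] by (simp add: ennreal_plus[symmetric] del: ennreal_plus)
  finally show ?thesis
    using *(2) S_U0(2)[OF t, of x] by (simp del: ennreal_plus)
qed

lemma drift_commute: "drift b t t' = drift b t' t"
  unfolding drift_def by (simp add: abs_minus_commute)

text \<open>Half of \<open>e\<close> pays for the free flow, which is uniformly continuous in time
  because \<open>u0\<close> is uniformly continuous; the other half pays for the drift of the
  Duhamel term. Neither estimate depends on \<open>x\<close>.\<close>

lemma U_time_continuous:
  assumes bd: "bounded_upto b" and t: "0 \<le> t" "t \<le> b" and e: "0 < e"
    and X: "X \<longlonglongrightarrow> t" "\<And>n. 0 \<le> X n" "\<And>n. X n \<le> b"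
  shows "\<forall>\<^sub>F n in sequentially. \<forall>x. \<bar>u (X n) x - u t x\<bar> \<le> e"
proof -
  obtain B where B: "0 \<le> B" "\<And>s x. 0 \<le> s \<Longrightarrow> s \<le> b \<Longrightarrow> U s x \<le> ennreal B"
    using bd unfolding bounded_upto_def by blast
  obtain H where H: "0 \<le> H" "\<And>s. 0 \<le> s \<Longrightarrow> s \<le> b \<Longrightarrow> h s \<le> H" using h_bounded[of 0 b] by blast
  define C where "C = H * B powr p"
  have C: "0 \<le> C" using H(1) by (simp add: C_def)
  have src: "src U s y \<le> ennreal C" if "0 < s" "s < b" for s y
    unfolding C_def using that by (intro src_le B H) auto
  have Uu: "ennreal (u s y) = U s y" if "0 \<le> s" "s \<le> b" for s y
    using le_less_trans[OF B(2)[OF that, of y] ennreal_less_top] by simp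
  obtain B0 where B0: "\<And>x. u0 x \<le> B0" using u0_bdd by blast
  obtain \<delta> where \<delta>: "0 < \<delta>" "\<And>t \<tau> x. 0 \<le> t \<Longrightarrow> 0 \<le> \<tau> \<Longrightarrow> \<tau> < \<delta> \<Longrightarrow>
       S (t + \<tau>) U0 x \<le> S t U0 x + ennreal (e / 2) \<and> S t U0 x \<le> S (t + \<tau>) U0 x + ennreal (e / 2)"
    using S_uniformly_continuous_time[OF u0_uc u0_nonneg B0, of "e / 2"] e by auto
  have Scl: "S r U0 x \<le> S s U0 x + ennreal (e / 2)" if "0 \<le> s" "0 \<le> r" "\<bar>r - s\<bar> < \<delta>" for r s x
  proof (cases "s \<le> r")
    case True then show ?thesis using \<delta>(2)[of s "r - s" x] that by auto
  next
    case False then show ?thesis using \<delta>(2)[of r "s - r" x] that by auto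
  qed
  have "\<forall>\<^sub>F n in sequentially. drift b t (X n) < ennreal (e / (2 * (C + 1)))"
    using drift_tendsto[OF X(1)] e C by (intro order_tendstoD(2)) auto
  moreover have "\<forall>\<^sub>F n in sequentially. dist (X n) t < \<delta>"
    using X(1) \<delta>(1) by (rule tendstoD)
  ultimately show ?thesis
  proof eventually_elim
    case (elim n)
    have cd: "ennreal C * drift b r s \<le> ennreal (e / 2)" if "drift b r s \<le> ennreal (e / (2 * (C + 1)))" for r s
    proof -
      have "ennreal C * drift b r s \<le> ennreal C * ennreal (e / (2 * (C + 1)))"
        by (intro mult_left_mono that) auto
      also have "\<dots> = ennreal (C * (e / (2 * (C + 1))))"
        using C e by (intro ennreal_mult[symmetric]) auto
      also have "\<dots> \<le> ennreal (e / 2)" using C e by (intro ennreal_leI) (simp add: field_simps)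
      finally show ?thesis .
    qed
    \<comment> \<open>One-sided and symmetric in its two times, so that using it twice gives the
      absolute value.\<close>
    have step: "u r x \<le> u s x + e"
      if rs: "0 \<le> r" "r \<le> b" "0 \<le> s" "s \<le> b" "\<bar>r - s\<bar> < \<delta>" "drift b s r \<le> ennreal (e / (2 * (C + 1)))" for r s x
    proof -
      have "ennreal (u r x) = S r U0 x + duhamel 0 (src U) r x"
        unfolding Uu[OF rs(1,2)] by (rule U_eq)
      also have "\<dots> \<le> (S s U0 x + ennreal (e / 2)) + (duhamel 0 (src U) s x + ennreal C * drift b s r)"
        using rs by (intro add_mono Scl duhamel_drift src_pair U_pair src) auto
      also have "\<dots> \<le> (S s U0 x + ennreal (e / 2)) + (duhamel 0 (src U) s x + ennreal (e / 2))"
        by (intro add_left_mono cd rs)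
      also have "\<dots> = U s x + (ennreal (e / 2) + ennreal (e / 2))"
        unfolding U_eq[of s x] by (simp add: ac_simps)
      also have "\<dots> = ennreal (u s x + e)"
        using e by (subst Uu[OF rs(3,4), symmetric]) (simp add: ennreal_plus[symmetric] del: ennreal_plus)
      finally show ?thesis using e by (simp del: ennreal_plus)
    qed
    have "u (X n) x \<le> u t x + e" "u t x \<le> u (X n) x + e" for x
      using step[of "X n" t x] step[of t "X n" x] elim t X(2,3)[of n] drift_commute[of b t "X n"]
      by (auto simp: dist_real_def abs_minus_commute)
    then show ?case by (simp add: abs_le_iff algebra_simps)
  qed
qed

lemma mild_solution_U:
  assumes T: "0 < T" and bd: "\<And>t. 0 \<le> t \<Longrightarrow> ereal t < T \<Longrightarrow> bounded_upto t"
  shows "mild T u"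
  unfolding mild_solution_def
proof (intro conjI allI impI T)
  fix t assume t: "0 \<le> t \<and> ereal t < T"
  \<comment> \<open>Room to the right of \<open>t\<close>: times approaching \<open>t\<close> from
    above must also lie in a range where \<open>U\<close> is bounded.\<close>
  then obtain b where b: "t < b" "ereal b < T" using ereal_dense2[of "ereal t" T] by auto
  have bdb: "bounded_upto b" using bd[of b] t b by simp
  obtain B where B: "0 \<le> B" "\<And>s x. 0 \<le> s \<Longrightarrow> s \<le> b \<Longrightarrow> U s x \<le> ennreal B"
    using bdb unfolding bounded_upto_def by blast
  have "u t x \<le> B" for x
    using t b by (intro enn2real_leI B) auto
  then have "Linf_norm (u t) \<le> ereal B" by (intro Linf_norm_le) auto
  then show "in_Linf (u t)" unfolding in_Linf_def by auto
  show "AE x in lborel. 0 \<le> u t x" by simp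
  show "AE x in lborel. u t x = mixed_semigroup \<sigma> t u0 x +
      (LINT s:{0..t}|lborel. mixed_semigroup \<sigma> (t - s) (\<lambda>y. h s * u s y powr p) x)"
    using t bd by (intro AE_I2 U_mild_equation) auto
  show "((\<lambda>s. Linf_norm (\<lambda>x. u s x - u t x)) \<longlongrightarrow> 0) (at t within {s. 0 \<le> s \<and> ereal s < T})"
    unfolding tendsto_at_iff_sequentially
  proof (intro allI impI)
    fix X assume X: "\<forall>i. X i \<in> {s. 0 \<le> s \<and> ereal s < T} - {t}" "X \<longlonglongrightarrow> t"
    have "(\<lambda>n. Linf_norm (\<lambda>x. u (X n) x - u t x)) \<longlonglongrightarrow> 0"
    proof (rule tendsto_Linf_zeroI)
      fix e :: real assume e: "0 < e"
      \<comment> \<open>The truncated sequence respects the bound \<open>b\<close> for every index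
        and eventually coincides with \<open>X\<close>.\<close>
      let ?Y = "\<lambda>n. min (X n) b"
      have "?Y \<longlonglongrightarrow> min t b" by (intro tendsto_intros X)
      then have "?Y \<longlonglongrightarrow> t" using b by simp
      then have "\<forall>\<^sub>F n in sequentially. \<forall>x. \<bar>u (?Y n) x - u t x\<bar> \<le> e"
        using X(1) t b e by (intro U_time_continuous[OF bdb]) auto
      moreover have "\<forall>\<^sub>F n in sequentially. X n < b"
        using X(2) b(1) by (rule order_tendstoD)
      ultimately show "\<forall>\<^sub>F n in sequentially. Linf_norm (\<lambda>x. u (X n) x - u t x) \<le> ereal e"
        by eventually_elim (auto intro!: Linf_norm_le)
    qed
    then show "((\<lambda>s. Linf_norm (\<lambda>x. u s x - u t x)) \<circ> X) \<longlonglongrightarrow> 0" by (simp add: comp_def)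
  qed
qed

text \<open>A continuous curve over a compact interval is bounded. The argument is by sequences: at
  a limit point of times with growing norm, continuity already bounds the norm nearby.\<close>

lemma mild_solution_bounded:
  assumes v: "mild T v" and b: "0 \<le> b" "ereal b < T"
  obtains B where "0 \<le> B" "\<And>t. 0 \<le> t \<Longrightarrow> t \<le> b \<Longrightarrow> AE x in lborel. \<bar>v t x\<bar> \<le> B"
proof -
  have "\<exists>n. \<forall>t. 0 \<le> t \<and> t \<le> b \<longrightarrow> (AE x in lborel. \<bar>v t x\<bar> \<le> real n)"
  proof (rule ccontr)
    assume "\<not> ?thesis"
    then obtain t where t: "\<And>n. 0 \<le> t n \<and> t n \<le> b \<and> \<not> (AE x in lborel. \<bar>v (t n) x\<bar> \<le> real n)"
      by metis
    have "seq_compact {0..b}" using compact_Icc compact_imp_seq_compact by blast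
    then obtain l r where l: "l \<in> {0..b}" and r: "strict_mono r" and lim: "(t \<circ> r) \<longlonglongrightarrow> l"
      using t by (auto elim!: seq_compactE[where f=t])
    have lT: "0 \<le> l \<and> ereal l < T" using l b by (auto intro: le_less_trans[of _ "ereal b"])
    have inL: "in_Linf (v l)"
      and tend: "((\<lambda>s. Linf_norm (\<lambda>x. v s x - v l x)) \<longlongrightarrow> 0) (at l within {s. 0 \<le> s \<and> ereal s < T})"
      using v lT unfolding mild_solution_def by blast+
    obtain N where N: "Linf_norm (v l) \<le> ereal N"
      using inL Linf_norm_nonneg[of "v l"] unfolding in_Linf_def by (cases "Linf_norm (v l)") auto
    have "\<forall>\<^sub>F s in at l within {s. 0 \<le> s \<and> ereal s < T}. Linf_norm (\<lambda>x. v s x - v l x) < 1"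
      using tend by (rule order_tendstoD) simp
    then obtain d where d: "0 < d" "\<And>s. 0 \<le> s \<Longrightarrow> ereal s < T \<Longrightarrow> s \<noteq> l \<Longrightarrow> dist s l < d \<Longrightarrow> Linf_norm (\<lambda>x. v s x - v l x) < 1"
      unfolding eventually_at by blast
    have near: "AE x in lborel. \<bar>v s x\<bar> \<le> N + 1" if s: "0 \<le> s" "ereal s < T" "dist s l < d" for s
    proof -
      have "AE x in lborel. \<bar>v s x - v l x\<bar> \<le> 1"
      proof (cases "s = l")
        case False
        then have "Linf_norm (\<lambda>x. v s x - v l x) \<le> ereal 1" using d(2)[of s] s by (simp add: one_ereal_def less_imp_le)
        then show ?thesis by (rule AE_le_Linf_norm)
      qed simp
      with AE_le_Linf_norm[OF N] show ?thesis by eventually_elim linarith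
    qed
    have "\<forall>\<^sub>F n in sequentially. dist ((t \<circ> r) n) l < d" using lim d(1) by (rule tendstoD)
    moreover have "\<forall>\<^sub>F n in sequentially. N + 1 \<le> real n"
      using eventually_ge_at_top[of "nat \<lceil>N + 1\<rceil>"] by (rule eventually_mono) linarith
    ultimately have "\<forall>\<^sub>F n in sequentially. False"
    proof eventually_elim
      case (elim n)
      have "N + 1 \<le> real (r n)" using elim(2) seq_suble[OF r, of n] by linarith
      moreover have "AE x in lborel. \<bar>v (t (r n)) x\<bar> \<le> N + 1"
        using t[of "r n"] elim(1) b by (intro near) (auto intro: le_less_trans[of _ "ereal b"])
      ultimately have "AE x in lborel. \<bar>v (t (r n)) x\<bar> \<le> real (r n)"
        by (auto elim!: eventually_mono)
      then show False using t by blast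
    qed
    then show False by simp
  qed
  then obtain n where "\<forall>t. 0 \<le> t \<and> t \<le> b \<longrightarrow> (AE x in lborel. \<bar>v t x\<bar> \<le> real n)" by blast
  then show thesis by (intro that[of "real n"]) auto
qed

text \<open>\<open>v\<close> is not assumed jointly measurable, so measurability of the Duhamel integrand in time has
  to come from continuity.\<close>
lemma mild_solution_integrand_measurable:
  assumes v: "mild T v" and t: "0 \<le> t" "ereal t < T"
  shows "(\<lambda>s. indicator {0..<t} s * (LINT y|lborel. K (t - s) (x - y) * (h s * v s y powr p))) \<in> borel_measurable borel"
proof -
  obtain B where B: "0 \<le> B" "\<And>s. 0 \<le> s \<Longrightarrow> s \<le> t \<Longrightarrow> AE x in lborel. \<bar>v s x\<bar> \<le> B"
    using mild_solution_bounded[OF v t] by blast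
  obtain H where H: "0 \<le> H" "\<And>s. 0 \<le> s \<Longrightarrow> s \<le> t \<Longrightarrow> h s \<le> H" using h_bounded[of 0 t] by blast
  define C where "C = H * B powr p"
  have C: "0 \<le> C" using H(1) by (simp add: C_def)
  have sT: "ereal s < T" if "s \<le> t" for s using that t by (auto intro: le_less_trans[of _ "ereal t"])
  have vm: "v s \<in> borel_measurable borel" and v0: "AE x in lborel. 0 \<le> v s x"
    and vc: "((\<lambda>r. Linf_norm (\<lambda>x. v r x - v s x)) \<longlongrightarrow> 0) (at s within {r. 0 \<le> r \<and> ereal r < T})"
    if "0 \<le> s" "s \<le> t" for s
    using v that sT[of s] unfolding mild_solution_def in_Linf_def by auto
  let ?g = "\<lambda>s y. h s * v s y powr p"
  let ?F = "\<lambda>s. LINT y|lborel. K (t - s) (x - y) * ?g s y"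
  have gm: "?g s \<in> borel_measurable borel" if "0 \<le> s" "s \<le> t" for s
  proof -
    note [measurable] = vm[OF that]
    show ?thesis by measurable
  qed
  have gbd: "AE y in lborel. \<bar>?g s y\<bar> \<le> C" if s: "0 \<le> s" "s \<le> t" for s
    using B(2)[OF s] v0[OF s]
  proof eventually_elim
    case (elim y)
    then have "v s y powr p \<le> B powr p" using p by (intro powr_mono2) auto
    then have "h s * v s y powr p \<le> C" unfolding C_def using H s by (intro mult_mono) auto
    then show ?case by (simp add: h_nonneg)
  qed
  let ?G = "\<lambda>(s, r). h s * r powr p"
  \<comment> \<open>Carries the continuity of \<open>v\<close> in L^infinity over to the source,
    uniformly for almost every \<open>y\<close>.\<close>
  have uc: "uniformly_continuous_on ({0..t} \<times> {0..B}) ?G"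
  proof (rule compact_uniformly_continuous)
    have "continuous_on ({0..t} \<times> {0..B}) (\<lambda>z. h (fst z) * snd z powr p)"
      using p by (intro continuous_intros continuous_on_compose2[OF h_cont] continuous_on_powr') auto
    then show "continuous_on ({0..t} \<times> {0..B}) ?G" by (simp add: case_prod_beta')
  qed (intro compact_Times compact_Icc)
  have "continuous_on {0..<t} ?F"
    unfolding continuous_on_sequentially
  proof (intro allI ballI impI)
    fix X s assume s: "s \<in> {0..<t}" and X: "(\<forall>n. X n \<in> {0..<t}) \<and> X \<longlonglongrightarrow> s"
    show "(?F \<circ> X) \<longlonglongrightarrow> ?F s"
    proof (rule metric_LIMSEQ_I)
      fix e :: real assume e: "0 < e"
      obtain d where d: "0 < d" "\<And>z z'. z \<in> {0..t} \<times> {0..B} \<Longrightarrow> z' \<in> {0..t} \<times> {0..B} \<Longrightarrow> dist z' z < d \<Longrightarrow> dist (?G z') (?G z) < e / 2"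
        using uniformly_continuous_onE[OF uc half_gt_zero[OF e]] by blast
      have "\<forall>\<^sub>F r in at s within {r. 0 \<le> r \<and> ereal r < T}. Linf_norm (\<lambda>x. v r x - v s x) < ereal (d / 3)"
        using vc[of s] s d(1) by (intro order_tendstoD) auto
      then obtain d' where d': "0 < d'" "\<And>r. 0 \<le> r \<Longrightarrow> ereal r < T \<Longrightarrow> r \<noteq> s \<Longrightarrow> dist r s < d' \<Longrightarrow> Linf_norm (\<lambda>x. v r x - v s x) < ereal (d / 3)"
        unfolding eventually_at by blast
      have "(\<lambda>n. kdist (t - X n) (t - s)) \<longlonglongrightarrow> 0"
        using s X by (intro K_L1_continuous tendsto_diff tendsto_const) auto
      then have "\<forall>\<^sub>F n in sequentially. (kdist (t - X n) (t - s)) < ennreal (e / (2 * (C + 1)))"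
        using e C by (intro order_tendstoD(2)) auto
      moreover have "\<forall>\<^sub>F n in sequentially. dist (X n) s < min d' (d / 3)"
        using X d d' by (intro tendstoD) auto
      ultimately have "\<forall>\<^sub>F n in sequentially. dist ((?F \<circ> X) n) (?F s) < e"
      proof eventually_elim
        case (elim n)
        let ?r = "X n"
        have r: "0 \<le> ?r" "?r < t" using X by auto
        have s': "0 \<le> s" "s < t" using s by auto
        have "AE y in lborel. \<bar>v ?r y - v s y\<bar> \<le> d / 3"
        proof (cases "?r = s")
          case False
          then have "Linf_norm (\<lambda>x. v ?r x - v s x) < ereal (d / 3)"
            using r elim sT[of ?r] by (intro d'(2)) simp_all
          then show ?thesis by (intro AE_le_Linf_norm less_imp_le)
        qed (use d in simp)
        moreover have "AE y in lborel. \<bar>v ?r y\<bar> \<le> B" "AE y in lborel. \<bar>v s y\<bar> \<le> B"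
          "AE y in lborel. 0 \<le> v ?r y" "AE y in lborel. 0 \<le> v s y"
          using B(2)[of ?r] B(2)[of s] v0[of ?r] v0[of s] r s' by auto
        ultimately have gd: "AE y in lborel. \<bar>?g ?r y - ?g s y\<bar> \<le> e / 2"
        proof eventually_elim
          case el: (elim y)
          have "dist (?r, v ?r y) (s, v s y) \<le> dist ?r s + dist (v ?r y) (v s y)"
            unfolding dist_Pair_Pair by (rule sqrt_sum_squares_le_sum) auto
          also have "\<dots> < d" using elim el d(1) by (simp add: dist_real_def)
          finally have "dist (?G (?r, v ?r y)) (?G (s, v s y)) < e / 2"
            using el r s' by (intro d(2)) auto
          then show ?case by (simp add: dist_real_def)
        qed
        have m: "?g ?r \<in> borel_measurable borel" "?g s \<in> borel_measurable borel"
          "AE y in lborel. \<bar>?g ?r y\<bar> \<le> C" "AE y in lborel. \<bar>?g s y\<bar> \<le> C"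
          using r s' gm[of ?r] gm[of s] gbd[of ?r] gbd[of s] by auto
        have \<eta>: "0 \<le> e / (2 * (C + 1))" using e C by simp
        have "\<bar>?F ?r - ?F s\<bar> \<le> C * (e / (2 * (C + 1))) + e / 2"
          by (rule K_integral_diff_le[OF _ _ C m gd less_imp_le[OF elim(1)] \<eta>]) (use r s' in auto)
        also have "C * (e / (2 * (C + 1))) < e / 2" using C e by (simp add: field_simps)
        finally show ?case by (simp add: dist_real_def)
      qed
      then show "\<exists>no. \<forall>n\<ge>no. dist ((?F \<circ> X) n) (?F s) < e" by (simp add: eventually_sequentially)
    qed
  qed
  from borel_measurable_continuous_on_indicator[OF _ this] show ?thesis by simp
qed

text \<open>Minimality of \<open>U\<close> among all mild solutions replaces a uniqueness theorem.\<close>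
lemma mild_solution_imp_bounded_upto:
  assumes v: "mild T v" and b: "0 \<le> b" "ereal b < T"
  shows "bounded_upto b"
proof -
  obtain B where B: "0 \<le> B" "\<And>t. 0 \<le> t \<Longrightarrow> t \<le> b \<Longrightarrow> AE x in lborel. \<bar>v t x\<bar> \<le> B"
    using mild_solution_bounded[OF v b] by blast
  obtain H where H: "0 \<le> H" "\<And>s. 0 \<le> s \<Longrightarrow> s \<le> b \<Longrightarrow> h s \<le> H" using h_bounded[of 0 b] by blast
  have vb: "v s \<in> borel_measurable borel" "AE x in lborel. 0 \<le> v s x"
    "AE x in lborel. v s x = mixed_semigroup \<sigma> s u0 x +
       (LINT r:{0..s}|lborel. mixed_semigroup \<sigma> (s - r) (\<lambda>y. h r * v r y powr p) x)"
    if "0 \<le> s" "s \<le> b" for s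
    using v that b le_less_trans[of "ereal s" "ereal b" T] unfolding mild_solution_def in_Linf_def by auto
  define W where "W = (\<lambda>t x. ennreal (v t x))"
  have "AE x in lborel. Phi W t x \<le> W t x" if t: "0 \<le> t" "t \<le> b" for t
    using vb(3)[OF t]
  proof eventually_elim
    case (elim x)
    let ?g = "\<lambda>s y. h s * v s y powr p"
    have g: "AE y in lborel. 0 \<le> ?g s y \<and> ?g s y \<le> H * B powr p" if s: "0 \<le> s" "s < t" for s
    proof -
      have s': "0 \<le> s" "s \<le> b" using s t by auto
      show ?thesis using B(2)[OF s'] vb(2)[OF s']
      proof eventually_elim
        case (elim y)
        then have "v s y powr p \<le> B powr p" using p by (intro powr_mono2) auto
        then have "h s * v s y powr p \<le> H * B powr p" using H s' by (intro mult_mono) auto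
        then show ?case by (simp add: h_nonneg)
      qed
    qed
    have gm: "?g s \<in> borel_measurable borel" if "0 \<le> s" "s < t" for s
    proof -
      have [measurable]: "v s \<in> borel_measurable borel" using vb(1)[of s] that t by simp
      show ?thesis by measurable
    qed
    have tT: "ereal t < T" using t b by (auto intro: le_less_trans[of _ "ereal b"])
    note m = mild_solution_integrand_measurable[OF v t(1) tT, of x]
    \<comment> \<open>The two sources are guaranteed to agree only where \<open>v s y\<close> is
      nonnegative, which holds for almost every \<open>y\<close> at each \<open>s\<close>.\<close>
    have "duhamel 0 (src W) t x \<le> duhamel 0 (\<lambda>s y. ennreal (?g s y)) t x"
    proof (rule duhamel_mono_AE)
      fix s assume s: "0 < s" "s < t"
      then have "AE y in lborel. 0 \<le> v s y" using vb(2)[of s] t by simp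
      then show "AE y in lborel. src W s y \<le> ennreal (?g s y)"
        by (rule eventually_mono) (simp add: src_def W_def ennreal_mult h_nonneg)
    qed
    also have "\<dots> = ennreal (source ?g t x)"
      by (rule duhamel_eq_integral[OF t(1) gm g m])
    finally have "Phi W t x \<le> ennreal (mixed_semigroup \<sigma> t u0 x) + ennreal (source ?g t x)"
      unfolding Phi_def S_U0(1)[OF t(1)] by (rule add_left_mono)
    also have "\<dots> = W t x"
      unfolding W_def elim
      using S_U0(2)[OF t(1), of x] duhamel_integral_nonneg[OF t(1) gm g m] by simp
    finally show ?case .
  qed
  then have UW: "AE x in lborel. U s x \<le> W s x" if "0 \<le> s" "s \<le> b" for s
    using that by (intro U_le_supersolution[of b])
  show ?thesis
  proof (rule bounded_uptoI[OF _ B(1)])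
    fix s assume s: "0 \<le> s" "s \<le> b"
    from UW[OF s] B(2)[OF s] show "AE x in lborel. U s x \<le> ennreal B"
    proof eventually_elim
      case (elim x)
      then show ?case unfolding W_def by (elim order_trans) (auto intro!: ennreal_leI)
    qed
  qed
qed

lemma global_not_blow_up:
  assumes "\<And>b. bounded_upto b"
  shows "\<not> blowup"
proof
  assume "blowup"
  then obtain T w where T: "maximal_mild_solution \<sigma> h (\<lambda>r. r powr p) u0 T w" "T < \<infinity>"
    unfolding blows_up_in_finite_time_def by blast
  have "mild \<infinity> u"
    using assms by (intro mild_solution_U) auto
  then have "\<infinity> \<le> T" using T(1) unfolding maximal_mild_solution_def by blast
  then show False using T(2) by simp
qed

text \<open>The step length depends only on the size \<open>M\<close> and, through the maximum of
  \<open>h\<close>, on the horizon \<open>c\<close>. Raising \<open>M\<close> to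
  \<open>M + 1\<close> keeps it positive for \<open>M = 0\<close>, and capping it at 1 keeps all
  times below \<open>c + 1\<close>.\<close>

lemma bounded_upto_extend_uniform:
  assumes M: "0 \<le> M" and c: "0 \<le> c"
  obtains \<delta> where "0 < \<delta>" "\<And>t. 0 \<le> t \<Longrightarrow> t \<le> c \<Longrightarrow> bounded_upto t \<Longrightarrow>
    AE x in lborel. U t x \<le> ennreal M \<Longrightarrow> bounded_upto (t + \<delta>)"
proof -
  obtain H where H: "0 \<le> H" "\<And>s. 0 \<le> s \<Longrightarrow> s \<le> c + 1 \<Longrightarrow> h s \<le> H" using h_bounded[of 0 "c + 1"] by blast
  define M' where "M' = M + 1"
  define L where "L = H * (2 * M') powr p"
  have L: "0 \<le> L" using H(1) by (simp add: L_def)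
  define \<delta> where "\<delta> = min 1 (M' / (L + 1))"
  have M': "0 < M'" using M by (simp add: M'_def)
  have \<delta>: "0 < \<delta>" "\<delta> \<le> 1" using L M' by (auto simp: \<delta>_def)
  have "\<delta> * L \<le> M' / (L + 1) * L" using L by (intro mult_right_mono) (auto simp: \<delta>_def)
  also have "\<dots> \<le> M'" using L M' by (simp add: field_simps)
  finally have \<delta>L: "\<delta> * L \<le> M'" .
  show thesis
  proof (rule that[OF \<delta>(1)])
    fix t assume t: "0 \<le> t" "t \<le> c" "bounded_upto t" "AE x in lborel. U t x \<le> ennreal M"
    have "AE x in lborel. U t x \<le> ennreal M'"
      using t(4) by (rule eventually_mono) (auto simp: M'_def elim!: order_trans intro!: ennreal_leI)
    then show "bounded_upto (t + \<delta>)"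
      using t M' \<delta> \<delta>L H(2) unfolding L_def by (intro bounded_upto_extend[where M=M' and H=H]) auto
  qed
qed

lemma not_global_blow_up:
  assumes b: "\<not> bounded_upto b"
  shows "blowup"
proof -
  define A where "A = {t. 0 \<le> t \<and> bounded_upto t}"
  have Ab: "t < b" if "t \<in> A" for t
    using that b bounded_upto_mono[of t b] by (force simp: A_def)
  have A0: "0 \<in> A" using bounded_upto_0 by (simp add: A_def)
  have bdd: "bdd_above A" using Ab by (intro bdd_aboveI[of _ b]) (auto intro: less_imp_le)
  define T where "T = Sup A"
  have AT: "t \<le> T" if "t \<in> A" for t unfolding T_def using that bdd by (rule cSup_upper)
  have T0: "0 \<le> T" using AT[OF A0] .
  have below: "bounded_upto t" if "t < T" for t
  proof -
    have "t < Sup A" using that by (simp add: T_def)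
    then obtain a where "a \<in> A" "t < a" using A0 by (auto elim: less_cSupE)
    then show ?thesis by (auto simp: A_def intro: bounded_upto_mono)
  qed
  have Linf_iff: "AE x in lborel. U t x \<le> ennreal M"
    if t: "0 \<le> t" "bounded_upto t" and M: "0 \<le> M" "Linf_norm (u t) \<le> ereal M" for t M
  proof -
    obtain B where B: "\<And>s x. 0 \<le> s \<Longrightarrow> s \<le> t \<Longrightarrow> U s x \<le> ennreal B"
      using t(2) unfolding bounded_upto_def by blast
    show ?thesis using AE_le_Linf_norm[OF M(2)]
    proof (rule eventually_mono)
      fix x assume "\<bar>u t x\<bar> \<le> M"
      moreover have "U t x < \<top>" using le_less_trans[OF B[OF t(1) order_refl] ennreal_less_top] .
      ultimately show "U t x \<le> ennreal M"
        by (metis abs_le_D1 ennreal_enn2real ennreal_leI)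
    qed
  qed
  have Tpos: "0 < T"
  proof -
    obtain B where B: "0 \<le> B" "\<And>s x. 0 \<le> s \<Longrightarrow> s \<le> 0 \<Longrightarrow> U s x \<le> ennreal B"
      using bounded_upto_0 unfolding bounded_upto_def by blast
    obtain \<delta> where "0 < \<delta>" "\<And>t. 0 \<le> t \<Longrightarrow> t \<le> 0 \<Longrightarrow> bounded_upto t \<Longrightarrow>
      AE x in lborel. U t x \<le> ennreal B \<Longrightarrow> bounded_upto (t + \<delta>)"
      using bounded_upto_extend_uniform[OF B(1) order_refl] by blast
    then have "\<delta> \<in> A" using bounded_upto_0 B(2) by (force simp: A_def)
    then show ?thesis using AT \<open>0 < \<delta>\<close> by (meson less_le_trans)
  qed
  have mild: "mild (ereal T) u"
    using Tpos below by (intro mild_solution_U) auto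
  \<comment> \<open>A longer mild solution would dominate \<open>U\<close> up to some
    \<open>c\<close> beyond \<open>T\<close>, against the choice of \<open>T\<close>.\<close>
  have max: "T' \<le> ereal T" if "mild T' w" for T' w
  proof (rule ccontr)
    assume "\<not> T' \<le> ereal T"
    then obtain c where c: "T < c" "ereal c < T'"
      using ereal_dense2[of "ereal T" T'] by (auto simp: not_le)
    then have "c \<in> A" using mild_solution_imp_bounded_upto[OF that, of c] T0 by (simp add: A_def)
    then show False using AT c by force
  qed
  have "((\<lambda>t. Linf_norm (u t)) \<longlongrightarrow> \<infinity>) (at_left T)"
    unfolding tendsto_PInfty
  proof
    fix r :: real
    define M where "M = max r 0"
    have M: "0 \<le> M" "r \<le> M" by (auto simp: M_def)
    obtain \<delta> where \<delta>: "0 < \<delta>" "\<And>t. 0 \<le> t \<Longrightarrow> t \<le> T \<Longrightarrow> bounded_upto t \<Longrightarrow>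
      AE x in lborel. U t x \<le> ennreal M \<Longrightarrow> bounded_upto (t + \<delta>)"
      using bounded_upto_extend_uniform[OF M(1) T0] by blast
    \<comment> \<open>A norm of at most \<open>r\<close> this close to \<open>T\<close> would allow
      a continuation to \<open>t + \<delta>\<close>, past \<open>T\<close>. So the norm tends to
      infinity and is not merely unbounded.\<close>
    have "ereal r < Linf_norm (u t)" if t: "max 0 (T - \<delta>) < t" "t < T" for t
    proof (rule ccontr)
      assume "\<not> ereal r < Linf_norm (u t)"
      then have "Linf_norm (u t) \<le> ereal M" using M(2) by (meson ereal_less_eq(3) not_less order_trans)
      then have "bounded_upto (t + \<delta>)" using t below[of t] M(1) by (intro \<delta>(2) Linf_iff) auto
      then have "t + \<delta> \<in> A" using t \<delta> by (simp add: A_def)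
      then show False using AT t by force
    qed
    moreover have "\<forall>\<^sub>F t in at_left T. t \<in> {max 0 (T - \<delta>)<..<T}"
      using Tpos \<delta>(1) by (intro eventually_at_leftI[of "max 0 (T - \<delta>)"]) auto
    ultimately show "\<forall>\<^sub>F t in at_left T. ereal r < Linf_norm (u t)"
      by (auto elim!: eventually_mono)
  qed
  then show ?thesis
    unfolding blows_up_in_finite_time_def maximal_mild_solution_def
    using mild max by (intro exI[of _ "ereal T"] exI[of _ u]) auto
qed

end

section \<open>A bound for the blow-up time\<close>

text \<open>The tangent line of the convex function \<open>r powr p\<close> at \<open>a\<close>,
  obtained from Young's inequality with weights \<open>1 / p\<close> and
  \<open>(p - 1) / p\<close>.\<close>

lemma tangent_powr_le:
  fixes a r p :: real
  assumes p: "1 < p" and a: "0 \<le> a" and r: "0 \<le> r"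
  shows "p * a powr (p - 1) * r \<le> r powr p + (p - 1) * a powr p"
proof (cases "a = 0 \<or> r = 0")
  case True
  then show ?thesis using p a r by auto
next
  case False
  then have a: "0 < a" and r: "0 < r" using a r by auto
  have "(r powr p) powr (1 / p) * (a powr p) powr ((p - 1) / p) \<le> (1 / p) * r powr p + ((p - 1) / p) * a powr p"
    using p a r by (intro Youngs_inequality_0) (auto simp: field_simps)
  moreover have "(r powr p) powr (1 / p) = r" "(a powr p) powr ((p - 1) / p) = a powr (p - 1)"
    using p a r by (simp_all add: powr_powr)
  ultimately show ?thesis using p by (simp add: field_simps)
qed

text \<open>For \<open>y = g0 + \<integral> h y^p\<close> the quantity \<open>y powr (1 - p) + (p - 1) \<integral> h\<close> is constant.\<close>
lemma blow_up_time_bound: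
  fixes F h :: "real \<Rightarrow> real"
  assumes p: "1 < p" and b: "0 \<le> b" and h: "continuous_on {0..b} h" "\<And>s. s \<in> {0..b} \<Longrightarrow> 0 \<le> h s"
    and F: "continuous_on {0..b} F" and g0: "0 < g0"
    and ineq: "\<And>s. s \<in> {0..b} \<Longrightarrow> g0 + integral {0..s} (\<lambda>r. h r * F r powr p) \<le> F s"
    and F0: "\<And>s. s \<in> {0..b} \<Longrightarrow> 0 \<le> F s"
  shows "(p - 1) * integral {0..b} h \<le> g0 powr (1 - p)"
proof (cases "b = 0")
  case True
  then show ?thesis by simp
next
  case False
  then have b: "0 < b" using b by simp
  define \<phi> where "\<phi> = (\<lambda>r. h r * F r powr p)"
  have \<phi>: "continuous_on {0..b} \<phi>"
    unfolding \<phi>_def using p F0 by (intro continuous_intros h F continuous_on_powr') auto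
  have \<phi>0: "0 \<le> \<phi> r" if "r \<in> {0..b}" for r using h(2)[OF that] by (simp add: \<phi>_def)
  define H where "H = (\<lambda>s. g0 + integral {0..s} \<phi>)"
  have Hpos: "g0 \<le> H s" if "s \<in> {0..b}" for s
  proof -
    have "\<phi> integrable_on {0..s}"
      by (intro integrable_continuous_interval continuous_on_subset[OF \<phi>]) (use that in auto)
    then have "0 \<le> integral {0..s} \<phi>"
      by (rule integral_nonneg) (use \<phi>0 that in auto)
    then show ?thesis by (simp add: H_def)
  qed
  have HF: "H s \<le> F s" if "s \<in> {0..b}" for s using ineq[OF that] by (simp add: H_def \<phi>_def)
  define Q where "Q = (\<lambda>s. H s powr (1 - p) + (p - 1) * integral {0..s} h)"
  have dI: "((\<lambda>x. integral {0..x} f) has_real_derivative f s) (at s within {0..b})"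
    if "continuous_on {0..b} f" "s \<in> {0..b}" for f s
    by (rule integral_has_real_derivative[OF that])
  have dH: "(H has_real_derivative \<phi> s) (at s within {0..b})" if "s \<in> {0..b}" for s
    unfolding H_def using DERIV_add[OF DERIV_const dI[OF \<phi> that], of g0] by simp
  have dQ: "(Q has_real_derivative ((1 - p) * H s powr (- p) * \<phi> s + (p - 1) * h s)) (at s within {0..b})"
    if s: "s \<in> {0..b}" for s
  proof -
    have "0 < H s" using Hpos[OF s] g0 by simp
    from DERIV_add[OF DERIV_chain2[OF has_real_derivative_powr[OF this, of "1 - p"] dH[OF s]]
        DERIV_cmult[OF dI[OF h(1) s], of "p - 1"]]
    show ?thesis unfolding Q_def by simp
  qed
  \<comment> \<open>As \<open>F\<close> lies above \<open>H\<close>, the derivative of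
    \<open>H\<close> is at least \<open>h * H powr p\<close>; this makes the derivative of
    \<open>Q\<close> nonpositive.\<close>
  have "Q b \<le> Q 0"
  proof (rule DERIV_nonpos_imp_decreasing_open[OF less_imp_le[OF b]])
    fix s assume s: "0 < s" "s < b"
    then have s': "s \<in> {0..b}" by simp
    have "0 < H s" using Hpos[OF s'] g0 by simp
    then have "1 = H s powr (- p + p)" by simp
    also have "\<dots> = H s powr (- p) * H s powr p" by (rule powr_add)
    also have "\<dots> \<le> H s powr (- p) * F s powr p"
      using HF[OF s'] \<open>0 < H s\<close> p by (intro mult_left_mono powr_mono2) auto
    finally have "h s * 1 \<le> h s * (H s powr (- p) * F s powr p)"
      by (rule mult_left_mono[OF _ h(2)[OF s']])
    then have "(p - 1) * h s \<le> (p - 1) * (H s powr (- p) * \<phi> s)"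
      using p by (intro mult_left_mono) (simp_all add: \<phi>_def mult.left_commute)
    then have "(1 - p) * H s powr (- p) * \<phi> s + (p - 1) * h s \<le> 0" by (simp add: algebra_simps)
    moreover have "(Q has_real_derivative ((1 - p) * H s powr (- p) * \<phi> s + (p - 1) * h s)) (at s)"
      using dQ[OF s'] s by (simp add: at_within_Icc_at)
    ultimately show "\<exists>y. (Q has_real_derivative y) (at s) \<and> y \<le> 0" by blast
  next
    show "continuous_on {0..b} Q" using dQ by (rule DERIV_continuous_on)
  qed
  then have "H b powr (1 - p) + (p - 1) * integral {0..b} h \<le> g0 powr (1 - p)"
    by (simp add: Q_def H_def)
  then show ?thesis using powr_ge_zero[of "H b" "1 - p"] by linarith
qed

context heat_semigroup
begin

text \<open>The tangent inequality at the mean \<open>a\<close> is averaged against the kernel, a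
  probability density. The bound \<open>B\<close> keeps \<open>a\<close> finite, so that it is a
  legitimate point of tangency.\<close>

lemma S_jensen:
  assumes t: "0 < t" and p: "1 < p" and [measurable]: "\<phi> \<in> borel_measurable borel"
    and bd: "\<And>y. \<phi> y \<le> ennreal B"
  shows "ennpow p (S t \<phi> x) \<le> S t (\<lambda>y. ennpow p (\<phi> y)) x"
proof -
  have "S t \<phi> x \<le> ennreal B" by (rule S_le[OF bd])
  then have "S t \<phi> x < \<top>" using ennreal_less_top by (rule le_less_trans)
  then obtain a where a: "0 \<le> a" "S t \<phi> x = ennreal a" by (cases "S t \<phi> x") auto
  have pt: "ennreal (p * a powr (p - 1)) * \<phi> y \<le> ennpow p (\<phi> y) + ennreal ((p - 1) * a powr p)" for y
  proof -
    have "\<phi> y < \<top>" using bd ennreal_less_top by (rule le_less_trans)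
    then obtain r where r: "0 \<le> r" "\<phi> y = ennreal r" by (cases "\<phi> y") auto
    show ?thesis using tangent_powr_le[OF p a(1) r(1)] p
      by (simp add: r ennreal_mult[symmetric] ennreal_plus[symmetric] ennreal_leI del: ennreal_plus)
  qed
  have "ennreal (p * a powr (p - 1)) * S t \<phi> x = S t (\<lambda>y. ennreal (p * a powr (p - 1)) * \<phi> y) x"
    using t by (simp add: S_def nn_integral_cmult[symmetric] mult_ac)
  also have "\<dots> \<le> S t (\<lambda>y. ennpow p (\<phi> y) + ennreal ((p - 1) * a powr p)) x"
    by (intro S_mono pt)
  also have "\<dots> = S t (\<lambda>y. ennpow p (\<phi> y)) x + S t (\<lambda>y. ennreal ((p - 1) * a powr p)) x"
    by (rule S_add) measurable
  also have "\<dots> \<le> S t (\<lambda>y. ennpow p (\<phi> y)) x + ennreal ((p - 1) * a powr p)"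
    by (intro add_left_mono S_le) simp
  finally have *: "ennreal (p * a powr p) \<le> S t (\<lambda>y. ennpow p (\<phi> y)) x + ennreal ((p - 1) * a powr p)"
  proof -
    assume "ennreal (p * a powr (p - 1)) * S t \<phi> x \<le> S t (\<lambda>y. ennpow p (\<phi> y)) x + ennreal ((p - 1) * a powr p)"
    moreover have "a powr (p - 1) * a = a powr p"
      using a(1) p powr_add[of a "p - 1" 1] by (cases "a = 0") auto
    ultimately show ?thesis using a p by (simp add: ennreal_mult[symmetric] mult.assoc)
  qed
  show ?thesis
  proof (cases "S t (\<lambda>y. ennpow p (\<phi> y)) x")
    case (real z)
    then have "p * a powr p \<le> z + (p - 1) * a powr p"
      using * p by (simp add: ennreal_plus[symmetric] del: ennreal_plus)
    then show ?thesis using a real by (simp add: algebra_simps ennreal_leI)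
  qed simp
qed

end

context minimal_solution
begin

text \<open>The state at time \<open>s\<close> is transported to the fixed final time \<tau>. By
  Jensen's inequality the resulting number \<open>g s\<close> satisfies the scalar inequality
  \<open>g s \<ge> g 0 + (\<integral>\<^sub>0\<^sup>s h * g powr p)\<close>.\<close>

lemma S_U_lower:
  assumes s: "0 \<le> s" "s < \<tau>" and bd: "bounded_upto s"
  shows "S \<tau> U0 x + (\<integral>\<^sup>+r. indicator {0<..<s} r * (ennreal (h r) * ennpow p (S (\<tau> - r) (U r) x)) \<partial>lborel)
    \<le> S (\<tau> - s) (U s) x"
proof -
  obtain B where B: "\<And>r y. 0 \<le> r \<Longrightarrow> r \<le> s \<Longrightarrow> U r y \<le> ennreal B"
    using bd unfolding bounded_upto_def by blast
  have "U s = (\<lambda>y. S s U0 y + duhamel 0 (src U) s y)" by (simp add: fun_eq_iff U_eq[symmetric])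
  then have "S (\<tau> - s) (U s) x = S (\<tau> - s) (\<lambda>y. S s U0 y + duhamel 0 (src U) s y) x"
    by (rule arg_cong)
  also have "\<dots> = S (\<tau> - s) (S s U0) x + S (\<tau> - s) (duhamel 0 (src U) s) x"
    by (subst S_add) auto
  also have "S (\<tau> - s) (S s U0) x = S \<tau> U0 x" using s by (simp add: S_S)
  also have "S (\<tau> - s) (duhamel 0 (src U) s) x
      = (\<integral>\<^sup>+r. slice {0<..<s} (src U) \<tau> x r \<partial>lborel)"
    using s by (intro S_duhamel src_pair U_pair)
  finally have eq: "S (\<tau> - s) (U s) x = S \<tau> U0 x +
    (\<integral>\<^sup>+r. slice {0<..<s} (src U) \<tau> x r \<partial>lborel)" .
  show ?thesis unfolding eq
  proof (rule add_left_mono)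
    show "(\<integral>\<^sup>+r. indicator {0<..<s} r * (ennreal (h r) * ennpow p (S (\<tau> - r) (U r) x)) \<partial>lborel)
      \<le> (\<integral>\<^sup>+r. slice {0<..<s} (src U) \<tau> x r \<partial>lborel)"
    proof (rule nn_integral_mono)
      fix r
      show "indicator {0<..<s} r * (ennreal (h r) * ennpow p (S (\<tau> - r) (U r) x))
        \<le> slice {0<..<s} (src U) \<tau> x r"
      proof (cases "r \<in> {0<..<s}")
        case True
        then have r: "0 < \<tau> - r" "0 \<le> r" "r \<le> s" using s by auto
        have "ennreal (h r) * ennpow p (S (\<tau> - r) (U r) x) \<le> ennreal (h r) * S (\<tau> - r) (\<lambda>y. ennpow p (U r y)) x"
          using r by (intro mult_left_mono S_jensen[where B=B] p B U_measurable) auto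
        also have "\<dots> = (\<integral>\<^sup>+y. ennreal (K (\<tau> - r) (x - y)) * src U r y \<partial>lborel)"
          using r by (simp add: S_def src_def nn_integral_cmult[symmetric] mult_ac)
        finally show ?thesis using True by simp
      qed simp
    qed
  qed
qed

text \<open>Kaplan's argument: test the solution with the backward heat kernel at a fixed point.\<close>
lemma bounded_upto_imp_mass_bound:
  assumes bd: "bounded_upto \<tau>" and b: "0 \<le> b" "b < \<tau>" and g0: "0 < g0" "ennreal g0 \<le> S \<tau> U0 x"
  shows "(p - 1) * integral {0..b} h \<le> g0 powr (1 - p)"
proof -
  obtain B where B: "0 \<le> B" "\<And>r y. 0 \<le> r \<Longrightarrow> r \<le> \<tau> \<Longrightarrow> U r y \<le> ennreal B"
    using bd unfolding bounded_upto_def by blast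
  define G where "G = (\<lambda>s. S (\<tau> - s) (U s) x)"
  have GB: "G s \<le> ennreal B" if "0 \<le> s" "s \<le> \<tau>" for s
    unfolding G_def by (intro S_le B that)
  have [measurable]: "(\<lambda>s. S (\<tau> - s) (U s) x) \<in> borel_measurable borel"
  proof -
    note [measurable (raw)] = measurable_uncurry[OF U_pair]
    show ?thesis unfolding S_def by measurable
  qed
  define \<gamma> where "\<gamma> = (\<lambda>s. enn2real (G s))"
  have [measurable]: "\<gamma> \<in> borel_measurable borel" unfolding \<gamma>_def G_def by measurable
  have G\<gamma>: "G s = ennreal (\<gamma> s)" if "0 \<le> s" "s \<le> \<tau>" for s
    unfolding \<gamma>_def using le_less_trans[OF GB[OF that] ennreal_less_top] by simp
  have \<gamma>B: "\<gamma> s \<le> B" if "0 \<le> s" "s \<le> \<tau>" for s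
    unfolding \<gamma>_def by (rule enn2real_leI[OF B(1) GB[OF that]])
  have \<gamma>0: "0 \<le> \<gamma> s" for s by (simp add: \<gamma>_def)
  define \<phi> where "\<phi> = (\<lambda>r. h r * \<gamma> r powr p)"
  have [measurable]: "\<phi> \<in> borel_measurable borel" unfolding \<phi>_def by measurable
  have \<phi>0: "0 \<le> \<phi> r" for r by (simp add: \<phi>_def h_nonneg)
  obtain H where H: "0 \<le> H" "\<And>s. 0 \<le> s \<Longrightarrow> s \<le> b \<Longrightarrow> h s \<le> H" using h_bounded[of 0 b] by blast
  have \<phi>B: "\<phi> r \<le> H * B powr p" if "0 \<le> r" "r \<le> b" for r
    unfolding \<phi>_def using that b \<gamma>B[of r] \<gamma>0[of r] H p by (intro mult_mono powr_mono2) auto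
  have \<phi>i: "set_integrable lborel {0..s} \<phi>" if "s \<le> b" for s
    unfolding set_integrable_def
  proof (rule Bochner_Integration.integrable_bound)
    show "integrable lborel (\<lambda>r. (H * B powr p) * indicator {0..s} r)"
      by (intro integrable_mult_right) (simp add: integrable_indicator_iff emeasure_lborel_Icc_eq)
    show "AE r in lborel. norm (indicator {0..s} r *\<^sub>R \<phi> r) \<le> norm ((H * B powr p) * indicator {0..s} r)"
      using \<phi>B \<phi>0 H(1) that by (intro AE_I2) (auto simp: indicator_def)
  qed measurable
  have \<phi>hk: "\<phi> integrable_on {0..s}" "integral {0..s} \<phi> = (LINT r:{0..s}|lborel. \<phi> r)" if "s \<le> b" for s
    using set_borel_integral_eq_integral[OF \<phi>i[OF that]] by auto
  \<comment> \<open>So far \<gamma> is only bounded and measurable, while the scalar lemma wants a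
    continuous function. \<open>F\<close> is continuous, lies below \<gamma>, and therefore inherits
    the inequality.\<close>
  define F where "F = (\<lambda>s. g0 + integral {0..s} \<phi>)"
  have F\<gamma>: "F s \<le> \<gamma> s" if s: "0 \<le> s" "s \<le> b" for s
  proof -
    have s': "s \<le> \<tau>" "s < \<tau>" using s b by auto
    have "ennreal (LINT r:{0..s}|lborel. \<phi> r) = (\<integral>\<^sup>+r. ennreal (indicator {0..s} r * \<phi> r) \<partial>lborel)"
      unfolding set_lebesgue_integral_def real_scaleR_def using \<phi>i[OF s(2)] \<phi>0
      by (intro nn_integral_eq_integral[symmetric]) (auto simp: set_integrable_def)
    also have "\<dots> = (\<integral>\<^sup>+r. indicator {0<..<s} r * (ennreal (h r) * ennpow p (S (\<tau> - r) (U r) x)) \<partial>lborel)"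
    proof (rule nn_integral_cong_AE, use AE_lborel_singleton[of 0] AE_lborel_singleton[of s] in eventually_elim)
      fix r assume r: "r \<noteq> 0" "r \<noteq> s"
      show "ennreal (indicator {0..s} r * \<phi> r) = indicator {0<..<s} r * (ennreal (h r) * ennpow p (S (\<tau> - r) (U r) x))"
      proof (cases "r \<in> {0<..<s}")
        case True
        then have "S (\<tau> - r) (U r) x = ennreal (\<gamma> r)" using G\<gamma>[of r] s' by (simp add: G_def)
        then show ?thesis using True \<gamma>0 by (simp add: \<phi>_def ennreal_mult h_nonneg)
      qed (use r in auto)
    qed
    finally have "ennreal g0 + ennreal (LINT r:{0..s}|lborel. \<phi> r) \<le> G s"
      using S_U_lower[OF s(1) s'(2) bounded_upto_mono[OF bd s'(1)], of x] g0(2)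
      unfolding G_def by (metis (no_types, lifting) add_right_mono order_trans)
    moreover have "0 \<le> (LINT r:{0..s}|lborel. \<phi> r)"
      unfolding set_lebesgue_integral_def using \<phi>0 by (intro Bochner_Integration.integral_nonneg) auto
    ultimately show ?thesis
      unfolding G\<gamma>[OF s(1) s'(1)] F_def \<phi>hk(2)[OF s(2)] using g0(1) \<gamma>0
      by (simp add: ennreal_plus[symmetric] del: ennreal_plus)
  qed
  have F0: "g0 \<le> F s" if "s \<in> {0..b}" for s
    unfolding F_def using integral_nonneg[OF \<phi>hk(1)[of s] \<phi>0] that by simp
  have Fc: "continuous_on {0..b} F"
    unfolding F_def by (intro continuous_intros indefinite_integral_continuous_1 \<phi>hk order_refl)
  have hb: "continuous_on {0..b} h" using h_cont by (rule continuous_on_subset) simp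
  show ?thesis
  proof (rule blow_up_time_bound[OF p b(1) hb h_nonneg Fc g0(1)])
    show "0 \<le> F s" if "s \<in> {0..b}" for s using F0[OF that] g0 by simp
    fix s assume s: "s \<in> {0..b}"
    have "integral {0..s} (\<lambda>r. h r * F r powr p) \<le> integral {0..s} \<phi>"
    proof (rule integral_le)
      show "(\<lambda>r. h r * F r powr p) integrable_on {0..s}"
      proof (rule integrable_continuous_interval)
        have "\<forall>r\<in>{0..s}. F r \<noteq> 0" using F0 g0(1) s by fastforce
        then show "continuous_on {0..s} (\<lambda>r. h r * F r powr p)"
          using s by (intro continuous_intros continuous_on_subset[OF hb] continuous_on_subset[OF Fc]) auto
      qed
      show "\<phi> integrable_on {0..s}" using \<phi>hk s by simp
      fix r assume "r \<in> {0..s}"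
      then show "h r * F r powr p \<le> \<phi> r"
        unfolding \<phi>_def using F\<gamma>[of r] F0[of r] g0(1) s p
        by (intro mult_left_mono powr_mono2 h_nonneg) auto
    qed
    then show "g0 + integral {0..s} (\<lambda>r. h r * F r powr p) \<le> F s" by (simp add: F_def)
  qed
qed

end

section \<open>Blow-up and global existence\<close>

lemma in_C0_bounded:
  fixes v :: "'a::euclidean_space \<Rightarrow> real"
  assumes "in_C0 v"
  obtains B where "\<And>x. \<bar>v x\<bar> \<le> B"
proof -
  have c: "continuous_on UNIV v" and l: "(v \<longlongrightarrow> 0) at_infinity" using assms by (auto simp: in_C0_def)
  obtain R where R: "\<And>x. R \<le> norm x \<Longrightarrow> dist (v x) 0 < 1"
    using tendstoD[OF l zero_less_one] unfolding eventually_at_infinity by blast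
  have "bounded (v ` cball 0 R)"
    by (intro compact_imp_bounded compact_continuous_image continuous_on_subset[OF c]) auto
  then obtain B where B: "\<And>x. norm x \<le> R \<Longrightarrow> \<bar>v x\<bar> \<le> B" by (force simp: bounded_iff)
  have "\<bar>v x\<bar> \<le> max 1 B" for x
    using R[of x] B[of x] by (cases "R \<le> norm x") auto
  then show thesis by (rule that)
qed

lemma in_C0_uniformly_continuous:
  fixes v :: "'a::euclidean_space \<Rightarrow> real"
  assumes "in_C0 v"
  shows "uniformly_continuous_on UNIV v"
  unfolding uniformly_continuous_on_def
proof (intro allI impI)
  fix e :: real assume e: "0 < e"
  have c: "continuous_on UNIV v" and l: "(v \<longlongrightarrow> 0) at_infinity" using assms by (auto simp: in_C0_def)
  obtain R where R: "\<And>x. R \<le> norm x \<Longrightarrow> dist (v x) 0 < e / 2"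
    using tendstoD[OF l, of "e / 2"] e unfolding eventually_at_infinity by auto
  have "uniformly_continuous_on (cball 0 (R + 1)) v"
    by (intro compact_uniformly_continuous continuous_on_subset[OF c]) auto
  then obtain d where d: "0 < d" "\<And>x y. x \<in> cball 0 (R + 1) \<Longrightarrow> y \<in> cball 0 (R + 1) \<Longrightarrow> dist y x < d \<Longrightarrow> dist (v y) (v x) < e"
    using e by (elim uniformly_continuous_onE) blast+
  \<comment> \<open>The collar of width 1 ensures that if one point leaves the larger ball, both lie
    where \<open>v\<close> is small.\<close>
  have "dist (v y) (v x) < e" if xy: "dist y x < min d 1" for x y
  proof (cases "x \<in> cball 0 (R + 1) \<and> y \<in> cball 0 (R + 1)")
    case True
    then show ?thesis using d(2) xy by auto
  next
    case False
    have "\<bar>norm x - norm y\<bar> < 1" using xy norm_triangle_ineq3[of y x]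
      unfolding dist_norm abs_minus_commute[of "norm x"] by linarith
    then have "R \<le> norm x" "R \<le> norm y" using False by auto
    then have "dist (v x) 0 < e / 2" "dist (v y) 0 < e / 2" using R by auto
    then show ?thesis by (simp add: dist_real_def)
  qed
  then show "\<exists>d>0. \<forall>x\<in>UNIV. \<forall>y\<in>UNIV. dist y x < d \<longrightarrow> dist (v y) (v x) < e"
    using d(1) by (intro exI[of _ "min d 1"]) auto
qed

lemma heat_semigroup_mker:
  assumes s: "0 < \<sigma>" "\<sigma> < 1"
  shows "heat_semigroup (mker \<sigma> :: real \<Rightarrow> 'a::euclidean_space \<Rightarrow> real)"
  by (unfold_locales; (rule mker_measurable_pair mker_nonneg[OF s] mker_nn_integral[OF s]
        mker_chapman_kolmogorov[OF s] mker_L1_continuous[OF s] mker_approx_identity[OF s]; assumption?)?)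
     (simp_all add: mker_def)

lemma mild_problem_mker:
  fixes u0 :: "'a::euclidean_space \<Rightarrow> real"
  assumes s: "0 < \<sigma>" "\<sigma> < 1" and p: "1 < p" and u0: "in_C0 u0" "\<And>x. 0 \<le> u0 x"
  shows "mild_problem (mker \<sigma>) (\<lambda>t. exp (\<theta> * t)) p u0 \<sigma>"
proof -
  interpret heat_semigroup "mker \<sigma> :: real \<Rightarrow> 'a \<Rightarrow> real" by (rule heat_semigroup_mker[OF s])
  obtain B where B: "\<And>x. \<bar>u0 x\<bar> \<le> B" using in_C0_bounded[OF u0(1)] by blast
  show ?thesis
  proof unfold_locales
    show "continuous_on UNIV (\<lambda>t. exp (\<theta> * t))" by (intro continuous_intros)
    show "u0 \<in> borel_measurable borel"
      using u0(1) by (intro borel_measurable_continuous_onI) (simp add: in_C0_def)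
    show "\<exists>B. \<forall>x. u0 x \<le> B" using B by (meson abs_le_D1)
    show "uniformly_continuous_on UNIV u0" by (rule in_C0_uniformly_continuous[OF u0(1)])
  qed (use p u0(2) mixed_heat_kernel_eq_mker[OF _ s(1)] in auto)
qed

lemma integral_exp_Icc:
  fixes \<theta> b :: real
  assumes "\<theta> \<noteq> 0" "0 \<le> b"
  shows "integral {0..b} (\<lambda>t. exp (\<theta> * t)) = (exp (\<theta> * b) - 1) / \<theta>"
proof -
  have "((\<lambda>t. exp (\<theta> * t)) has_integral (exp (\<theta> * b) / \<theta> - exp (\<theta> * 0) / \<theta>)) {0..b}"
    using assms by (intro fundamental_theorem_of_calculus)
      (auto intro!: derivative_eq_intros simp flip: has_real_derivative_iff_has_vector_derivative)
  then show ?thesis by (simp add: integral_unique diff_divide_distrib)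
qed

text \<open>The kernel decays slower than any exponential, whereas \<open>\<integral> h\<close> grows exponentially.\<close>
lemma blow_up_of_positive_rate:
  fixes u0 :: "'a::euclidean_space \<Rightarrow> real"
  assumes s: "0 < \<sigma>" "\<sigma> < 1" and p: "1 < p" and \<theta>: "0 < \<theta>"
    and u0: "in_C0 u0" "\<And>x. 0 < u0 x"
  shows "blows_up_in_finite_time \<sigma> (\<lambda>t. exp (\<theta> * t)) (\<lambda>r. r powr p) u0"
proof -
  interpret mild_problem "mker \<sigma>" "\<lambda>t. exp (\<theta> * t)" p u0 \<sigma>
    by (rule mild_problem_mker[OF s p u0(1) less_imp_le[OF u0(2)]])
  \<comment> \<open>Raised to the power \<open>1 - p\<close>, a decay at rate \<open>e\<close>
    becomes growth at rate \<open>\<theta> / 2\<close>, half the growth rate of the integral of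
    \<open>h\<close>.\<close>
  define e where "e = \<theta> / 2 / (p - 1)"
  have e: "0 < e" using p \<theta> by (simp add: e_def)
  have ep: "e * (p - 1) = \<theta> / 2"
    unfolding e_def using p by (intro nonzero_eq_divide_eq[THEN iffD1]) auto
  obtain c t0 where c: "0 < c"
    and lower: "\<And>t x. t0 \<le> t \<Longrightarrow> norm (x :: 'a) \<le> 1 \<Longrightarrow> c * exp (- e * t) \<le> mker \<sigma> t x"
    using mker_lower_bound[OF s e, where 'a='a] by blast
  have cont: "continuous_on (cball 0 1) u0"
    using u0(1) unfolding in_C0_def by (blast intro: continuous_on_subset)
  \<comment> \<open>By compactness a positive datum has a positive minimum on the unit ball, the
    region where the lower bound for the kernel is available.\<close>
  obtain x0 where x0: "\<And>y. y \<in> cball 0 1 \<Longrightarrow> u0 x0 \<le> u0 y"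
    using continuous_attains_inf[OF compact_cball _ cont] by force
  define m where "m = u0 x0"
  have m: "0 < m" using u0(2) by (simp add: m_def)
  define v where "v = measure lborel (cball (0::'a) 1)"
  have v: "0 < v" unfolding v_def using content_cball_pos[of 1 "0::'a"] by simp
  define a where "a = c * m * v"
  have a: "0 < a" using c m v by (simp add: a_def)
  have g: "ennreal (a * exp (- e * t)) \<le> S t U0 0" if t: "t0 \<le> t" "0 < t" for t
  proof -
    have "ennreal (a * exp (- e * t)) = (\<integral>\<^sup>+y. ennreal (c * exp (- e * t) * m) * indicator (cball (0::'a) 1) y \<partial>lborel)"
    proof -
      have "emeasure lborel (cball (0::'a) 1) = ennreal v"
        unfolding v_def using emeasure_lborel_cball_finite[of "0::'a" 1]
        by (intro emeasure_eq_ennreal_measure) simp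
      then have "(\<integral>\<^sup>+y. ennreal (c * exp (- e * t) * m) * indicator (cball (0::'a) 1) y \<partial>lborel)
          = ennreal (c * exp (- e * t) * m) * ennreal v"
        by (subst nn_integral_cmult_indicator) simp_all
      also have "\<dots> = ennreal (c * exp (- e * t) * m * v)"
        using c m v by (intro ennreal_mult[symmetric]) auto
      finally show ?thesis by (simp add: a_def mult_ac)
    qed
    also have "\<dots> \<le> (\<integral>\<^sup>+y. ennreal (mker \<sigma> t (0 - y)) * ennreal (u0 y) \<partial>lborel)"
    proof (rule nn_integral_mono)
      fix y :: 'a
      show "ennreal (c * exp (- e * t) * m) * indicator (cball 0 1) y \<le> ennreal (mker \<sigma> t (0 - y)) * ennreal (u0 y)"
      proof (cases "y \<in> cball 0 1")
        case True
        then have "c * exp (- e * t) * m \<le> mker \<sigma> t (0 - y) * u0 y"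
          using lower[of t "0 - y"] x0[of y] t m c by (intro mult_mono) (auto simp: m_def mker_nonneg[OF s])
        then show ?thesis
          using True by (simp add: ennreal_mult[symmetric] mker_nonneg[OF s] u0_nonneg ennreal_leI)
      qed simp
    qed
    also have "\<dots> = S t U0 0" using t by (simp add: S_def)
    finally show ?thesis .
  qed
  have "\<exists>b. \<not> bounded_upto b"
  proof (rule ccontr)
    assume "\<not> ?thesis"
    then have bd: "bounded_upto b" for b by blast
    \<comment> \<open>Kaplan's bound needs an integration time strictly below the final time;
      stopping at \<open>t - 1\<close> costs only a constant factor in the leading
      exponential.\<close>
    have *: "(p - 1) * ((exp (\<theta> * (t - 1)) - 1) / \<theta>) \<le> a powr (1 - p) * exp (\<theta> / 2 * t)" if t: "max 1 t0 \<le> t" for t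
    proof -
      have "(p - 1) * integral {0..t - 1} (\<lambda>t. exp (\<theta> * t)) \<le> (a * exp (- e * t)) powr (1 - p)"
        using t a by (intro bounded_upto_imp_mass_bound[OF bd _ _ _ g]) auto
      also have "\<dots> = a powr (1 - p) * exp (e * (p - 1) * t)"
        using a by (simp add: powr_mult powr_def[of "exp _"] algebra_simps)
      finally show ?thesis using \<theta> t by (simp add: integral_exp_Icc ep)
    qed
    have "\<forall>\<^sub>F t in at_top. a powr (1 - p) * exp (\<theta> / 2 * t) < (p - 1) * ((exp (\<theta> * (t - 1)) - 1) / \<theta>)"
      using p \<theta> a by real_asymp
    then have "\<forall>\<^sub>F t :: real in at_top. False"
      using eventually_ge_at_top[of "max 1 t0"]
    proof eventually_elim
      case (elim t)
      then show ?case using *[of t] by linarith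
    qed
    then show False by simp
  qed
  then show ?thesis using not_global_blow_up by blast
qed

text \<open>For the constant \<open>2 * \<epsilon>\<close> the free flow contributes at most
  \<epsilon>. The source contributes at most
  \<open>(2 * \<epsilon>) powr p / \<bar>\<theta>\<bar>\<close>, because
  \<open>exp (\<theta> * s)\<close> has integral \<open>1 / \<bar>\<theta>\<bar>\<close> over all
  positive times, and the smallness condition bounds this by \<epsilon> again.\<close>

lemma global_of_negative_rate:
  fixes u0 :: "'a::euclidean_space \<Rightarrow> real"
  assumes s: "0 < \<sigma>" "\<sigma> < 1" and p: "1 < p" and \<theta>: "\<theta> < 0"
    and u0: "in_C0 u0" "\<And>x. 0 \<le> u0 x" "\<And>x. u0 x \<le> \<epsilon>"
    and small: "0 \<le> \<epsilon>" "(2 * \<epsilon>) powr p \<le> \<bar>\<theta>\<bar> * \<epsilon>"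
  shows "\<not> blows_up_in_finite_time \<sigma> (\<lambda>t. exp (\<theta> * t)) (\<lambda>r. r powr p) u0"
proof -
  interpret mild_problem "mker \<sigma>" "\<lambda>t. exp (\<theta> * t)" p u0 \<sigma>
    by (rule mild_problem_mker[OF s p u0(1,2)])
  define W :: "real \<Rightarrow> 'a \<Rightarrow> ennreal" where "W = (\<lambda>_ _. ennreal (2 * \<epsilon>))"
  have super: "Phi W t x \<le> W t x" if t: "0 \<le> t" for t x
  proof -
    define q where "q = (2 * \<epsilon>) powr p"
    have q: "0 \<le> q" by (simp add: q_def)
    have "duhamel 0 (src W) t x \<le> (\<integral>\<^sup>+s. ennreal (exp (\<theta> * s) * q) * indicator {0<..<t} s \<partial>lborel)"
    proof (intro duhamel_le_integral AE_I2)
      have "ennpow p (ennreal (2 * \<epsilon>)) = ennreal q"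
        unfolding q_def using small(1) by (intro ennpow_ennreal) simp
      then show "src W s y \<le> ennreal (exp (\<theta> * s) * q)" for s y
        unfolding src_def W_def using q by (simp only: ennreal_mult exp_ge_zero order_refl)
    qed
    also have "\<dots> \<le> (\<integral>\<^sup>+s. ennreal (exp (\<theta> * s) * q) * indicator {0..t} s \<partial>lborel)"
      by (intro nn_integral_mono) (auto simp: indicator_def)
    also have "\<dots> = ennreal (exp (\<theta> * t) * q / \<theta> - exp (\<theta> * 0) * q / \<theta>)"
      using \<theta> t q by (intro nn_integral_FTC_Icc) (auto intro!: derivative_eq_intros)
    also have "\<dots> \<le> ennreal \<epsilon>"
    proof (rule ennreal_leI)
      have "exp (\<theta> * t) * q / \<theta> - exp (\<theta> * 0) * q / \<theta> = (1 - exp (\<theta> * t)) * q / \<bar>\<theta>\<bar>"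
        using \<theta> by (simp add: field_simps)
      also have "\<dots> \<le> 1 * q / \<bar>\<theta>\<bar>" using q by (intro divide_right_mono mult_right_mono) auto
      also have "\<dots> \<le> \<epsilon>" using small(2) \<theta> by (simp add: q_def field_simps)
      finally show "exp (\<theta> * t) * q / \<theta> - exp (\<theta> * 0) * q / \<theta> \<le> \<epsilon>" .
    qed
    finally have "duhamel 0 (src W) t x \<le> ennreal \<epsilon>" .
    then have "Phi W t x \<le> ennreal \<epsilon> + ennreal \<epsilon>"
      unfolding Phi_def by (intro add_mono S_le ennreal_leI u0(3))
    then show ?thesis using small(1) by (simp add: W_def flip: ennreal_plus)
  qed
  have "bounded_upto b" for b
  proof (rule bounded_uptoI)
    fix r assume "0 \<le> r" "r \<le> b"
    then show "AE x in lborel. U r x \<le> ennreal (2 * \<epsilon>)"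
      using U_le_supersolution[of b W r] super by (simp add: W_def)
  qed (use small(1) in simp)
  then show ?thesis by (rule global_not_blow_up)
qed

lemma
  assumes "0 < \<epsilon>"
  shows gaussian_in_C0: "in_C0 (\<lambda>x::'a::euclidean_space. \<epsilon> * exp (- (norm x)\<^sup>2))" (is ?C)
    and gaussian_integrable: "integrable lborel (\<lambda>x::'a::euclidean_space. \<epsilon> * exp (- (norm x)\<^sup>2))" (is ?I)
proof -
  have "((\<lambda>r::real. \<epsilon> * exp (- r\<^sup>2)) \<longlongrightarrow> 0) at_top" by real_asymp
  then have "((\<lambda>x::'a. \<epsilon> * exp (- (norm x)\<^sup>2)) \<longlongrightarrow> 0) at_infinity"
    using filterlim_at_infinity_imp_norm_at_top[OF filterlim_ident]
    by (rule filterlim_compose)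
  then show ?C unfolding in_C0_def by (auto intro!: continuous_intros)
  show ?I using integrable_exp_norm_sq[of 1, where 'a='a] by simp
qed

theorem corollary1p7:
  fixes \<sigma> \<theta> p :: real
  assumes "0 < \<sigma>" and "\<sigma> < 1" and "\<theta> \<noteq> 0" and "1 < p"
  shows "(\<forall>u0 :: real ^ 'd \<Rightarrow> real.
            in_C0 u0 \<and> integrable lborel u0 \<and> (\<forall>x. 0 < u0 x) \<longrightarrow>
              blows_up_in_finite_time \<sigma> (\<lambda>t. exp (\<theta> * t)) (\<lambda>r. r powr p) u0)
         \<longleftrightarrow> 0 < \<theta>"
    (is "?blowup \<longleftrightarrow> _")
proof
  assume "0 < \<theta>"
  then show ?blowup
    using assms by (auto intro!: blow_up_of_positive_rate)
next
  assume all: ?blowup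
  show "0 < \<theta>"
  proof (rule ccontr)
    assume "\<not> 0 < \<theta>"
    then have \<theta>: "\<theta> < 0" using assms(3) by simp
    \<comment> \<open>The positive solution of
      \<open>(2 * \<epsilon>) powr p = \<bar>\<theta>\<bar> * \<epsilon>\<close>, the borderline
      case of the smallness condition.\<close>
    define \<epsilon> where "\<epsilon> = (\<bar>\<theta>\<bar> / 2 powr p) powr (1 / (p - 1))"
    have \<epsilon>: "0 < \<epsilon>" using \<theta> by (simp add: \<epsilon>_def)
    have "\<epsilon> powr (p - 1) = \<bar>\<theta>\<bar> / 2 powr p" using \<theta> assms(4) by (simp add: \<epsilon>_def powr_powr)
    then have "(2 * \<epsilon>) powr p = \<bar>\<theta>\<bar> * \<epsilon>"
      using \<epsilon> powr_add[of \<epsilon> "p - 1" 1] by (simp add: powr_mult field_simps)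
    then have "\<not> blows_up_in_finite_time \<sigma> (\<lambda>t. exp (\<theta> * t)) (\<lambda>r. r powr p) (\<lambda>x::real^'d. \<epsilon> * exp (- (norm x)\<^sup>2))"
      using \<epsilon> by (intro global_of_negative_rate[OF assms(1,2,4) \<theta> gaussian_in_C0, of \<epsilon> \<epsilon>])
        (auto simp: mult_left_le)
    then show False using all gaussian_in_C0[OF \<epsilon>] gaussian_integrable[OF \<epsilon>] \<epsilon> by auto
  qed
qed

end
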